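(* Let $D\subset(\mathbb C^n,0)$, $n\ge1$, be a reduced hypersurface singularity with $\operatorname{Der}(-\log D)\subset\mathfrak m\cdot\operatorname{Der}_{\mathbb C}(\mathcal O)$. If $D$ is an isolated singularity of order at least $3$, then the initial logarithmic Lie algebra $\overline{\mathfrak l}_D$ is solvable.
   Context: $\mathcal O$ is the local ring of convergent power series at $0\in\mathbb C^n$, with maximal ideal $\mathfrak m$; $D=\{f=0\}$ with $f\in\mathfrak m$ reduced; $\mathfrak l_D=\operatorname{Der}(-\log D)=\{\theta\in\operatorname{Der}_{\mathbb C}(\mathcal O)\mid\theta(f)\in\mathcal O\cdot f\}$ is the module of logarithmic vector fields. Standing assumption: $\mathfrak l_D\subset\mathfrak m\cdot\operatorname{Der}_{\mathbb C}(\mathcal O)$. Under it, the commutator of vector fields makes $\overline{\mathfrak l}_D:=\mathfrak l_D/\mathfrak m\cdot\mathfrak l_D$ a finite-dimensional complex Lie algebra, the initial logarithmic Lie algebra of $D$. The order of $D$ is the maximal $k$ with $f\in\mathfrak m^k$. $D$ is an isolated singularity if its singular locus is $\{0\}$ (as a germ). *)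

theory Defs
  imports
    "HOL-Analysis.Analysis"
    "HOL-Library.Function_Algebras"
    "HOL-Algebra.Algebraic_Closure_Type"
begin

section \<open>Convergent power series\<close>

text \<open>
  A monomial in the variables indexed by the finite type \<open>'n\<close> is its exponent function
  \<open>m :: 'n \<Rightarrow> nat\<close>.  Exponents are added, subtracted and compared pointwise.
\<close>

definition mdeg :: "('n::finite \<Rightarrow> nat) \<Rightarrow> nat" where
  "mdeg m = (\<Sum>i\<in>UNIV. m i)"

definition cps_convergent :: "(('n::finite \<Rightarrow> nat) \<Rightarrow> complex) \<Rightarrow> bool" where
  "cps_convergent a \<longleftrightarrow> (\<exists>r>0. (\<lambda>m. norm (a m) * r ^ mdeg m) summable_on UNIV)"

lemma mdeg_add: "mdeg (a + b) = mdeg a + mdeg b"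
  by (simp add: mdeg_def sum.distrib)

lemma mdeg_0 [simp]: "mdeg 0 = 0"
  by (simp add: mdeg_def)

lemma mdeg_diff: "a \<le> m \<Longrightarrow> mdeg a + mdeg (m - a) = mdeg m"
  by (simp add: mdeg_def le_fun_def flip: sum.distrib)

lemma diff_diff_fun: "a \<le> m \<Longrightarrow> m - (m - a) = (a :: 'n \<Rightarrow> nat)"
  by (simp add: le_fun_def fun_eq_iff)

lemma atMost_fun_PiE: "{..m :: 'n::finite \<Rightarrow> nat} = PiE UNIV (\<lambda>i. {..m i})"
  by (auto simp: le_fun_def PiE_UNIV_domain Pi_iff)

lemma finite_atMost_fun [simp]: "finite {..m :: 'n::finite \<Rightarrow> nat}"
  by (simp add: atMost_fun_PiE finite_PiE)

lemma card_atMost_fun: "card {..m :: 'n::finite \<Rightarrow> nat} \<le> 2 ^ mdeg m"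
proof -
  have "card {..m} = (\<Prod>i\<in>UNIV. Suc (m i))"
    by (simp add: atMost_fun_PiE card_PiE)
  also have "\<dots> \<le> (\<Prod>i\<in>UNIV. 2 ^ m i)"
    by (intro prod_mono) (auto simp: Suc_le_eq)
  also have "\<dots> = 2 ^ mdeg m"
    by (simp add: mdeg_def power_sum)
  finally show ?thesis .
qed

lemma summable_half_mdeg: "(\<lambda>m :: 'n::finite \<Rightarrow> nat. (1/2::real) ^ mdeg m) summable_on UNIV"
proof -
  have *: "(\<lambda>k. (1/2::real) ^ k) summable_on (UNIV :: nat set)"
    by (rule norm_summable_imp_summable_on) (simp add: summable_geometric)
  hence "Infinite_Sum.abs_summable_on (\<lambda>k. (1/2::real) ^ k) (UNIV :: nat set)"
    by simp
  hence "Infinite_Set_Sum.abs_summable_on (\<lambda>k. (1/2::real) ^ k) (UNIV :: nat set)"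
    by (simp only: abs_summable_equivalent)
  hence "Infinite_Set_Sum.abs_summable_on (\<lambda>m. \<Prod>i\<in>UNIV. (1/2::real) ^ m i)
           (PiE (UNIV :: 'n set) (\<lambda>_. UNIV :: nat set))"
    by (intro abs_summable_on_prod_PiE) auto
  hence "Infinite_Sum.abs_summable_on (\<lambda>m. \<Prod>i\<in>UNIV. (1/2::real) ^ m i)
           (PiE (UNIV :: 'n set) (\<lambda>_. UNIV :: nat set))"
    by (simp only: abs_summable_equivalent)
  moreover have "(\<lambda>m::'n \<Rightarrow> nat. norm (\<Prod>i\<in>UNIV. (1/2::real) ^ m i)) = (\<lambda>m. (1/2) ^ mdeg m)"
    by (simp add: mdeg_def flip: power_sum)
  ultimately show ?thesis
    by (simp add: PiE_UNIV_domain)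
qed

lemma cps_convergent_iff:
  "cps_convergent a \<longleftrightarrow> (\<exists>C R. 1 \<le> R \<and> (\<forall>m. norm (a m) \<le> C * R ^ mdeg m))"
proof
  assume "cps_convergent a"
  then obtain r where r: "r > 0" "(\<lambda>m. norm (a m) * r ^ mdeg m) summable_on UNIV"
    by (auto simp: cps_convergent_def)
  define C where "C = infsum (\<lambda>m. norm (a m) * r ^ mdeg m) UNIV"
  have C: "norm (a m) * r ^ mdeg m \<le> C" for m
    using finite_sum_le_infsum[OF r(2), of "{m}"] r(1) by (simp add: C_def)
  have "0 \<le> C"
    using C[of 0] by (metis norm_ge_zero order_trans mdeg_0 mult.right_neutral power_0)
  have "norm (a m) \<le> C * (max 1 (1/r)) ^ mdeg m" for m
  proof -
    have "norm (a m) \<le> C * (1/r) ^ mdeg m"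
      using C[of m] r(1) by (simp add: field_simps power_divide)
    also have "\<dots> \<le> C * (max 1 (1/r)) ^ mdeg m"
      using r(1) \<open>0 \<le> C\<close> by (intro mult_left_mono power_mono) auto
    finally show ?thesis .
  qed
  thus "\<exists>C R. 1 \<le> R \<and> (\<forall>m. norm (a m) \<le> C * R ^ mdeg m)"
    by (intro exI[of _ C] exI[of _ "max 1 (1/r)"]) auto
next
  assume "\<exists>C R. 1 \<le> R \<and> (\<forall>m. norm (a m) \<le> C * R ^ mdeg m)"
  then obtain C R where CR: "1 \<le> R" "\<And>m. norm (a m) \<le> C * R ^ mdeg m" by blast
  have "(\<lambda>m. C * (1/2) ^ mdeg m) summable_on (UNIV :: ('a \<Rightarrow> nat) set)"
    by (intro summable_on_cmult_right summable_half_mdeg)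
  hence "(\<lambda>m. norm (a m) * (1/(2*R)) ^ mdeg m) summable_on UNIV"
  proof (rule summable_on_comparison_test)
    fix m
    have "norm (a m) * (1/(2*R)) ^ mdeg m \<le> (C * R ^ mdeg m) * (1/(2*R)) ^ mdeg m"
      using CR by (intro mult_right_mono) auto
    also have "\<dots> = C * (R * (1/(2*R))) ^ mdeg m"
      by (simp only: power_mult_distrib mult.assoc)
    also have "R * (1/(2*R)) = 1/2" using CR(1) by simp
    finally show "norm (a m) * (1/(2*R)) ^ mdeg m \<le> C * (1/2) ^ mdeg m" .
  qed (use CR in auto)
  thus "cps_convergent a"
    unfolding cps_convergent_def using CR(1) by (intro exI[of _ "1/(2*R)"]) auto
qed

lemma cps_convergentI:
  assumes "1 \<le> R" "\<And>m. norm (a m) \<le> C * R ^ mdeg m"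
  shows "cps_convergent a"
  using assms cps_convergent_iff by blast

lemma cps_convergent_common:
  fixes a b :: "('n::finite \<Rightarrow> nat) \<Rightarrow> complex"
  assumes "cps_convergent a" "cps_convergent b"
  obtains C R where "0 \<le> C" "1 \<le> R" "\<And>m. norm (a m) \<le> C * R ^ mdeg m"
    "\<And>m. norm (b m) \<le> C * R ^ mdeg m"
proof -
  from assms obtain C R C' R' where *: "1 \<le> R" "\<And>m. norm (a m) \<le> C * R ^ mdeg m"
     "1 \<le> R'" "\<And>m. norm (b m) \<le> C' * R' ^ mdeg m"
    unfolding cps_convergent_iff by metis
  have "0 \<le> C" "0 \<le> C'"
    using *(2)[of 0] *(4)[of 0] by (auto intro: order_trans[OF norm_ge_zero])
  have "C * R ^ mdeg m \<le> max C C' * max R R' ^ mdeg m" for m :: "'n \<Rightarrow> nat"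
    using * \<open>0 \<le> C\<close> by (intro mult_mono power_mono) auto
  moreover have "C' * R' ^ mdeg m \<le> max C C' * max R R' ^ mdeg m" for m :: "'n \<Rightarrow> nat"
    using * \<open>0 \<le> C'\<close> by (intro mult_mono power_mono) auto
  ultimately show thesis
    using *(1,3) \<open>0 \<le> C\<close>
      order_trans[OF *(2)] order_trans[OF *(4)]
    by (intro that[of "max C C'" "max R R'"]) auto
qed

lemma cps_convergent_finite_support:
  assumes "\<And>m. m \<noteq> m0 \<Longrightarrow> a m = 0"
  shows "cps_convergent a"
proof (rule cps_convergentI[of 1 _ "norm (a m0)"])
  show "norm (a m) \<le> norm (a m0) * 1 ^ mdeg m" for m
    using assms[of m] by (cases "m = m0") auto
qed simp

lemma cps_convergent_add:
  assumes "cps_convergent a" "cps_convergent b"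
  shows "cps_convergent (\<lambda>m. a m + b m)"
proof -
  obtain C R where CR: "1 \<le> R" "\<And>m. norm (a m) \<le> C * R ^ mdeg m"
    "\<And>m. norm (b m) \<le> C * R ^ mdeg m"
    using cps_convergent_common[OF assms] by metis
  have "norm (a m + b m) \<le> (2 * C) * R ^ mdeg m" for m
    using CR(2)[of m] CR(3)[of m] norm_triangle_ineq[of "a m" "b m"] by simp
  thus ?thesis using CR(1) by (rule cps_convergentI[rotated])
qed

lemma cps_convergent_uminus: "cps_convergent a \<Longrightarrow> cps_convergent (\<lambda>m. - a m)"
  by (simp add: cps_convergent_def)

lemma cps_convergent_mult:
  assumes "cps_convergent a" "cps_convergent b"
  shows "cps_convergent (\<lambda>m. \<Sum>k\<in>{..m}. a k * b (m - k))"
proof -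
  obtain C R where CR: "0 \<le> C" "1 \<le> R" "\<And>m. norm (a m) \<le> C * R ^ mdeg m"
    "\<And>m. norm (b m) \<le> C * R ^ mdeg m"
    using cps_convergent_common[OF assms] by metis
  have "norm (\<Sum>k\<in>{..m}. a k * b (m - k)) \<le> C\<^sup>2 * (2 * R) ^ mdeg m" for m
  proof -
    have "norm (\<Sum>k\<in>{..m}. a k * b (m - k)) \<le> (\<Sum>k\<in>{..m}. C\<^sup>2 * R ^ mdeg m)"
    proof (rule sum_norm_le)
      fix k assume "k \<in> {..m}"
      have "norm (a k * b (m - k)) \<le> (C * R ^ mdeg k) * (C * R ^ mdeg (m - k))"
        unfolding norm_mult using CR by (intro mult_mono) auto
      also have "\<dots> = C\<^sup>2 * R ^ (mdeg k + mdeg (m - k))"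
        by (simp add: power_add power2_eq_square)
      finally show "norm (a k * b (m - k)) \<le> C\<^sup>2 * R ^ mdeg m"
        using \<open>k \<in> {..m}\<close> by (simp add: mdeg_diff)
    qed
    also have "\<dots> = real (card {..m}) * (C\<^sup>2 * R ^ mdeg m)"
      by simp
    also have "\<dots> \<le> 2 ^ mdeg m * (C\<^sup>2 * R ^ mdeg m)"
      using card_atMost_fun[of m] CR
      by (intro mult_right_mono) (auto simp: of_nat_le_numeral_power_cancel_iff)
    finally show ?thesis by (simp add: power_mult_distrib mult_ac)
  qed
  thus ?thesis using CR(2) by (intro cps_convergentI[of "2 * R" _ "C\<^sup>2"]) auto
qed

lemma mdeg_upd_Suc: "mdeg (m(i := Suc (m i))) = Suc (mdeg m)"
proof -
  have "m(i := Suc (m i)) = m + (\<lambda>j. if j = i then 1 else 0)"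
    by (auto simp: fun_eq_iff)
  thus ?thesis by (simp add: mdeg_add) (simp add: mdeg_def)
qed

lemma cps_convergent_pderiv:
  assumes "cps_convergent a"
  shows "cps_convergent (\<lambda>m. of_nat (Suc (m i)) * a (m(i := Suc (m i))))"
proof -
  obtain C R where CR: "1 \<le> R" "\<And>m. norm (a m) \<le> C * R ^ mdeg m"
    using assms by (auto simp: cps_convergent_iff)
  have "0 \<le> C" using CR(2)[of 0] by (auto intro: order_trans[OF norm_ge_zero])
  have "norm (of_nat (Suc (m i)) * a (m(i := Suc (m i)))) \<le> (C * R) * (2 * R) ^ mdeg m" for m
  proof -
    have "m i \<le> mdeg m" unfolding mdeg_def by (rule member_le_sum) auto
    hence "Suc (m i) \<le> 2 ^ mdeg m"
      by (meson Suc_leI less_exp order_le_less_trans)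
    hence "real (Suc (m i)) \<le> 2 ^ mdeg m"
      by (metis of_nat_le_iff of_nat_numeral of_nat_power)
    hence "norm (of_nat (Suc (m i)) * a (m(i := Suc (m i)))) \<le> 2 ^ mdeg m * (C * R ^ Suc (mdeg m))"
      unfolding norm_mult norm_of_nat mdeg_upd_Suc[symmetric, of m i]
      by (intro mult_mono CR(2)) (auto simp: mdeg_upd_Suc)
    thus ?thesis by (simp add: power_mult_distrib mult_ac)
  qed
  thus ?thesis using CR(1) by (intro cps_convergentI[of "2 * R" _ "C * R"]) auto
qed

typedef 'n cps = "{a :: ('n::finite \<Rightarrow> nat) \<Rightarrow> complex. cps_convergent a}"
  morphisms cps_coeff Abs_cps
  by (rule exI[of _ "\<lambda>_. 0"]) (auto intro!: cps_convergent_finite_support)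

setup_lifting type_definition_cps

lemma cps_eqI: "(\<And>m. cps_coeff f m = cps_coeff g m) \<Longrightarrow> f = g"
  by (metis cps_coeff_inject ext)

lift_definition cps_const :: "complex \<Rightarrow> 'n::finite cps"
  is "\<lambda>c m. if m = 0 then c else 0"
  by (rule cps_convergent_finite_support[of 0]) simp

lift_definition cps_pderiv :: "'n::finite \<Rightarrow> 'n cps \<Rightarrow> 'n cps"
  is "\<lambda>i a m. of_nat (Suc (m i)) * a (m(i := Suc (m i)))"
  by (rule cps_convergent_pderiv)

text \<open>Only meaningful for \<open>z\<close> close to \<open>0\<close>, where the series converges absolutely.\<close>

definition cps_eval :: "'n::finite cps \<Rightarrow> complex ^ 'n \<Rightarrow> complex" where
  "cps_eval f z = (\<Sum>\<^sub>\<infinity>m. cps_coeff f m * (\<Prod>i\<in>UNIV. (z $ i) ^ m i))"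

lemma conv_assoc:
  fixes a b c :: "('n::finite \<Rightarrow> nat) \<Rightarrow> complex"
  shows "(\<Sum>k\<in>{..m}. (\<Sum>j\<in>{..k}. a j * b (k - j)) * c (m - k)) =
         (\<Sum>j\<in>{..m}. a j * (\<Sum>k\<in>{..m - j}. b k * c (m - j - k)))"
proof -
  have "(\<Sum>k\<in>{..m}. (\<Sum>j\<in>{..k}. a j * b (k - j)) * c (m - k)) =
        (\<Sum>(k, j)\<in>(SIGMA k:{..m}. {..k}). a j * b (k - j) * c (m - k))"
    by (simp add: sum_distrib_right sum.Sigma)
  also have "\<dots> = (\<Sum>(j, k)\<in>(SIGMA j:{..m}. {..m - j}). a j * (b k * c (m - j - k)))"
  proof (rule sum.reindex_bij_witness
      [where i = "\<lambda>(j, k). (j + k, j)" and j = "\<lambda>(k, j). (j, k - j)"], goal_cases)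
    case (1 p)
    thus ?case by (auto simp: le_fun_def fun_eq_iff)
  next
    case (2 p)
    thus ?case by (auto simp: le_fun_def diff_le_mono intro: order_trans)
  next
    case (3 p)
    thus ?case by (auto simp: fun_eq_iff)
  next
    case (4 p)
    obtain j k where p: "p = (j, k)" by force
    have "j i + k i \<le> m i" for i
    proof -
      have "j i \<le> m i" "k i \<le> m i - j i"
        using 4 by (auto simp: p le_fun_def)
      thus ?thesis by linarith
    qed
    thus ?case by (auto simp: p le_fun_def)
  next
    case (5 p)
    obtain k j where p: "p = (k, j)" by force
    have "k i \<le> m i" "j i \<le> k i" for i
      using 5 by (auto simp: p le_fun_def)
    hence "m - j - (k - j) = m - k"
      by (simp add: fun_eq_iff)
    thus ?case by (simp add: p)
  qed
  also have "\<dots> = (\<Sum>j\<in>{..m}. a j * (\<Sum>k\<in>{..m - j}. b k * c (m - j - k)))"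
    by (simp add: sum_distrib_left sum.Sigma)
  finally show ?thesis .
qed

instantiation cps :: (finite) comm_ring_1
begin

lift_definition zero_cps :: "'a cps" is "\<lambda>_. 0"
  by (auto intro!: cps_convergent_finite_support)
definition one_cps :: "'a cps" where "one_cps = cps_const 1"
lift_definition plus_cps :: "'a cps \<Rightarrow> 'a cps \<Rightarrow> 'a cps" is "\<lambda>a b m. a m + b m"
  by (rule cps_convergent_add)
lift_definition uminus_cps :: "'a cps \<Rightarrow> 'a cps" is "\<lambda>a m. - a m"
  by (rule cps_convergent_uminus)
lift_definition minus_cps :: "'a cps \<Rightarrow> 'a cps \<Rightarrow> 'a cps" is "\<lambda>a b m. a m - b m"
  using cps_convergent_add[OF _ cps_convergent_uminus] by simp
lift_definition times_cps :: "'a cps \<Rightarrow> 'a cps \<Rightarrow> 'a cps"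
  is "\<lambda>a b m. \<Sum>k\<in>{..m}. a k * b (m - k)"
  by (rule cps_convergent_mult)

instance
proof
  fix f g h :: "'a cps"
  show "f * g * h = f * (g * h)"
    by transfer (simp add: conv_assoc)
  show *: "f * g = g * f" for f g :: "'a cps"
    apply transfer
    apply (rule ext)
    subgoal for a b m
      by (rule sum.reindex_bij_witness[where i = "\<lambda>k. m - k" and j = "\<lambda>k. m - k"])
         (auto simp: diff_diff_fun mult.commute, auto simp: le_fun_def)
    done
  show "1 * f = f"
  proof (rule cps_eqI)
    fix m
    have "cps_coeff (1 * f) m = (\<Sum>k\<in>{..m}. (if k = 0 then 1 else 0) * cps_coeff f (m - k))"
      by (simp add: one_cps_def times_cps.rep_eq cps_const.rep_eq)
    also have "\<dots> = (\<Sum>k\<in>{..m}. if k = 0 then cps_coeff f (m - k) else 0)"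
      by (rule sum.cong) auto
    also have "\<dots> = cps_coeff f m"
      by (subst sum.delta) (auto simp: le_fun_def fun_diff_def)
    finally show "cps_coeff (1 * f) m = cps_coeff f m" .
  qed
  show "(f + g) * h = f * h + g * h"
    by transfer (simp add: distrib_right sum.distrib)
  show "(0 :: 'a cps) \<noteq> 1"
  proof
    assume "(0 :: 'a cps) = 1"
    hence "cps_coeff (0 :: 'a cps) 0 = cps_coeff (1 :: 'a cps) 0" by simp
    thus False by (simp add: zero_cps.rep_eq one_cps_def cps_const.rep_eq)
  qed
qed (transfer; simp add: algebra_simps)+

end


section \<open>Ideals and vector fields\<close>

text \<open>
  For an ideal \<open>I\<close> of scalars and a submodule \<open>M\<close>, the submodule \<open>I \<cdot> M\<close> generated by the
  products, with respect to the scalar multiplication \<open>sm\<close>.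
\<close>

definition ideal_smult ::
  "('r::comm_ring_1 \<Rightarrow> 'm::ab_group_add \<Rightarrow> 'm) \<Rightarrow> 'r set \<Rightarrow> 'm set \<Rightarrow> 'm set" where
  "ideal_smult sm I M = module.span sm {sm a x | a x. a \<in> I \<and> x \<in> M}"

definition cps_max_ideal :: "'n::finite cps set" where
  "cps_max_ideal = {f. cps_coeff f 0 = 0}"

primrec cps_max_ideal_power :: "nat \<Rightarrow> 'n::finite cps set" where
  "cps_max_ideal_power 0 = UNIV"
| "cps_max_ideal_power (Suc k) = ideal_smult (*) cps_max_ideal (cps_max_ideal_power k)"

definition vf_scale :: "'n::finite cps \<Rightarrow> ('n cps \<Rightarrow> 'n cps) \<Rightarrow> 'n cps \<Rightarrow> 'n cps" where
  "vf_scale g \<theta> = (\<lambda>h. g * \<theta> h)"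

definition vf_bracket ::
  "('n::finite cps \<Rightarrow> 'n cps) \<Rightarrow> ('n cps \<Rightarrow> 'n cps) \<Rightarrow> 'n cps \<Rightarrow> 'n cps" where
  "vf_bracket \<theta> \<eta> = (\<lambda>h. \<theta> (\<eta> h) - \<eta> (\<theta> h))"

text \<open>The complex-linear derivations of the ring of convergent power series.\<close>

definition cps_Der :: "('n::finite cps \<Rightarrow> 'n cps) set" where
  "cps_Der = {\<theta>. (\<forall>g h. \<theta> (g + h) = \<theta> g + \<theta> h) \<and>
                 (\<forall>c g. \<theta> (cps_const c * g) = cps_const c * \<theta> g) \<and>
                 (\<forall>g h. \<theta> (g * h) = \<theta> g * h + g * \<theta> h)}"

definition log_Der :: "'n::finite cps \<Rightarrow> ('n cps \<Rightarrow> 'n cps) set" where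
  "log_Der f = {\<theta> \<in> cps_Der. f dvd \<theta> f}"


section \<open>Lie algebras\<close>

text \<open>
  A Lie algebra over \<open>R\<close> is a module whose otherwise unused multiplication field holds the
  bracket; the field \<open>one\<close> is irrelevant.
\<close>

locale lie_algebra = Module.module R L for R (structure) and L (structure) +
  assumes bracket_closed [simp, intro]:
      "\<lbrakk>x \<in> carrier L; y \<in> carrier L\<rbrakk> \<Longrightarrow> x \<otimes>\<^bsub>L\<^esub> y \<in> carrier L"
    and bracket_add_left:
      "\<lbrakk>x \<in> carrier L; y \<in> carrier L; z \<in> carrier L\<rbrakk> \<Longrightarrow>
        (x \<oplus>\<^bsub>L\<^esub> y) \<otimes>\<^bsub>L\<^esub> z = x \<otimes>\<^bsub>L\<^esub> z \<oplus>\<^bsub>L\<^esub> y \<otimes>\<^bsub>L\<^esub> z"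
    and bracket_add_right:
      "\<lbrakk>x \<in> carrier L; y \<in> carrier L; z \<in> carrier L\<rbrakk> \<Longrightarrow>
        z \<otimes>\<^bsub>L\<^esub> (x \<oplus>\<^bsub>L\<^esub> y) = z \<otimes>\<^bsub>L\<^esub> x \<oplus>\<^bsub>L\<^esub> z \<otimes>\<^bsub>L\<^esub> y"
    and bracket_smult_left:
      "\<lbrakk>a \<in> carrier R; x \<in> carrier L; y \<in> carrier L\<rbrakk> \<Longrightarrow>
        (a \<odot>\<^bsub>L\<^esub> x) \<otimes>\<^bsub>L\<^esub> y = a \<odot>\<^bsub>L\<^esub> (x \<otimes>\<^bsub>L\<^esub> y)"
    and bracket_smult_right:
      "\<lbrakk>a \<in> carrier R; x \<in> carrier L; y \<in> carrier L\<rbrakk> \<Longrightarrow>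
        x \<otimes>\<^bsub>L\<^esub> (a \<odot>\<^bsub>L\<^esub> y) = a \<odot>\<^bsub>L\<^esub> (x \<otimes>\<^bsub>L\<^esub> y)"
    and bracket_self: "x \<in> carrier L \<Longrightarrow> x \<otimes>\<^bsub>L\<^esub> x = \<zero>\<^bsub>L\<^esub>"
    and jacobi:
      "\<lbrakk>x \<in> carrier L; y \<in> carrier L; z \<in> carrier L\<rbrakk> \<Longrightarrow>
        x \<otimes>\<^bsub>L\<^esub> (y \<otimes>\<^bsub>L\<^esub> z) \<oplus>\<^bsub>L\<^esub> y \<otimes>\<^bsub>L\<^esub> (z \<otimes>\<^bsub>L\<^esub> x) \<oplus>\<^bsub>L\<^esub> z \<otimes>\<^bsub>L\<^esub> (x \<otimes>\<^bsub>L\<^esub> y) = \<zero>\<^bsub>L\<^esub>"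

text \<open>The submodule \<open>[A, B]\<close> spanned by all brackets.\<close>

definition lie_bracket_span ::
  "('a, 'm) ring_scheme \<Rightarrow> ('a, 'b, 'c) module_scheme \<Rightarrow> 'b set \<Rightarrow> 'b set \<Rightarrow> 'b set" where
  "lie_bracket_span R L A B =
     \<Inter>{N. submodule N R L \<and> (\<forall>x\<in>A. \<forall>y\<in>B. x \<otimes>\<^bsub>L\<^esub> y \<in> N)}"

primrec lie_derived_series ::
  "('a, 'm) ring_scheme \<Rightarrow> ('a, 'b, 'c) module_scheme \<Rightarrow> nat \<Rightarrow> 'b set" where
  "lie_derived_series R L 0 = carrier L"
| "lie_derived_series R L (Suc k) =
     lie_bracket_span R L (lie_derived_series R L k) (lie_derived_series R L k)"

locale solvable_lie_algebra = lie_algebra +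
  assumes solvable: "\<exists>k. lie_derived_series R L k = {\<zero>\<^bsub>L\<^esub>}"

definition lie_quotient :: "('a, 'b, 'c) module_scheme \<Rightarrow> 'b set \<Rightarrow> ('a, 'b set) module" where
  "lie_quotient L I =
     \<lparr>carrier = a_rcosets\<^bsub>L\<^esub> I, mult = rcoset_mult L I, one = undefined, zero = I,
      add = set_add L, smult = (\<lambda>c A. \<Union>x\<in>A. I +>\<^bsub>L\<^esub> (c \<odot>\<^bsub>L\<^esub> x))\<rparr>"

locale lie_ideal = lie_algebra R L + submodule I R L
  for I and R (structure) and L (structure) +
  assumes bracket_left_closed: "\<lbrakk>x \<in> I; y \<in> carrier L\<rbrakk> \<Longrightarrow> x \<otimes>\<^bsub>L\<^esub> y \<in> I"
    and bracket_right_closed: "\<lbrakk>x \<in> carrier L; y \<in> I\<rbrakk> \<Longrightarrow> x \<otimes>\<^bsub>L\<^esub> y \<in> I"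
begin

lemma abelian_subgroup_I: "abelian_subgroup I L"
  by (intro abelian_subgroupI3 additive_subgroupI subgroup_axioms M.abelian_group_axioms)

end

sublocale lie_ideal \<subseteq> A?: abelian_subgroup I L
  by (rule abelian_subgroup_I)

context lie_ideal
begin

lemma coset_absorb:
  assumes "h \<in> I" "x \<in> carrier L"
  shows "I +>\<^bsub>L\<^esub> (h \<oplus>\<^bsub>L\<^esub> x) = I +>\<^bsub>L\<^esub> x"
  using a_repr_independence[OF a_rcosI[OF assms(1) a_subset assms(2)] assms(2) subgroup_axioms]
  by simp

lemma coset_elem:
  assumes "x' \<in> I +>\<^bsub>L\<^esub> x"
  obtains h where "h \<in> I" "x' = h \<oplus>\<^bsub>L\<^esub> x"
  using assms by (auto simp: a_r_coset_def r_coset_def)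

lemma coset_smult:
  assumes "c \<in> carrier R" "x \<in> carrier L"
  shows "(\<Union>x'\<in>I +>\<^bsub>L\<^esub> x. I +>\<^bsub>L\<^esub> (c \<odot>\<^bsub>L\<^esub> x')) = I +>\<^bsub>L\<^esub> (c \<odot>\<^bsub>L\<^esub> x)"
proof -
  have "I +>\<^bsub>L\<^esub> (c \<odot>\<^bsub>L\<^esub> x') = I +>\<^bsub>L\<^esub> (c \<odot>\<^bsub>L\<^esub> x)" if x': "x' \<in> I +>\<^bsub>L\<^esub> x" for x'
  proof -
    obtain h where h: "h \<in> I" "x' = h \<oplus>\<^bsub>L\<^esub> x" using x' by (rule coset_elem)
    have "h \<in> carrier L" using h(1) a_subset by blast
    thus ?thesis using assms h
      by (simp add: smult_r_distr coset_absorb smult_closed)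
  qed
  thus ?thesis by (intro UN_constant_eq[OF a_rcos_self[OF assms(2)]] ballI) assumption
qed

lemma coset_bracket:
  assumes "x \<in> carrier L" "y \<in> carrier L"
  shows "rcoset_mult L I (I +>\<^bsub>L\<^esub> x) (I +>\<^bsub>L\<^esub> y) = I +>\<^bsub>L\<^esub> (x \<otimes>\<^bsub>L\<^esub> y)"
proof -
  have "I +>\<^bsub>L\<^esub> (x' \<otimes>\<^bsub>L\<^esub> y') = I +>\<^bsub>L\<^esub> (x \<otimes>\<^bsub>L\<^esub> y)"
    if xy': "x' \<in> I +>\<^bsub>L\<^esub> x" "y' \<in> I +>\<^bsub>L\<^esub> y" for x' y'
  proof -
    obtain h where h: "h \<in> I" "x' = h \<oplus>\<^bsub>L\<^esub> x" using xy'(1) by (rule coset_elem)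
    obtain k where k: "k \<in> I" "y' = k \<oplus>\<^bsub>L\<^esub> y" using xy'(2) by (rule coset_elem)
    have carr: "h \<in> carrier L" "k \<in> carrier L" using h(1) k(1) a_subset by blast+
    have in_I: "h \<otimes>\<^bsub>L\<^esub> y' \<in> I" "x \<otimes>\<^bsub>L\<^esub> k \<in> I"
      using h k carr assms by (auto intro: bracket_left_closed bracket_right_closed)
    have "x' \<otimes>\<^bsub>L\<^esub> y' = h \<otimes>\<^bsub>L\<^esub> y' \<oplus>\<^bsub>L\<^esub> (x \<otimes>\<^bsub>L\<^esub> k \<oplus>\<^bsub>L\<^esub> x \<otimes>\<^bsub>L\<^esub> y)"
      unfolding h(2) using k carr assms bracket_add_left[of h x y'] bracket_add_right[of k y x]
      by simp
    thus ?thesis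
      using in_I carr assms by (simp add: coset_absorb)
  qed
  thus ?thesis
    unfolding rcoset_mult_def
    by (intro UN_constant_eq[OF a_rcos_self[OF assms(1)]]
        UN_constant_eq[OF a_rcos_self[OF assms(2)]] ballI) assumption
qed

lemma lie_quotient_carrier: "carrier (lie_quotient L I) = (\<lambda>x. I +>\<^bsub>L\<^esub> x) ` carrier L"
  by (auto simp: lie_quotient_def A_RCOSETS_def RCOSETS_def a_r_coset_def)

lemma lie_quotient_ops:
  "x \<in> carrier L \<Longrightarrow> y \<in> carrier L \<Longrightarrow>
     (I +>\<^bsub>L\<^esub> x) \<oplus>\<^bsub>lie_quotient L I\<^esub> (I +>\<^bsub>L\<^esub> y) = I +>\<^bsub>L\<^esub> (x \<oplus>\<^bsub>L\<^esub> y)"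
  "x \<in> carrier L \<Longrightarrow> y \<in> carrier L \<Longrightarrow>
     (I +>\<^bsub>L\<^esub> x) \<otimes>\<^bsub>lie_quotient L I\<^esub> (I +>\<^bsub>L\<^esub> y) = I +>\<^bsub>L\<^esub> (x \<otimes>\<^bsub>L\<^esub> y)"
  "c \<in> carrier R \<Longrightarrow> x \<in> carrier L \<Longrightarrow>
     c \<odot>\<^bsub>lie_quotient L I\<^esub> (I +>\<^bsub>L\<^esub> x) = I +>\<^bsub>L\<^esub> (c \<odot>\<^bsub>L\<^esub> x)"
  "\<zero>\<^bsub>lie_quotient L I\<^esub> = I +>\<^bsub>L\<^esub> \<zero>\<^bsub>L\<^esub>"
  using a_coset_add_zero[OF a_subset]
  by (simp_all add: lie_quotient_def a_rcos_sum coset_bracket coset_smult)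

lemma lie_algebra_lie_quotient: "lie_algebra R (lie_quotient L I)"
proof -
  let ?Q = "lie_quotient L I"
  have Q_cases: thesis
    if "A \<in> carrier ?Q" "\<And>x. x \<in> carrier L \<Longrightarrow> A = I +>\<^bsub>L\<^esub> x \<Longrightarrow> thesis" for A thesis
    using that by (auto simp: lie_quotient_carrier)
  have Q_mem: "I +>\<^bsub>L\<^esub> x \<in> carrier ?Q" if "x \<in> carrier L" for x
    using that by (simp add: lie_quotient_carrier)
  note ops = lie_quotient_ops Q_mem
  have "abelian_group ?Q"
  proof (rule abelian_groupI)
    show "\<zero>\<^bsub>?Q\<^esub> \<in> carrier ?Q"
      unfolding ops(4) by (rule Q_mem) simp
  next
    fix A B assume "A \<in> carrier ?Q" "B \<in> carrier ?Q"
    thus "A \<oplus>\<^bsub>?Q\<^esub> B \<in> carrier ?Q" "A \<oplus>\<^bsub>?Q\<^esub> B = B \<oplus>\<^bsub>?Q\<^esub> A"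
      by (auto elim!: Q_cases simp: ops M.a_comm)
  next
    fix A B C assume "A \<in> carrier ?Q" "B \<in> carrier ?Q" "C \<in> carrier ?Q"
    thus "A \<oplus>\<^bsub>?Q\<^esub> B \<oplus>\<^bsub>?Q\<^esub> C = A \<oplus>\<^bsub>?Q\<^esub> (B \<oplus>\<^bsub>?Q\<^esub> C)"
      by (elim Q_cases) (simp add: ops M.a_assoc)
  next
    fix A assume A: "A \<in> carrier ?Q"
    then obtain x where x: "x \<in> carrier L" "A = I +>\<^bsub>L\<^esub> x" by (rule Q_cases)
    show "\<zero>\<^bsub>?Q\<^esub> \<oplus>\<^bsub>?Q\<^esub> A = A"
      unfolding ops(4) x(2) using x(1) by (subst ops(1)) auto
    have "(I +>\<^bsub>L\<^esub> (\<ominus>\<^bsub>L\<^esub> x)) \<oplus>\<^bsub>?Q\<^esub> A = \<zero>\<^bsub>?Q\<^esub>"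
      unfolding ops(4) x(2) using x(1) by (subst ops(1)) (auto simp: M.l_neg)
    thus "\<exists>B\<in>carrier ?Q. B \<oplus>\<^bsub>?Q\<^esub> A = \<zero>\<^bsub>?Q\<^esub>"
      using Q_mem[of "\<ominus>\<^bsub>L\<^esub> x"] x(1) by auto
  qed
  with R.cring_axioms have "Module.module R ?Q"
    by (rule moduleI)
       (erule Q_cases | simp add: ops smult_l_distr smult_r_distr smult_assoc1)+
  moreover have "lie_algebra_axioms R ?Q"
  proof (rule lie_algebra_axioms.intro)
    fix A assume "A \<in> carrier ?Q"
    then obtain x where x: "x \<in> carrier L" "A = I +>\<^bsub>L\<^esub> x" by (rule Q_cases)
    show "A \<otimes>\<^bsub>?Q\<^esub> A = \<zero>\<^bsub>?Q\<^esub>"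
      unfolding ops(4) x(2) using x(1) by (subst ops(2)) (auto simp: bracket_self)
  next
    fix A B C assume "A \<in> carrier ?Q" "B \<in> carrier ?Q" "C \<in> carrier ?Q"
    then obtain x y z where xyz: "x \<in> carrier L" "y \<in> carrier L" "z \<in> carrier L"
      and eqs: "A = I +>\<^bsub>L\<^esub> x" "B = I +>\<^bsub>L\<^esub> y" "C = I +>\<^bsub>L\<^esub> z"
      by (metis Q_cases)
    show "(A \<oplus>\<^bsub>?Q\<^esub> B) \<otimes>\<^bsub>?Q\<^esub> C = A \<otimes>\<^bsub>?Q\<^esub> C \<oplus>\<^bsub>?Q\<^esub> B \<otimes>\<^bsub>?Q\<^esub> C"
      "C \<otimes>\<^bsub>?Q\<^esub> (A \<oplus>\<^bsub>?Q\<^esub> B) = C \<otimes>\<^bsub>?Q\<^esub> A \<oplus>\<^bsub>?Q\<^esub> C \<otimes>\<^bsub>?Q\<^esub> B"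
      unfolding eqs using xyz by (simp_all add: ops(1,2) bracket_add_left bracket_add_right)
    have "A \<otimes>\<^bsub>?Q\<^esub> (B \<otimes>\<^bsub>?Q\<^esub> C) \<oplus>\<^bsub>?Q\<^esub> B \<otimes>\<^bsub>?Q\<^esub> (C \<otimes>\<^bsub>?Q\<^esub> A) \<oplus>\<^bsub>?Q\<^esub> C \<otimes>\<^bsub>?Q\<^esub> (A \<otimes>\<^bsub>?Q\<^esub> B) =
        I +>\<^bsub>L\<^esub> (x \<otimes>\<^bsub>L\<^esub> (y \<otimes>\<^bsub>L\<^esub> z) \<oplus>\<^bsub>L\<^esub> y \<otimes>\<^bsub>L\<^esub> (z \<otimes>\<^bsub>L\<^esub> x) \<oplus>\<^bsub>L\<^esub> z \<otimes>\<^bsub>L\<^esub> (x \<otimes>\<^bsub>L\<^esub> y))"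
      unfolding eqs using xyz by (simp add: ops(1,2))
    thus "A \<otimes>\<^bsub>?Q\<^esub> (B \<otimes>\<^bsub>?Q\<^esub> C) \<oplus>\<^bsub>?Q\<^esub> B \<otimes>\<^bsub>?Q\<^esub> (C \<otimes>\<^bsub>?Q\<^esub> A) \<oplus>\<^bsub>?Q\<^esub> C \<otimes>\<^bsub>?Q\<^esub> (A \<otimes>\<^bsub>?Q\<^esub> B) =
        \<zero>\<^bsub>?Q\<^esub>"
      unfolding ops(4) jacobi[OF xyz] .
  next
    fix A B assume "A \<in> carrier ?Q" "B \<in> carrier ?Q"
    then obtain x y where xy: "x \<in> carrier L" "y \<in> carrier L"
      and eqs: "A = I +>\<^bsub>L\<^esub> x" "B = I +>\<^bsub>L\<^esub> y"
      by (metis Q_cases)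
    show "A \<otimes>\<^bsub>?Q\<^esub> B \<in> carrier ?Q"
      unfolding eqs using xy by (simp add: ops(2,5))
    fix c assume c: "c \<in> carrier R"
    show "(c \<odot>\<^bsub>?Q\<^esub> A) \<otimes>\<^bsub>?Q\<^esub> B = c \<odot>\<^bsub>?Q\<^esub> (A \<otimes>\<^bsub>?Q\<^esub> B)"
      "A \<otimes>\<^bsub>?Q\<^esub> (c \<odot>\<^bsub>?Q\<^esub> B) = c \<odot>\<^bsub>?Q\<^esub> (A \<otimes>\<^bsub>?Q\<^esub> B)"
      unfolding eqs using xy c
      by (simp_all add: ops(2,3) bracket_smult_left bracket_smult_right)
  qed
  ultimately show ?thesis by (rule lie_algebra.intro)
qed

end


section \<open>The initial logarithmic Lie algebra\<close>

abbreviation complex_ring :: "complex ring" where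
  "complex_ring \<equiv> ring_of_type_algebra"

definition vf_lie :: "('n::finite cps \<Rightarrow> 'n cps) set \<Rightarrow> (complex, 'n cps \<Rightarrow> 'n cps) module" where
  "vf_lie V =
     \<lparr>carrier = V, mult = vf_bracket, one = undefined, zero = 0,
      add = (+), smult = (\<lambda>c. vf_scale (cps_const c))\<rparr>"

definition initial_log_lie_algebra ::
  "'n::finite cps \<Rightarrow> (complex, ('n cps \<Rightarrow> 'n cps) set) module" where
  "initial_log_lie_algebra f =
     lie_quotient (vf_lie (log_Der f)) (ideal_smult vf_scale cps_max_ideal (log_Der f))"


lemma cps_DerI:
  assumes "\<And>g h. \<theta> (g + h) = \<theta> g + \<theta> h" "\<And>c g. \<theta> (cps_const c * g) = cps_const c * \<theta> g"
    "\<And>g h. \<theta> (g * h) = \<theta> g * h + g * \<theta> h"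
  shows "\<theta> \<in> cps_Der"
  unfolding cps_Der_def using assms by blast

lemma cps_DerD:
  assumes "\<theta> \<in> cps_Der"
  shows "\<theta> (g + h) = \<theta> g + \<theta> h" "\<theta> (cps_const c) = 0"
    "\<theta> (g * h) = \<theta> g * h + g * \<theta> h" "\<theta> (g - h) = \<theta> g - \<theta> h"
    "\<theta> 0 = 0" "\<theta> (- g) = - \<theta> g"
proof -
  have add: "\<theta> (g + h) = \<theta> g + \<theta> h" for g h
    using assms unfolding cps_Der_def by blast
  have mult: "\<theta> (g * h) = \<theta> g * h + g * \<theta> h" for g h
    using assms unfolding cps_Der_def by blast
  have scale: "\<theta> (cps_const c * g) = cps_const c * \<theta> g" for c g
    using assms unfolding cps_Der_def by blast
  show "\<theta> (g + h) = \<theta> g + \<theta> h" "\<theta> (g * h) = \<theta> g * h + g * \<theta> h"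
    by (fact add mult)+
  show "\<theta> (g - h) = \<theta> g - \<theta> h"
    using add[of "g - h" h] by simp
  show "\<theta> 0 = 0"
    using add[of 0 0] by simp
  thus "\<theta> (- g) = - \<theta> g"
    using add[of "- g" g] by (simp add: eq_neg_iff_add_eq_0)
  have "\<theta> 1 = 0" using mult[of 1 1] by simp
  thus "\<theta> (cps_const c) = 0" using scale[of c 1] by simp
qed

lemma log_DerD: "\<theta> \<in> log_Der f \<Longrightarrow> \<theta> \<in> cps_Der" "\<theta> \<in> log_Der f \<Longrightarrow> f dvd \<theta> f"
  by (simp_all add: log_Der_def)

lemma module_vf_scale: "Modules.module vf_scale"
  by unfold_locales (auto simp: vf_scale_def fun_eq_iff algebra_simps)

lemma module_span_subset:
  assumes "Modules.module sm" "0 \<in> N" "\<And>x y. x \<in> N \<Longrightarrow> y \<in> N \<Longrightarrow> x + y \<in> N"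
    "\<And>a x. x \<in> N \<Longrightarrow> sm a x \<in> N" "S \<subseteq> N"
  shows "module.span sm S \<subseteq> N"
proof (rule module.span_minimal[OF assms(1,5)])
  show "module.subspace sm N"
    by (rule module.subspaceI[OF assms(1)]) (fact assms)+
qed

lemma ideal_smult_induct [consumes 2, case_names gen zero add scale]:
  assumes "Modules.module sm" "x \<in> ideal_smult sm I M"
    and "\<And>a x. a \<in> I \<Longrightarrow> x \<in> M \<Longrightarrow> P (sm a x)"
    and "P 0" "\<And>x y. P x \<Longrightarrow> P y \<Longrightarrow> P (x + y)" "\<And>a x. P x \<Longrightarrow> P (sm a x)"
  shows "P x"
proof -
  have "module.span sm {sm a x | a x. a \<in> I \<and> x \<in> M} \<subseteq> Collect P"
    by (rule module_span_subset[OF assms(1)]) (use assms(3-6) in auto)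
  thus ?thesis using assms(2) unfolding ideal_smult_def by blast
qed

lemma ideal_smult_closed:
  assumes "Modules.module sm"
  shows "a \<in> I \<Longrightarrow> x \<in> M \<Longrightarrow> sm a x \<in> ideal_smult sm I M"
    "0 \<in> ideal_smult sm I M"
    "x \<in> ideal_smult sm I M \<Longrightarrow> y \<in> ideal_smult sm I M \<Longrightarrow> x + y \<in> ideal_smult sm I M"
    "x \<in> ideal_smult sm I M \<Longrightarrow> sm b x \<in> ideal_smult sm I M"
proof -
  show "a \<in> I \<Longrightarrow> x \<in> M \<Longrightarrow> sm a x \<in> ideal_smult sm I M"
    unfolding ideal_smult_def by (rule module.span_base[OF assms]) blast
  show "0 \<in> ideal_smult sm I M"
    unfolding ideal_smult_def by (rule module.span_zero[OF assms])
  show "x \<in> ideal_smult sm I M \<Longrightarrow> y \<in> ideal_smult sm I M \<Longrightarrow> x + y \<in> ideal_smult sm I M"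
    unfolding ideal_smult_def by (rule module.span_add[OF assms])
  show "x \<in> ideal_smult sm I M \<Longrightarrow> sm b x \<in> ideal_smult sm I M"
    unfolding ideal_smult_def by (rule module.span_scale[OF assms])
qed

lemma log_Der_closed:
  "0 \<in> log_Der f"
  "\<theta> \<in> log_Der f \<Longrightarrow> \<eta> \<in> log_Der f \<Longrightarrow> \<theta> + \<eta> \<in> log_Der f"
  "\<theta> \<in> log_Der f \<Longrightarrow> vf_scale g \<theta> \<in> log_Der f"
  "\<theta> \<in> log_Der f \<Longrightarrow> \<eta> \<in> log_Der f \<Longrightarrow> vf_bracket \<theta> \<eta> \<in> log_Der f"
proof -
  show "0 \<in> log_Der f"
    by (simp add: log_Der_def cps_DerI)
  show "\<theta> + \<eta> \<in> log_Der f" if "\<theta> \<in> log_Der f" "\<eta> \<in> log_Der f"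
  proof -
    note D = cps_DerD[OF log_DerD(1)[OF that(1)]] cps_DerD[OF log_DerD(1)[OF that(2)]]
    have "\<theta> + \<eta> \<in> cps_Der"
      by (rule cps_DerI) (simp_all add: D distrib_left distrib_right add_ac)
    thus ?thesis using that by (simp add: log_Der_def)
  qed
  show "vf_scale g \<theta> \<in> log_Der f" if "\<theta> \<in> log_Der f"
  proof -
    note D = cps_DerD[OF log_DerD(1)[OF that]]
    have "vf_scale g \<theta> \<in> cps_Der"
      by (rule cps_DerI) (simp_all add: D vf_scale_def distrib_left mult_ac)
    thus ?thesis using that by (simp add: log_Der_def vf_scale_def)
  qed
  show "vf_bracket \<theta> \<eta> \<in> log_Der f" if "\<theta> \<in> log_Der f" "\<eta> \<in> log_Der f"
  proof -
    note D = cps_DerD[OF log_DerD(1)[OF that(1)]] cps_DerD[OF log_DerD(1)[OF that(2)]]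
    have "vf_bracket \<theta> \<eta> \<in> cps_Der"
      by (rule cps_DerI) (simp_all add: vf_bracket_def D algebra_simps)
    moreover from log_DerD(2)[OF that(1)] log_DerD(2)[OF that(2)]
    obtain a b where "\<theta> f = f * a" "\<eta> f = f * b"
      by (elim dvdE)
    hence "f dvd \<theta> (\<eta> f) - \<eta> (\<theta> f)"
      by (simp add: D dvd_diff)
    ultimately show ?thesis by (simp add: log_Der_def vf_bracket_def)
  qed
qed

lemma cps_const_simps:
  "cps_const (a + b) = (cps_const a + cps_const b :: 'n::finite cps)"
  "cps_const (a * b) = (cps_const a * cps_const b :: 'n cps)"
  "cps_const 1 = (1 :: 'n cps)"
proof -
  show "cps_const (a + b) = (cps_const a + cps_const b :: 'n cps)"
    by (rule cps_eqI) (simp add: cps_const.rep_eq plus_cps.rep_eq)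
  show "cps_const (a * b) = (cps_const a * cps_const b :: 'n cps)"
  proof (rule cps_eqI)
    fix m :: "'n \<Rightarrow> nat"
    have "(\<Sum>k\<in>{..m}. (if k = 0 then a else 0) * (if m - k = 0 then b else 0)) =
          (\<Sum>k\<in>{..m}. if k = 0 then (if m - k = 0 then a * b else 0) else 0)"
      by (rule sum.cong) auto
    also have "\<dots> = (if m - 0 = 0 then a * b else 0)"
      by (subst sum.delta) (auto simp: le_fun_def)
    also have "m - 0 = m" by (simp add: fun_eq_iff)
    finally show "cps_coeff (cps_const (a * b)) m = cps_coeff (cps_const a * cps_const b) m"
      by (simp only: cps_const.rep_eq times_cps.rep_eq)
  qed
qed (simp add: one_cps_def)

lemma lie_algebra_log_Der: "lie_algebra complex_ring (vf_lie (log_Der f))"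
proof (intro lie_algebra.intro lie_algebra_axioms.intro moduleI)
  show "cring complex_ring" by (rule cring_from_type_algebra)
  show "abelian_group (vf_lie (log_Der f))"
  proof (rule abelian_groupI)
    fix \<theta> assume "\<theta> \<in> carrier (vf_lie (log_Der f))"
    hence "vf_scale (- 1) \<theta> \<in> log_Der f" by (simp add: vf_lie_def log_Der_closed)
    moreover have "vf_scale (- 1) \<theta> + \<theta> = 0" by (simp add: vf_scale_def fun_eq_iff)
    ultimately show "\<exists>\<eta>\<in>carrier (vf_lie (log_Der f)).
        \<eta> \<oplus>\<^bsub>vf_lie (log_Der f)\<^esub> \<theta> = \<zero>\<^bsub>vf_lie (log_Der f)\<^esub>"
      by (auto simp: vf_lie_def)
  qed (auto simp: vf_lie_def log_Der_closed add_ac)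
qed (simp_all add: vf_lie_def log_Der_closed ring_of_type_algebra_def,
     auto simp: vf_scale_def vf_bracket_def fun_eq_iff algebra_simps cps_const_simps
       cps_DerD[OF log_DerD(1)])

lemma vf_scale_bracket_mem:
  assumes der: "\<theta> \<in> log_Der f" "\<eta> \<in> log_Der f" and g: "g \<in> cps_max_ideal"
    and \<eta>: "\<And>h. h \<in> cps_max_ideal \<Longrightarrow> \<eta> h \<in> cps_max_ideal"
  shows "vf_bracket \<eta> (vf_scale g \<theta>) \<in>
           ideal_smult vf_scale cps_max_ideal (log_Der f)"
proof -
  have "vf_bracket \<eta> (vf_scale g \<theta>) =
        vf_scale g (vf_bracket \<eta> \<theta>) + vf_scale (\<eta> g) \<theta>"
    using cps_DerD[OF log_DerD(1)[OF der(2)]]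
    by (simp add: vf_scale_def vf_bracket_def fun_eq_iff algebra_simps)
  thus ?thesis
    using ideal_smult_closed[OF module_vf_scale] log_Der_closed der g \<eta>[OF g] by metis
qed

lemma max_ideal_Der_maps:
  fixes h :: "'n::finite cps"
  assumes "\<eta> \<in> ideal_smult vf_scale cps_max_ideal V"
  shows "\<eta> h \<in> cps_max_ideal"
proof -
  have mult: "cps_coeff (a * b) 0 = cps_coeff a 0 * cps_coeff b 0" for a b :: "'n cps"
  proof -
    have "{..0 :: 'n \<Rightarrow> nat} = {0}" by (auto simp: le_fun_def fun_eq_iff)
    thus ?thesis by (simp add: times_cps.rep_eq)
  qed
  show ?thesis
    using module_vf_scale assms
  proof (induction rule: ideal_smult_induct)
    case zero
    show ?case by (simp add: cps_max_ideal_def zero_cps.rep_eq)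
  qed (auto simp: cps_max_ideal_def vf_scale_def mult plus_cps.rep_eq)
qed

text \<open>Under the standing assumption the quotient is a Lie algebra.\<close>

lemma lie_algebra_initial_log_lie_algebra:
  assumes "log_Der f \<subseteq> ideal_smult vf_scale cps_max_ideal cps_Der"
  shows "lie_algebra complex_ring (initial_log_lie_algebra f)"
proof -
  interpret L: lie_algebra complex_ring "vf_lie (log_Der f)"
    by (rule lie_algebra_log_Der)
  define J where "J = ideal_smult vf_scale cps_max_ideal (log_Der f)"
  note closed = ideal_smult_closed[where I = cps_max_ideal and M = "log_Der f", OF module_vf_scale,
      folded J_def]
  have sub: "J \<subseteq> log_Der f"
  proof
    fix \<theta> assume "\<theta> \<in> J"
    with module_vf_scale show "\<theta> \<in> log_Der f"
      unfolding J_def by (induction rule: ideal_smult_induct) (blast intro: log_Der_closed)+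
  qed
  have br: "vf_bracket \<eta> \<theta> \<in> J" if \<theta>: "\<theta> \<in> J" and \<eta>: "\<eta> \<in> log_Der f" for \<theta> \<eta>
  proof -
    have maps: "\<eta> h \<in> cps_max_ideal" for h
      using assms \<eta> max_ideal_Der_maps by blast
    have *: "\<theta> \<in> J \<and> vf_bracket \<eta> \<theta> \<in> J"
      using module_vf_scale \<theta>[unfolded J_def]
    proof (induction rule: ideal_smult_induct)
      case (gen g \<theta>)
      thus ?case using vf_scale_bracket_mem[of \<theta> f \<eta> g] \<eta> maps closed(1) by (simp add: J_def)
    next
      case zero
      have "vf_bracket \<eta> 0 = 0"
        by (simp add: vf_bracket_def fun_eq_iff cps_DerD[OF log_DerD(1)[OF \<eta>]])
      thus ?case using closed(2) by metis
    next
      case (add \<theta> \<theta>')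
      have "vf_bracket \<eta> (\<theta> + \<theta>') = (vf_bracket \<eta> \<theta>) + (vf_bracket \<eta> \<theta>')"
        by (simp add: vf_bracket_def fun_eq_iff cps_DerD[OF log_DerD(1)[OF \<eta>]] algebra_simps)
      thus ?case using add closed(3) by metis
    next
      case (scale g \<theta>)
      have "vf_bracket \<eta> (vf_scale g \<theta>) =
            vf_scale g (vf_bracket \<eta> \<theta>) + vf_scale (\<eta> g) \<theta>"
        by (simp add: vf_scale_def vf_bracket_def fun_eq_iff cps_DerD[OF log_DerD(1)[OF \<eta>]] algebra_simps)
      thus ?case using scale closed(3,4) by metis
    qed
    thus ?thesis by simp
  qed
  have inv: "\<ominus>\<^bsub>vf_lie (log_Der f)\<^esub> \<theta> \<in> J" if "\<theta> \<in> J" for \<theta>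
  proof -
    have neg: "vf_scale (- 1) \<theta> \<in> J" by (rule closed(4)[OF that])
    have "vf_scale (- 1) \<theta> + \<theta> = 0" by (simp add: vf_scale_def fun_eq_iff)
    hence "\<ominus>\<^bsub>vf_lie (log_Der f)\<^esub> \<theta> = vf_scale (- 1) \<theta>"
      using neg that sub by (intro L.M.minus_equality) (auto simp: vf_lie_def)
    thus ?thesis using neg by simp
  qed
  have "lie_ideal J complex_ring (vf_lie (log_Der f))"
  proof (intro lie_ideal.intro lie_ideal_axioms.intro L.submoduleI)
    fix \<theta> \<eta> assume "\<theta> \<in> J" "\<eta> \<in> carrier (vf_lie (log_Der f))"
    hence "vf_scale (- 1) (vf_bracket \<eta> \<theta>) \<in> J"
      by (intro closed(4) br) (auto simp: vf_lie_def)
    also have "vf_scale (- 1) (vf_bracket \<eta> \<theta>) = vf_bracket \<theta> \<eta>"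
      by (simp add: vf_scale_def vf_bracket_def fun_eq_iff)
    finally show "\<theta> \<otimes>\<^bsub>vf_lie (log_Der f)\<^esub> \<eta> \<in> J"
      by (simp add: vf_lie_def)
  qed (use sub inv closed br lie_algebra_log_Der in \<open>auto simp: vf_lie_def\<close>)
  thus ?thesis
    unfolding initial_log_lie_algebra_def J_def by (rule lie_ideal.lie_algebra_lie_quotient)
qed


section \<open>Hypersurface germs\<close>

text \<open>The germ \<open>D = {f = 0}\<close> is reduced: \<open>f\<close> is nonzero and the quotient ring modulo \<open>f\<close> has no
  nonzero nilpotent elements.\<close>

definition cps_reduced :: "'n::finite cps \<Rightarrow> bool" where
  "cps_reduced f \<longleftrightarrow> f \<noteq> 0 \<and> (\<forall>g k. f dvd g ^ k \<longrightarrow> f dvd g)"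

text \<open>For \<open>f = 0\<close> the maximum does not exist and the value is unspecified.\<close>

definition cps_order :: "'n::finite cps \<Rightarrow> nat" where
  "cps_order f = (GREATEST k. f \<in> cps_max_ideal_power k)"

text \<open>
  For reduced \<open>f\<close> the singular locus of \<open>D\<close> is the common zero set of \<open>f\<close> and all its partial
  derivatives; it equals \<open>{0}\<close> as a germ.
\<close>

definition isolated_singularity :: "'n::finite cps \<Rightarrow> bool" where
  "isolated_singularity f \<longleftrightarrow>
     (\<forall>\<^sub>F z in nhds 0.
        cps_eval f z = 0 \<and> (\<forall>i. cps_eval (cps_pderiv i f) z = 0) \<longleftrightarrow> z = 0)"

end

theory Submission
  imports Defs
begin

no_notation fps_nth (infixl "$" 75)

text \<open>
  Let \<open>\<theta>\<close> be logarithmic with \<open>\<theta> f = g f\<close> and \<open>g \<in> \<mm>\<close>; this holds for all brackets.  Then the linear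
  part \<open>A\<close> of \<open>\<theta>\<close> is nilpotent.  Otherwise scale \<open>\<theta>\<close> so that an eigenvalue of maximal modulus is 1, with
  eigenvector \<open>v\<close>.  As no integer \<open>k \<ge> 2\<close> is an eigenvalue, there is a convergent arc
  \<open>\<gamma>(s) = v s + \<dots>\<close> with \<open>s \<gamma>' = \<theta>(\<gamma>)\<close>.  Along it \<open>u = f \<circ> \<gamma>\<close> satisfies \<open>s u' = (g \<circ> \<gamma>) u\<close>, so \<open>u = 0\<close>; and
  \<open>p = \<nabla>f \<circ> \<gamma>\<close>, which vanishes to order at least 2, satisfies \<open>s p' = (g - D\<theta>\<^sup>T) p\<close>, so \<open>p = 0\<close> since no
  \<open>-k\<close> with \<open>k \<ge> 2\<close> is an eigenvalue of \<open>A\<close>.  Hence \<open>D\<close> is singular along \<open>\<gamma>\<close>, a contradiction.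

  By Engel's theorem long products of such linear parts vanish, so the terms of the derived series
  eventually have no linear part, and from then on their order grows.  By the division theorem for
  convergent power series, logarithmic vector fields of high order lie in \<open>\<mm> \<cdot> Der(-log D)\<close>.
\<close>

section \<open>Orders, derivatives and derivations\<close>

text \<open>The quadric \<open>x^2 + y^2 + z^2\<close> shows the obstacle: its initial Lie algebra
  contains so(3). There the gradient along the arc starts in order 1 and may meet the eigenvalue -1,
  which scaling by an eigenvalue of maximal modulus cannot exclude; order at least 3 moves the start
  to order 2, beyond the spectral radius. Maximal modulus serves twice: it removes the resonances
  \<open>k \<ge> 2\<close> in the construction of the arc and the resonances \<open>-k\<close> in
  the equation for the gradient. A formal arc would not contradict
  \<open>isolated_singularity\<close>, which speaks of values at points near 0, so the arc is
  constructed in weighted norms that yield convergence.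

  The condition on \<open>g\<close> excludes Euler fields, whose linear part is not nilpotent; it is
  available only from the first bracket on. High order of a logarithmic field does not by itself
  exhibit it as a combination of logarithmic fields with coefficients in the maximal ideal. A
  statement of Artin-Rees type is needed, and division by finitely many elements supplies it with an
  explicit threshold.\<close>

definition mexp :: "'n \<Rightarrow> 'n::finite \<Rightarrow> nat" where
  "mexp i = (\<lambda>j. if j = i then 1 else 0)"

lemma mexp_simps [simp]: "mexp i i = 1" "j \<noteq> i \<Longrightarrow> mexp i j = 0" "mexp i \<noteq> 0" "0 \<noteq> mexp i"
  by (auto simp: mexp_def fun_eq_iff)

lemma mexp_eq_iff [simp]: "mexp i = mexp j \<longleftrightarrow> i = j"
  by (auto simp: mexp_def fun_eq_iff)

lemma add_mexp_eq_mexp_iff: "m + mexp i = mexp j \<longleftrightarrow> m = 0 \<and> i = j"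
proof
  assume *: "m + mexp i = mexp j"
  have "i = j" using fun_cong[OF *, of i] by (cases "i = j") auto
  thus "m = 0 \<and> i = j" using * by auto
qed auto

lemma upd_Suc_conv_mexp: "m(i := Suc (m i)) = m + mexp i"
  by (auto simp: fun_eq_iff mexp_def)

lemma mdeg_mexp [simp]: "mdeg (mexp i) = 1"
  by (simp add: mdeg_def mexp_def)

lemma mexp_le_iff: "mexp i \<le> m \<longleftrightarrow> m i \<noteq> 0"
  by (auto simp: le_fun_def mexp_def)

lemma le_mdeg: "m i \<le> mdeg m"
  unfolding mdeg_def by (rule member_le_sum) auto

lemma mdeg_mono: "k \<le> m \<Longrightarrow> mdeg k \<le> mdeg m"
  using mdeg_diff[of k m] by simp

lemma mdeg_eq_0_iff [simp]: "mdeg m = 0 \<longleftrightarrow> m = 0"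
  by (auto simp: mdeg_def fun_eq_iff)

lemma finite_mdeg_le [simp]: "finite {m :: 'n::finite \<Rightarrow> nat. mdeg m \<le> d}"
  by (rule finite_subset[of _ "{..(\<lambda>_. d)}"]) (auto simp: le_fun_def intro: order_trans[OF le_mdeg])

lift_definition cps_monom :: "('n::finite \<Rightarrow> nat) \<Rightarrow> 'n cps" is "\<lambda>k m. if m = k then 1 else 0"
  by (rule cps_convergent_finite_support) simp

abbreviation cps_var :: "'n::finite \<Rightarrow> 'n cps" where
  "cps_var i \<equiv> cps_monom (mexp i)"

lemmas cps_coeff_simps [simp] = zero_cps.rep_eq plus_cps.rep_eq minus_cps.rep_eq uminus_cps.rep_eq

lemma cps_coeff_sum [simp]: "cps_coeff (\<Sum>i\<in>A. f i) m = (\<Sum>i\<in>A. cps_coeff (f i) m)"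
  by (induction A rule: infinite_finite_induct) auto

lemma cps_coeff_times_0 [simp]:
  fixes f g :: "'n::finite cps"
  shows "cps_coeff (f * g) 0 = cps_coeff f 0 * cps_coeff g 0"
proof -
  have "{..0 :: 'n \<Rightarrow> nat} = {0}" by (auto simp: le_fun_def fun_eq_iff)
  thus ?thesis by (simp add: times_cps.rep_eq)
qed

lemma cps_coeff_monom_times:
  "cps_coeff (cps_monom k * h) m = (if k \<le> m then cps_coeff h (m - k) else 0)"
proof -
  have "cps_coeff (cps_monom k * h) m = (\<Sum>j\<in>{..m}. if j = k then cps_coeff h (m - j) else 0)"
    unfolding times_cps.rep_eq cps_monom.rep_eq by (intro sum.cong) auto
  thus ?thesis by (simp add: sum.delta')
qed

lemma cps_coeff_const_times [simp]: "cps_coeff (cps_const c * h) m = c * cps_coeff h m"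
proof -
  have "cps_coeff (cps_const c * h) m = (\<Sum>j\<in>{..m}. if j = 0 then c * cps_coeff h (m - j) else 0)"
    unfolding times_cps.rep_eq cps_const.rep_eq by (intro sum.cong) auto
  also have "m - 0 = m" for m :: "'a \<Rightarrow> nat" by (simp add: fun_eq_iff)
  ultimately show ?thesis by (simp add: sum.delta' le_fun_def)
qed

text \<open>Each nonconstant monomial is charged to one variable that divides it, chosen by
  \<open>idx\<close>, so every coefficient of \<open>f\<close> goes to exactly one quotient. The
  quotients keep the growth rate \<open>R\<close>; the shift only costs a factor \<open>R\<close> in
  the constant.\<close>

lemma hadamard:
  fixes f :: "'n::finite cps"
  obtains h where "f = cps_const (cps_coeff f 0) + (\<Sum>i\<in>UNIV. cps_var i * h i)"
proof -
  define idx where "idx m = (SOME i. m i \<noteq> 0)" for m :: "'n \<Rightarrow> nat"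
  have idx: "m (idx m) \<noteq> 0" if "m \<noteq> 0" for m
    unfolding idx_def by (rule someI_ex) (use that in \<open>auto simp: fun_eq_iff\<close>)
  define a where "a i m = (if idx (m + mexp i) = i then cps_coeff f (m + mexp i) else 0)" for i m
  have conv: "cps_convergent (a i)" for i
  proof -
    obtain C R where CR: "1 \<le> R" "\<And>m. norm (cps_coeff f m) \<le> C * R ^ mdeg m"
      using cps_coeff[of f] by (auto simp: cps_convergent_iff)
    have C: "0 \<le> C" using CR(2)[of 0] by (auto intro: order_trans[OF norm_ge_zero])
    show ?thesis
    proof (rule cps_convergentI[OF CR(1)])
      show "norm (a i m) \<le> (C * R) * R ^ mdeg m" for m
        using CR(2)[of "m + mexp i"] C CR(1) by (simp add: a_def mdeg_add mult_ac)
    qed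
  qed
  define h where "h i = Abs_cps (a i)" for i
  have h: "cps_coeff (h i) = a i" for i
    unfolding h_def by (rule Abs_cps_inverse) (use conv in auto)
  have "cps_coeff f m = cps_coeff (cps_const (cps_coeff f 0) + (\<Sum>i\<in>UNIV. cps_var i * h i)) m" for m
  proof (cases "m = 0")
    case True
    thus ?thesis by (simp add: cps_const.rep_eq cps_monom.rep_eq)
  next
    case False
    have m: "m - mexp i + mexp i = m" if "m i \<noteq> 0" for i
      using that by (auto simp: fun_eq_iff mexp_def)
    have "(\<Sum>i\<in>UNIV. cps_coeff (cps_var i * h i) m) = (\<Sum>i\<in>UNIV. if i = idx m then cps_coeff f m else 0)"
      by (rule sum.cong) (use m idx[OF False] in \<open>auto simp: cps_coeff_monom_times mexp_le_iff h a_def\<close>)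
    thus ?thesis using False by (simp add: cps_const.rep_eq)
  qed
  hence "f = cps_const (cps_coeff f 0) + (\<Sum>i\<in>UNIV. cps_var i * h i)" by (rule cps_eqI)
  thus thesis by (rule that)
qed

text \<open>Coefficientwise form of lying in the k-th power of the maximal ideal; unlike
  \<open>cps_order\<close> it is meaningful for 0 as well.\<close>

definition cps_ord_ge :: "nat \<Rightarrow> 'n::finite cps \<Rightarrow> bool" where
  "cps_ord_ge k f \<longleftrightarrow> (\<forall>m. mdeg m < k \<longrightarrow> cps_coeff f m = 0)"

lemma cps_ord_ge_0 [simp]: "cps_ord_ge 0 f"
  by (simp add: cps_ord_ge_def)

lemma cps_ord_ge_zero [simp]: "cps_ord_ge k 0"
  by (simp add: cps_ord_ge_def)

lemma cps_ord_ge_mono: "cps_ord_ge k f \<Longrightarrow> j \<le> k \<Longrightarrow> cps_ord_ge j f"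
  by (simp add: cps_ord_ge_def)

lemma cps_ord_ge_Suc_0: "cps_ord_ge (Suc 0) f \<longleftrightarrow> cps_coeff f 0 = 0"
  by (auto simp: cps_ord_ge_def)

lemma cps_ord_ge_add: "cps_ord_ge k f \<Longrightarrow> cps_ord_ge k g \<Longrightarrow> cps_ord_ge k (f + g)"
  by (simp add: cps_ord_ge_def)

lemma cps_ord_ge_diff: "cps_ord_ge k f \<Longrightarrow> cps_ord_ge k g \<Longrightarrow> cps_ord_ge k (f - g)"
  by (simp add: cps_ord_ge_def)

lemma cps_ord_ge_sum: "(\<And>i. i \<in> A \<Longrightarrow> cps_ord_ge k (f i)) \<Longrightarrow> cps_ord_ge k (\<Sum>i\<in>A. f i)"
  by (simp add: cps_ord_ge_def)

lemma cps_ord_ge_mult: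
  assumes "cps_ord_ge a f" "cps_ord_ge b g"
  shows "cps_ord_ge (a + b) (f * g)"
  unfolding cps_ord_ge_def
proof (intro allI impI)
  fix m :: "'a \<Rightarrow> nat" assume m: "mdeg m < a + b"
  have "cps_coeff f k * cps_coeff g (m - k) = 0" if "k \<le> m" for k
  proof -
    have "mdeg k < a \<or> mdeg (m - k) < b" using mdeg_diff[OF that] m by linarith
    thus ?thesis using assms by (auto simp: cps_ord_ge_def)
  qed
  thus "cps_coeff (f * g) m = 0"
    unfolding times_cps.rep_eq by (intro sum.neutral ballI) simp
qed

lemma cps_ord_ge_var: "cps_ord_ge (Suc 0) (cps_var i)"
  by (simp add: cps_ord_ge_Suc_0 cps_monom.rep_eq)

lemma cps_ord_ge_all_imp_0: "(\<And>k. cps_ord_ge k f) \<Longrightarrow> f = 0"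
  by (rule cps_eqI) (use lessI in \<open>auto simp: cps_ord_ge_def\<close>)

lemma max_ideal_power_ord_ge: "f \<in> cps_max_ideal_power k \<Longrightarrow> cps_ord_ge k f"
proof (induction k arbitrary: f)
  case (Suc k)
  have mod: "Modules.module ((*) :: 'a cps \<Rightarrow> _)"
    by unfold_locales (auto simp: algebra_simps)
  have "f \<in> ideal_smult (*) cps_max_ideal (cps_max_ideal_power k)" using Suc.prems by simp
  with mod show ?case
  proof (induction rule: ideal_smult_induct)
    case (gen a x)
    thus ?case using cps_ord_ge_mult[of "Suc 0" a k x] Suc.IH
      by (simp add: cps_max_ideal_def cps_ord_ge_Suc_0)
  next
    case (scale a x)
    thus ?case using cps_ord_ge_mult[of 0 a "Suc k" x] by simp
  qed (auto intro: cps_ord_ge_add)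
qed simp

text \<open>Since \<open>f \<noteq> 0\<close>, the maximum in the definition of the order is attained.\<close>

lemma cps_order_ord_ge:
  assumes "f \<noteq> 0" "k \<le> cps_order f"
  shows "cps_ord_ge k f"
proof -
  obtain m where m: "cps_coeff f m \<noteq> 0"
    using assms(1) cps_eqI[of f 0] by auto
  have "f \<in> cps_max_ideal_power (cps_order f)"
    unfolding cps_order_def
  proof (rule GreatestI_nat[where k = 0 and b = "mdeg m"])
    fix k assume "f \<in> cps_max_ideal_power k"
    hence "cps_ord_ge k f" by (rule max_ideal_power_ord_ge)
    thus "k \<le> mdeg m" using m by (meson cps_ord_ge_def not_le)
  qed simp
  thus ?thesis using assms(2) max_ideal_power_ord_ge cps_ord_ge_mono by blast
qed

section \<open>Partial derivatives and the expansion of derivations\<close>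

lemma cps_coeff_pderiv:
  "cps_coeff (cps_pderiv i f) m = of_nat (Suc (m i)) * cps_coeff f (m + mexp i)"
  by (simp only: cps_pderiv.rep_eq upd_Suc_conv_mexp)

lemma cps_ord_ge_pderiv: "cps_ord_ge (Suc k) f \<Longrightarrow> cps_ord_ge k (cps_pderiv i f)"
  by (simp add: cps_ord_ge_def cps_coeff_pderiv mdeg_add)

lemma cps_pderiv_commute: "cps_pderiv i (cps_pderiv j f) = cps_pderiv j (cps_pderiv i f)"
  by (cases "i = j"; rule cps_eqI) (auto simp: cps_coeff_pderiv add_ac)

text \<open>The factor \<open>k i\<close> kills the exponents without the variable \<open>i\<close>,
  and the others are shifts by \<open>mexp i\<close>. Splitting the exponent of a product as
  \<open>k i + (?M - k) i\<close> then yields the Leibniz rule.\<close>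

lemma sum_exponent_shift:
  fixes F :: "('n::finite \<Rightarrow> nat) \<Rightarrow> complex"
  shows "(\<Sum>k\<in>{..m + mexp i}. of_nat (k i) * F k) = (\<Sum>k\<in>{..m}. of_nat (Suc (k i)) * F (k + mexp i))"
proof -
  have "(\<Sum>k\<in>{..m + mexp i}. of_nat (k i) * F k) =
        (\<Sum>k\<in>{k. k \<le> m + mexp i \<and> k i \<noteq> 0}. of_nat (k i) * F k)"
    by (rule sum.mono_neutral_right) auto
  also have "\<dots> = (\<Sum>k\<in>{..m}. of_nat (Suc (k i)) * F (k + mexp i))"
  proof (rule sum.reindex_bij_witness[where i = "\<lambda>k. k + mexp i" and j = "\<lambda>k. k - mexp i"], goal_cases)
    case (1 k) thus ?case by (auto simp: fun_eq_iff mexp_def)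
  next
    case (2 k) thus ?case by (auto simp: le_fun_def le_diff_conv mexp_def split: if_splits)
  next
    case (5 k)
    hence "k - mexp i + mexp i = k" by (auto simp: fun_eq_iff mexp_def)
    thus ?case using 5 by simp
  qed (auto simp: le_fun_def fun_eq_iff mexp_def)
  finally show ?thesis .
qed

lemma cps_pderiv_mult:
  "cps_pderiv i (f * g) = cps_pderiv i f * g + f * cps_pderiv i g"
proof (rule cps_eqI)
  fix m
  let ?M = "m + mexp i"
  have *: "(\<Sum>k\<in>{..?M}. of_nat (k i) * (cps_coeff f k * cps_coeff g (?M - k))) =
        cps_coeff (cps_pderiv i f * g) m" for f g :: "'a cps"
  proof -
    have "(m + mexp i) - (k + mexp i) = m - k" for k by (auto simp: fun_eq_iff)
    thus ?thesis
      unfolding sum_exponent_shift times_cps.rep_eq cps_coeff_pderiv by (simp add: mult_ac)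
  qed
  have "cps_coeff (cps_pderiv i (f * g)) m =
        (\<Sum>k\<in>{..?M}. of_nat (k i + (?M - k) i) * (cps_coeff f k * cps_coeff g (?M - k)))"
    unfolding cps_coeff_pderiv times_cps.rep_eq sum_distrib_left
    by (intro sum.cong refl arg_cong2[where f = "(*)"] arg_cong[where f = of_nat])
       (auto simp: le_fun_def dest!: spec[of _ i])
  also have "\<dots> = (\<Sum>k\<in>{..?M}. of_nat (k i) * (cps_coeff f k * cps_coeff g (?M - k))) +
      (\<Sum>k\<in>{..?M}. of_nat ((?M - k) i) * (cps_coeff f k * cps_coeff g (?M - k)))"
    by (simp only: of_nat_add ring_distribs sum.distrib)
  also have "(\<Sum>k\<in>{..?M}. of_nat ((?M - k) i) * (cps_coeff f k * cps_coeff g (?M - k))) =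
      (\<Sum>k\<in>{..?M}. of_nat (k i) * (cps_coeff g k * cps_coeff f (?M - k)))"
    by (rule sum.reindex_bij_witness[where i = "\<lambda>k. ?M - k" and j = "\<lambda>k. ?M - k"])
       (auto simp: diff_diff_fun, auto simp: le_fun_def)
  finally show "cps_coeff (cps_pderiv i (f * g)) m = cps_coeff (cps_pderiv i f * g + f * cps_pderiv i g) m"
    unfolding * by (simp add: mult.commute)
qed

lemma cps_pderiv_add: "cps_pderiv i (f + g) = cps_pderiv i f + cps_pderiv i g"
  by (rule cps_eqI) (simp add: cps_coeff_pderiv algebra_simps)

lemma cps_pderiv_Der: "cps_pderiv i \<in> cps_Der"
proof (rule cps_DerI)
  fix c and g :: "'a cps"
  have "cps_pderiv i (cps_const c) = 0"
    by (rule cps_eqI) (auto simp: cps_coeff_pderiv cps_const.rep_eq)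
  thus "cps_pderiv i (cps_const c * g) = cps_const c * cps_pderiv i g"
    by (simp add: cps_pderiv_mult)
qed (simp_all add: cps_pderiv_add cps_pderiv_mult)

lemma cps_pderiv_var: "cps_pderiv i (cps_var j) = (if i = j then 1 else 0)"
  by (rule cps_eqI)
     (auto simp: cps_coeff_pderiv cps_monom.rep_eq one_cps_def cps_const.rep_eq add_mexp_eq_mexp_iff)

lemma cps_Der_sum: "\<theta> \<in> cps_Der \<Longrightarrow> \<theta> (\<Sum>i\<in>A. f i) = (\<Sum>i\<in>A. \<theta> (f i))"
  by (induction A rule: infinite_finite_induct) (auto simp: cps_DerD)

text \<open>Iterating Hadamard's lemma shows that a derivation killing the coordinates has values of
  arbitrarily large order.\<close>

lemma cps_Der_expand:
  fixes g :: "'n::finite cps"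
  assumes \<theta>: "\<theta> \<in> cps_Der"
  shows "\<theta> g = (\<Sum>i\<in>UNIV. \<theta> (cps_var i) * cps_pderiv i g)"
proof -
  define \<delta> where "\<delta> g = \<theta> g - (\<Sum>i\<in>UNIV. \<theta> (cps_var i) * cps_pderiv i g)" for g
  have D: "\<delta> \<in> cps_Der"
    by (rule cps_DerI)
       (simp_all add: \<delta>_def cps_DerD[OF \<theta>] cps_DerD[OF cps_pderiv_Der] ring_distribs sum.distrib
         sum_distrib_left sum_distrib_right mult_ac)
  have var: "\<delta> (cps_var j) = 0" for j
    by (simp add: \<delta>_def cps_pderiv_var if_distrib[of "\<lambda>x. _ * x"] cong: if_cong)
  have "cps_ord_ge k (\<delta> g)" for k and g :: "'n cps"
  proof (induction k arbitrary: g)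
    case (Suc k)
    obtain h where h: "g = cps_const (cps_coeff g 0) + (\<Sum>i\<in>UNIV. cps_var i * h i)"
      by (rule hadamard)
    have "\<delta> g = (\<Sum>i\<in>UNIV. cps_var i * \<delta> (h i))"
      by (subst h) (simp add: cps_DerD[OF D] cps_Der_sum[OF D] var)
    thus ?case
      using cps_ord_ge_mult[OF cps_ord_ge_var Suc.IH] by (auto intro!: cps_ord_ge_sum)
  qed simp
  hence "\<delta> g = 0" by (rule cps_ord_ge_all_imp_0)
  thus ?thesis by (simp add: \<delta>_def)
qed


section \<open>Composition with formal arcs\<close>

text \<open>A bound for the weighted l1-norm at radius \<open>t\<close>, phrased by partial sums so
  that no summability has to be carried along. Bounds multiply under products, as in a Banach
  algebra.\<close>

definition fps_maj :: "real \<Rightarrow> real \<Rightarrow> complex fps \<Rightarrow> bool" where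
  "fps_maj t B f \<longleftrightarrow> (\<forall>n. (\<Sum>k\<le>n. norm (fps_nth f k) * t ^ k) \<le> B)"

lemma fps_majD: "fps_maj t B f \<Longrightarrow> (\<Sum>k\<le>n. norm (fps_nth f k) * t ^ k) \<le> B"
  by (simp add: fps_maj_def)

lemma fps_maj_nonneg: "fps_maj t B f \<Longrightarrow> 0 \<le> B"
  using fps_majD[of t B f 0] by (auto intro: order_trans[OF norm_ge_zero])

lemma fps_maj_mult:
  assumes "fps_maj t B f" "fps_maj t C g" "0 \<le> t"
  shows "fps_maj t (B * C) (f * g)"
  unfolding fps_maj_def
proof
  fix n
  define F G where "F k = norm (fps_nth f k) * t ^ k" and "G k = norm (fps_nth g k) * t ^ k" for k
  have nonneg: "0 \<le> F k" "0 \<le> G k" for k using assms(3) by (auto simp: F_def G_def)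
  have "(\<Sum>k\<le>n. norm (fps_nth (f * g) k) * t ^ k) \<le> (\<Sum>k\<le>n. \<Sum>i\<le>k. F i * G (k - i))"
  proof (rule sum_mono)
    fix k
    have "norm (fps_nth (f * g) k) * t ^ k \<le> (\<Sum>i\<le>k. norm (fps_nth f i * fps_nth g (k - i))) * t ^ k"
      unfolding fps_mult_nth atLeast0AtMost using assms(3) by (intro mult_right_mono norm_sum) auto
    also have "\<dots> = (\<Sum>i\<le>k. F i * G (k - i))"
      unfolding sum_distrib_right
      by (intro sum.cong refl) (simp add: F_def G_def norm_mult mult_ac flip: power_add)
    finally show "norm (fps_nth (f * g) k) * t ^ k \<le> (\<Sum>i\<le>k. F i * G (k - i))" .
  qed
  also have "\<dots> = (\<Sum>(i, j)\<in>{(i, j). i + j \<le> n}. F i * G j)"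
    by (rule sum.triangle_reindex_eq[symmetric])
  also have "\<dots> \<le> (\<Sum>(i, j)\<in>{..n} \<times> {..n}. F i * G j)"
    by (rule sum_mono2) (auto simp: nonneg)
  also have "\<dots> = (\<Sum>i\<le>n. F i) * (\<Sum>j\<le>n. G j)"
    by (simp add: sum_product sum.cartesian_product)
  also have "\<dots> \<le> B * C"
    using assms by (intro mult_mono sum_nonneg fps_maj_nonneg[OF assms(1)])
      (auto simp: nonneg F_def G_def fps_majD)
  finally show "(\<Sum>k\<le>n. norm (fps_nth (f * g) k) * t ^ k) \<le> B * C" .
qed

lemma fps_maj_1: "fps_maj t 1 1"
proof -
  have "(\<Sum>k\<le>n. norm (fps_nth (1 :: complex fps) k) * t ^ k) = 1" for n
  proof -
    have "(\<Sum>k\<le>n. norm (fps_nth (1 :: complex fps) k) * t ^ k) = (\<Sum>k\<le>n. if k = 0 then 1 else 0)"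
      by (intro sum.cong) auto
    thus ?thesis by simp
  qed
  thus ?thesis by (simp add: fps_maj_def)
qed

lemma fps_maj_power: "fps_maj t B f \<Longrightarrow> 0 \<le> t \<Longrightarrow> fps_maj t (B ^ n) (f ^ n)"
  by (induction n) (auto intro: fps_maj_mult fps_maj_1)

lemma fps_maj_prod:
  "(\<And>i. i \<in> A \<Longrightarrow> fps_maj t (B i) (f i)) \<Longrightarrow> 0 \<le> t \<Longrightarrow> fps_maj t (\<Prod>i\<in>A. B i) (\<Prod>i\<in>A. f i)"
  by (induction A rule: infinite_finite_induct) (auto intro: fps_maj_mult fps_maj_1)

lemma fps_maj_summable:
  assumes "fps_maj t B f" "norm z \<le> t"
  shows "summable (\<lambda>k. norm (fps_nth f k * z ^ k))"
proof (rule summableI_nonneg_bounded)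
  fix n
  have "(\<Sum>k<n. norm (fps_nth f k * z ^ k)) \<le> (\<Sum>k\<le>n. norm (fps_nth f k) * t ^ k)"
    using assms(2) order_trans[OF norm_ge_zero assms(2)]
    by (intro sum_mono2 order_trans[OF sum_mono2[of "{..n}"] sum_mono])
       (auto simp: norm_mult norm_power intro!: mult_left_mono power_mono)
  also have "\<dots> \<le> B" by (rule fps_majD[OF assms(1)])
  finally show "(\<Sum>k<n. norm (fps_nth f k * z ^ k)) \<le> B" .
qed simp

lemma fps_maj_conv_radius:
  assumes "fps_maj t B f" "0 \<le> t"
  shows "fps_conv_radius f \<ge> ereal t"
proof -
  have "summable (\<lambda>k. fps_nth f k * of_real t ^ k)"
    using fps_maj_summable[OF assms(1), of "of_real t"] assms(2) summable_norm_cancel by simp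
  thus ?thesis
    unfolding fps_conv_radius_def using conv_radius_geI[of "fps_nth f" "of_real t"] assms(2) by simp
qed

section \<open>Substitution of an arc into a power series\<close>

definition fps_mon :: "('n::finite \<Rightarrow> complex fps) \<Rightarrow> ('n \<Rightarrow> nat) \<Rightarrow> complex fps" where
  "fps_mon \<gamma> m = (\<Prod>i\<in>UNIV. \<gamma> i ^ m i)"

lemma fps_mon_add: "fps_mon \<gamma> (a + b) = fps_mon \<gamma> a * fps_mon \<gamma> b"
  by (simp add: fps_mon_def power_add prod.distrib)

lemma fps_mon_0 [simp]: "fps_mon \<gamma> 0 = 1"
  by (simp add: fps_mon_def)

lemma fps_mon_mexp [simp]: "fps_mon \<gamma> (mexp i) = \<gamma> i"
proof -
  have "fps_mon \<gamma> (mexp i) = (\<Prod>j\<in>UNIV. if j = i then \<gamma> j else 1)"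
    unfolding fps_mon_def by (intro prod.cong) (auto simp: mexp_def)
  thus ?thesis by simp
qed

lemma fps_eq_X_times_shift: "fps_nth f 0 = 0 \<Longrightarrow> f = fps_X * fps_shift 1 f"
  for f :: "complex fps"
  by (rule fps_ext) simp

text \<open>Each component is divisible by \<open>fps_X\<close>, so a monomial of degree
  \<open>d\<close> is divisible by \<open>fps_X ^ d\<close>. This makes every coefficient of a
  substitution a finite sum.\<close>

lemma fps_mon_nth_less:
  assumes "\<And>i. fps_nth (\<gamma> i) 0 = 0" "k < mdeg m"
  shows "fps_nth (fps_mon \<gamma> m) k = 0"
proof -
  have "fps_mon \<gamma> m = (\<Prod>i\<in>UNIV. (fps_X * fps_shift 1 (\<gamma> i)) ^ m i)"
    unfolding fps_mon_def using fps_eq_X_times_shift[OF assms(1)] by metis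
  also have "\<dots> = fps_X ^ mdeg m * (\<Prod>i\<in>UNIV. fps_shift 1 (\<gamma> i) ^ m i)"
    by (simp add: power_mult_distrib prod.distrib mdeg_def power_sum)
  finally show ?thesis using assms(2) by (simp add: fps_X_power_mult_nth)
qed

lemma fps_mon_maj:
  assumes "\<And>i. fps_maj t r (\<gamma> i)" "0 \<le> t"
  shows "fps_maj t (r ^ mdeg m) (fps_mon \<gamma> m)"
proof -
  have "fps_maj t (\<Prod>i\<in>UNIV. r ^ m i) (fps_mon \<gamma> m)"
    unfolding fps_mon_def using assms by (intro fps_maj_prod fps_maj_power)
  thus ?thesis by (simp add: mdeg_def power_sum)
qed

text \<open>This is \<open>f \<circ> \<gamma>\<close> only for arcs \<open>\<gamma>\<close> without constant terms.\<close>

definition cps_subst :: "('n::finite \<Rightarrow> complex fps) \<Rightarrow> 'n cps \<Rightarrow> complex fps" where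
  "cps_subst \<gamma> f = Abs_fps (\<lambda>k. \<Sum>m | mdeg m \<le> k. cps_coeff f m * fps_nth (fps_mon \<gamma> m) k)"

locale arc =
  fixes \<gamma> :: "'n::finite \<Rightarrow> complex fps"
  assumes arc_0 [simp]: "fps_nth (\<gamma> i) 0 = 0"
begin

lemma subst_nth:
  assumes "k \<le> d"
  shows "fps_nth (cps_subst \<gamma> f) k = (\<Sum>m | mdeg m \<le> d. cps_coeff f m * fps_nth (fps_mon \<gamma> m) k)"
  unfolding cps_subst_def fps_nth_Abs_fps
  using assms fps_mon_nth_less[of \<gamma>] by (intro sum.mono_neutral_left) auto

lemma subst_nth_0 [simp]: "fps_nth (cps_subst \<gamma> f) 0 = cps_coeff f 0"
  by (simp add: cps_subst_def)

lemma subst_add: "cps_subst \<gamma> (f + g) = cps_subst \<gamma> f + cps_subst \<gamma> g"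
  by (rule fps_ext) (simp add: cps_subst_def ring_distribs sum.distrib)

lemma subst_0 [simp]: "cps_subst \<gamma> 0 = 0"
  by (rule fps_ext) (simp add: cps_subst_def)

lemma subst_diff: "cps_subst \<gamma> (f - g) = cps_subst \<gamma> f - cps_subst \<gamma> g"
  by (rule fps_ext) (simp add: cps_subst_def ring_distribs sum_subtractf)

lemma subst_sum: "cps_subst \<gamma> (\<Sum>i\<in>A. f i) = (\<Sum>i\<in>A. cps_subst \<gamma> (f i))"
  by (induction A rule: infinite_finite_induct) (auto simp: subst_add)

lemma subst_monom: "cps_subst \<gamma> (cps_monom a) = fps_mon \<gamma> a"
proof (rule fps_ext)
  fix k
  have "fps_nth (cps_subst \<gamma> (cps_monom a)) k =
      (\<Sum>m | mdeg m \<le> k. if m = a then fps_nth (fps_mon \<gamma> a) k else 0)"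
    unfolding cps_subst_def fps_nth_Abs_fps cps_monom.rep_eq by (intro sum.cong) auto
  thus "fps_nth (cps_subst \<gamma> (cps_monom a)) k = fps_nth (fps_mon \<gamma> a) k"
    using fps_mon_nth_less[of \<gamma> k a] by (auto simp: sum.delta')
qed

lemma subst_const: "cps_subst \<gamma> (cps_const c) = fps_const c"
proof (rule fps_ext)
  fix k
  have "fps_nth (cps_subst \<gamma> (cps_const c)) k =
      (\<Sum>m | mdeg (m :: 'n \<Rightarrow> nat) \<le> k. if m = 0 then c * fps_nth 1 k else 0)"
    unfolding cps_subst_def fps_nth_Abs_fps cps_const.rep_eq
    by (rule sum.cong) (simp_all del: fps_one_nth)
  thus "fps_nth (cps_subst \<gamma> (cps_const c)) k = fps_nth (fps_const c) k"
    by (simp add: sum.delta')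
qed

lemma subst_ord_ge: "cps_ord_ge d f \<Longrightarrow> k < d \<Longrightarrow> fps_nth (cps_subst \<gamma> f) k = 0"
  by (simp add: cps_subst_def cps_ord_ge_def)

lemma subst_mult: "cps_subst \<gamma> (f * g) = cps_subst \<gamma> f * cps_subst \<gamma> g"
proof (rule fps_ext)
  fix d
  define S where "S = {m :: 'n \<Rightarrow> nat. mdeg m \<le> d}"
  have [simp]: "finite S" by (simp add: S_def)
  \<comment> \<open>The truncation to degree at most \<open>d\<close> is a genuine finite sum of
    series, so products can be expanded, and it is correct up to coefficient
    \<open>d\<close>.\<close>
  define T where "T a = (\<Sum>m\<in>S. fps_const (cps_coeff a m) * fps_mon \<gamma> m)" for a
  have T: "fps_nth (T a) k = fps_nth (cps_subst \<gamma> a) k" if "k \<le> d" for a k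
    using subst_nth[OF that, of a] by (simp add: T_def S_def fps_sum_nth)
  have "fps_nth (cps_subst \<gamma> f * cps_subst \<gamma> g) d = fps_nth (T f * T g) d"
    unfolding fps_mult_nth by (intro sum.cong) (auto simp: T)
  also have "T f * T g = (\<Sum>(a, b)\<in>S \<times> S. fps_const (cps_coeff f a * cps_coeff g b) * fps_mon \<gamma> (a + b))"
    by (simp add: T_def sum_product sum.cartesian_product fps_mon_add mult_ac flip: fps_const_mult)
  also have "fps_nth \<dots> d = (\<Sum>(a, b)\<in>S \<times> S. cps_coeff f a * cps_coeff g b * fps_nth (fps_mon \<gamma> (a + b)) d)"
    by (simp add: fps_sum_nth case_prod_unfold)
  also have "\<dots> = (\<Sum>(a, b)\<in>{(a, b). mdeg (a + b) \<le> d}. cps_coeff f a * cps_coeff g b * fps_nth (fps_mon \<gamma> (a + b)) d)"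
  proof (rule sum.mono_neutral_right)
    show "\<forall>p\<in>S \<times> S - {(a, b). mdeg (a + b) \<le> d}.
        (case p of (a, b) \<Rightarrow> cps_coeff f a * cps_coeff g b * fps_nth (fps_mon \<gamma> (a + b)) d) = 0"
      using fps_mon_nth_less[of \<gamma> d] by auto (metis arc_0 not_le)
  qed (auto simp: S_def mdeg_add)
  also have "\<dots> = (\<Sum>(m, a)\<in>(SIGMA m:S. {..m}). cps_coeff f a * cps_coeff g (m - a) * fps_nth (fps_mon \<gamma> m) d)"
  proof (rule sum.reindex_bij_witness[where i = "\<lambda>(m, a). (a, m - a)" and j = "\<lambda>(a, b). (a + b, a)"], goal_cases)
    case (1 p) thus ?case by (auto simp: fun_eq_iff)
  next
    case (2 p) thus ?case by (auto simp: S_def le_fun_def)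
  next
    case (3 p) thus ?case by (auto simp: fun_eq_iff le_fun_def)
  next
    case (4 p)
    then obtain m a where p: "p = (m, a)" "mdeg m \<le> d" "a \<le> m" by (auto simp: S_def)
    hence "a + (m - a) = m" by (auto simp: fun_eq_iff le_fun_def)
    thus ?case using p by simp
  next
    case (5 p)
    have "(a + b) - a = b" for a b :: "'n \<Rightarrow> nat" by (simp add: fun_eq_iff)
    thus ?case by (auto split: prod.split)
  qed
  also have "\<dots> = fps_nth (cps_subst \<gamma> (f * g)) d"
    unfolding cps_subst_def fps_nth_Abs_fps times_cps.rep_eq
    by (simp add: sum_distrib_right S_def flip: sum.Sigma)
  finally show "fps_nth (cps_subst \<gamma> (f * g)) d = fps_nth (cps_subst \<gamma> f * cps_subst \<gamma> g) d" ..
qed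

lemma subst_var [simp]: "cps_subst \<gamma> (cps_var i) = \<gamma> i"
  by (simp add: subst_monom)

text \<open>The defect \<open>\<delta>\<close> is a derivation along the substitution homomorphism
  and kills constants and coordinates. Hadamard's lemma rewrites it as a sum of products with the
  \<open>\<gamma> i\<close>, which have no constant term, so induction on the coefficient index
  makes it vanish.\<close>

lemma subst_chain_rule:
  "fps_deriv (cps_subst \<gamma> f) = (\<Sum>i\<in>UNIV. cps_subst \<gamma> (cps_pderiv i f) * fps_deriv (\<gamma> i))"
proof -
  define \<delta> where "\<delta> f = fps_deriv (cps_subst \<gamma> f) -
      (\<Sum>i\<in>UNIV. cps_subst \<gamma> (cps_pderiv i f) * fps_deriv (\<gamma> i))" for f
  note P = cps_DerD[OF cps_pderiv_Der]
  have add: "\<delta> (f + g) = \<delta> f + \<delta> g" for f g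
    by (simp add: \<delta>_def subst_add P ring_distribs sum.distrib)
  have mult: "\<delta> (f * g) = \<delta> f * cps_subst \<gamma> g + cps_subst \<gamma> f * \<delta> g" for f g
    by (simp add: \<delta>_def subst_add subst_mult P ring_distribs sum.distrib sum_distrib_left
        sum_distrib_right mult_ac)
  have const: "\<delta> (cps_const c) = 0" for c
    by (simp add: \<delta>_def P subst_const)
  have var: "\<delta> (cps_var i) = 0" for i
  proof -
    have "cps_subst \<gamma> (if j = i then 1 else 0) * fps_deriv (\<gamma> j) =
            (if j = i then fps_deriv (\<gamma> j) else 0)" for j
      by (simp add: one_cps_def subst_const)
    thus ?thesis by (simp add: \<delta>_def cps_pderiv_var)
  qed
  have sum: "\<delta> (\<Sum>i\<in>A. f i) = (\<Sum>i\<in>A. \<delta> (f i))" for A :: "'n set" and f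
  proof (induction A rule: infinite_finite_induct)
    case (empty)
    show ?case using const[of 0] add[of 0 0] by simp
  qed (auto simp: add)
  have "fps_nth (\<delta> f) k = 0" for f k
  proof (induction k arbitrary: f rule: less_induct)
    case (less k)
    obtain h where h: "f = cps_const (cps_coeff f 0) + (\<Sum>i\<in>UNIV. cps_var i * h i)"
      by (rule hadamard)
    have "\<delta> f = (\<Sum>i\<in>UNIV. \<gamma> i * \<delta> (h i))"
      by (subst h) (simp add: add const sum mult var)
    moreover have "fps_nth (\<gamma> i * \<delta> (h i)) k = 0" for i
      unfolding fps_mult_nth
    proof (intro sum.neutral ballI)
      fix j assume "j \<in> {0..k}"
      thus "fps_nth (\<gamma> i) j * fps_nth (\<delta> (h i)) (k - j) = 0"
        using less[of "k - j" "h i"] by (cases "j = 0") auto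
    qed
    ultimately show ?case by (simp add: fps_sum_nth)
  qed
  hence "\<delta> f = 0" by (intro fps_ext) simp
  thus ?thesis by (simp add: \<delta>_def)
qed

end

text \<open>The family \<open>f\<^sub>m (\<gamma>\<^sup>m)\<^sub>k s\<^sup>k\<close> is absolutely summable, so the order of summation may be exchanged.\<close>

lemma cps_eval_arc_eq_0:
  fixes f :: "'n::finite cps"
  assumes "arc \<gamma>" and maj: "\<And>i. fps_maj t r (\<gamma> i)" and t: "norm s < t"
    and summ: "(\<lambda>m. norm (cps_coeff f m) * r ^ mdeg m) summable_on UNIV"
    and zero: "cps_subst \<gamma> f = 0"
  shows "cps_eval f (\<chi> i. eval_fps (\<gamma> i) s) = 0"
proof -
  interpret arc \<gamma> by fact
  have t0: "0 \<le> t" using t by (meson norm_ge_zero order_trans less_imp_le)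
  have r0: "0 \<le> r" using maj fps_maj_nonneg by blast
  have rad: "ereal (norm s) < fps_conv_radius g" if "fps_maj t B g" for g B
    using fps_maj_conv_radius[OF that t0] t by (meson ereal_less_eq(3) less_le_trans ereal_less(1) less_ereal.simps(1))
  have prod: "eval_fps (\<Prod>i\<in>A. \<gamma> i ^ m i) s = (\<Prod>i\<in>A. eval_fps (\<gamma> i) s ^ m i)" for A m
  proof (induction A rule: infinite_finite_induct)
    case (insert i A)
    have "fps_maj t (r ^ m i) (\<gamma> i ^ m i)" "fps_maj t (\<Prod>i\<in>A. r ^ m i) (\<Prod>i\<in>A. \<gamma> i ^ m i)"
      using maj t0 by (auto intro!: fps_maj_power fps_maj_prod)
    thus ?case using insert rad[OF maj]
      by (simp add: eval_fps_mult eval_fps_power rad)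
  qed auto
  define F where "F m k = cps_coeff f m * (fps_nth (fps_mon \<gamma> m) k * s ^ k)" for m k
  have bound: "(\<Sum>k\<le>n. norm (F m k)) \<le> norm (cps_coeff f m) * r ^ mdeg m" for m n
  proof -
    have "(\<Sum>k\<le>n. norm (F m k)) = norm (cps_coeff f m) * (\<Sum>k\<le>n. norm (fps_nth (fps_mon \<gamma> m) k) * norm s ^ k)"
      by (simp add: F_def norm_mult norm_power sum_distrib_left mult_ac)
    also have "\<dots> \<le> norm (cps_coeff f m) * (\<Sum>k\<le>n. norm (fps_nth (fps_mon \<gamma> m) k) * t ^ k)"
      using t by (intro mult_left_mono sum_mono power_mono) auto
    also have "\<dots> \<le> norm (cps_coeff f m) * r ^ mdeg m"
      by (intro mult_left_mono fps_majD fps_mon_maj maj t0) auto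
    finally show ?thesis .
  qed
  \<comment> \<open>Every finite set of index pairs lies in a rectangle, whose row sums are
    controlled by \<open>bound\<close> and hence by the norm of \<open>f\<close> at radius
    \<open>r\<close>.\<close>
  have "(\<lambda>p. norm (case p of (m, k) \<Rightarrow> F m k)) summable_on (UNIV \<times> UNIV)"
  proof (rule nonneg_bdd_above_summable_on)
    show "bdd_above (sum (\<lambda>p. norm (case p of (m, k) \<Rightarrow> F m k)) ` {P. P \<subseteq> UNIV \<times> UNIV \<and> finite P})"
    proof (rule bdd_aboveI2)
      fix P :: "(('n \<Rightarrow> nat) \<times> nat) set" assume "P \<in> {P. P \<subseteq> UNIV \<times> UNIV \<and> finite P}"
      hence P: "finite P" by simp
      define n where "n = Max (insert 0 (snd ` P))"
      have "P \<subseteq> fst ` P \<times> {..n}"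
      proof
        fix p assume p: "p \<in> P"
        hence "snd p \<le> n" unfolding n_def using P by (intro Max_ge) auto
        thus "p \<in> fst ` P \<times> {..n}" using p by (cases p) force
      qed
      hence "(\<Sum>p\<in>P. norm (case p of (m, k) \<Rightarrow> F m k)) \<le> (\<Sum>p\<in>fst ` P \<times> {..n}. norm (case p of (m, k) \<Rightarrow> F m k))"
        using P by (intro sum_mono2) auto
      also have "\<dots> = (\<Sum>m\<in>fst ` P. \<Sum>k\<le>n. norm (F m k))"
        by (simp add: sum.cartesian_product case_prod_unfold)
      also have "\<dots> \<le> (\<Sum>m\<in>fst ` P. norm (cps_coeff f m) * r ^ mdeg m)"
        by (intro sum_mono bound)
      also have "\<dots> \<le> infsum (\<lambda>m. norm (cps_coeff f m) * r ^ mdeg m) UNIV"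
        using P r0 by (intro finite_sum_le_infsum summ) auto
      finally show "(\<Sum>p\<in>P. norm (case p of (m, k) \<Rightarrow> F m k)) \<le> infsum (\<lambda>m. norm (cps_coeff f m) * r ^ mdeg m) UNIV" .
    qed
  qed auto
  hence summ': "(\<lambda>(m, k). F m k) summable_on (UNIV \<times> UNIV)"
    by (rule abs_summable_summable)
  have row: "infsum (F m) UNIV = cps_coeff f m * (\<Prod>i\<in>UNIV. eval_fps (\<gamma> i) s ^ m i)" for m
  proof -
    have "summable (\<lambda>k. norm (fps_nth (fps_mon \<gamma> m) k * s ^ k))"
      using t by (intro fps_maj_summable[OF fps_mon_maj[of t r \<gamma>, OF maj t0]]) simp
    hence "((\<lambda>k. fps_nth (fps_mon \<gamma> m) k * s ^ k) has_sum eval_fps (fps_mon \<gamma> m) s) UNIV"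
      unfolding eval_fps_def
      by (intro norm_summable_imp_has_sum) (auto intro: summable_sums summable_norm_cancel)
    hence "(F m has_sum cps_coeff f m * eval_fps (fps_mon \<gamma> m) s) UNIV"
      unfolding F_def by (rule has_sum_cmult_right)
    thus ?thesis unfolding fps_mon_def prod by (rule infsumI)
  qed
  \<comment> \<open>For fixed \<open>k\<close> only monomials of degree at most \<open>k\<close>
    contribute, and together they give coefficient \<open>k\<close> of the composition.\<close>
  have col: "infsum (\<lambda>m. F m k) UNIV = 0" for k
  proof -
    have "infsum (\<lambda>m. F m k) UNIV = infsum (\<lambda>m. F m k) {m. mdeg m \<le> k}"
      by (rule infsum_cong_neutral) (auto simp: F_def not_le fps_mon_nth_less[OF arc_0])
    also have "\<dots> = fps_nth (cps_subst \<gamma> f) k * s ^ k"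
      by (simp add: F_def cps_subst_def sum_distrib_right mult.assoc)
    finally show ?thesis by (simp add: zero)
  qed
  have "cps_eval f (\<chi> i. eval_fps (\<gamma> i) s) = infsum (\<lambda>m. infsum (\<lambda>k. F m k) UNIV) UNIV"
    by (simp add: cps_eval_def row)
  also have "\<dots> = infsum (\<lambda>k. infsum (\<lambda>m. F m k) UNIV) UNIV"
    by (rule infsum_swap_banach[OF summ'])
  finally show ?thesis by (simp add: col)
qed


section \<open>Convergent solutions of a singular differential equation\<close>

definition fps_agree :: "nat \<Rightarrow> complex fps \<Rightarrow> complex fps \<Rightarrow> bool" where
  "fps_agree k f g \<longleftrightarrow> (\<forall>j<k. fps_nth f j = fps_nth g j)"

lemma fps_agree_refl [simp]: "fps_agree k f f"
  by (simp add: fps_agree_def)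

lemma fps_agree_mult: "fps_agree k f f' \<Longrightarrow> fps_agree k g g' \<Longrightarrow> fps_agree k (f * g) (f' * g')"
  by (auto simp: fps_agree_def fps_mult_nth)

lemma fps_agree_power: "fps_agree k f f' \<Longrightarrow> fps_agree k (f ^ n) (f' ^ n)"
  by (induction n) (auto intro: fps_agree_mult)

lemma fps_agree_prod:
  "(\<And>i. i \<in> A \<Longrightarrow> fps_agree k (f i) (f' i)) \<Longrightarrow> fps_agree k (\<Prod>i\<in>A. f i) (\<Prod>i\<in>A. f' i)"
  by (induction A rule: infinite_finite_induct) (auto intro: fps_agree_mult)

text \<open>Without constant terms the two extreme summands of the Cauchy product vanish, so
  coefficient \<open>k\<close> only involves factors of index below \<open>k\<close>.\<close>

lemma fps_agree_mult_Suc: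
  assumes "fps_agree k f f'" "fps_agree k g g'"
    and "fps_nth f 0 = 0" "fps_nth f' 0 = 0" "fps_nth g 0 = 0" "fps_nth g' 0 = 0"
  shows "fps_agree (Suc k) (f * g) (f' * g')"
  unfolding fps_agree_def fps_mult_nth
proof (intro allI impI sum.cong refl)
  fix n j assume nj: "n < Suc k" "j \<in> {0..n}"
  show "fps_nth f j * fps_nth g (n - j) = fps_nth f' j * fps_nth g' (n - j)"
  proof (cases "j = 0 \<or> j = n")
    case False
    hence "j < k" "n - j < k" using nj by auto
    thus ?thesis using assms(1,2) by (simp add: fps_agree_def)
  qed (use assms in auto)
qed

text \<open>A monomial of degree at least 2 is a variable times a nonconstant monomial, so one order
  of agreement is gained. This forces the coefficients of the Picard iterates to stabilise.\<close>

lemma cps_subst_agree: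
  assumes "arc \<gamma>" "arc \<gamma>'" "\<And>i. fps_agree k (\<gamma> i) (\<gamma>' i)" "cps_ord_ge 2 f"
  shows "fps_agree (Suc k) (cps_subst \<gamma> f) (cps_subst \<gamma>' f)"
proof -
  have "fps_agree (Suc k) (fps_mon \<gamma> m) (fps_mon \<gamma>' m)" if m: "mdeg m \<ge> 2" for m
  proof -
    obtain i where i: "m i \<noteq> 0" using m by (metis mdeg_eq_0_iff not_numeral_le_zero ext zero_fun_def)
    define m' where "m' = m - mexp i"
    have eq: "m = mexp i + m'" using i by (auto simp: m'_def fun_eq_iff mexp_def)
    have "mdeg m' > 0" using m by (simp add: eq mdeg_add)
    moreover have "fps_agree k (fps_mon \<gamma> m') (fps_mon \<gamma>' m')"
      unfolding fps_mon_def using assms(3) by (intro fps_agree_prod fps_agree_power)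
    ultimately show ?thesis
      using assms(1,2) unfolding eq fps_mon_add fps_mon_mexp
      by (intro fps_agree_mult_Suc assms(3)) (auto intro: fps_mon_nth_less arc.arc_0)
  qed
  hence *: "fps_nth (fps_mon \<gamma> m) n = fps_nth (fps_mon \<gamma>' m) n" if "mdeg m \<ge> 2" "n < Suc k" for m n
    using that by (simp add: fps_agree_def)
  have "cps_coeff f m * fps_nth (fps_mon \<gamma> m) n = cps_coeff f m * fps_nth (fps_mon \<gamma>' m) n"
    if "n < Suc k" for m n
    using *[of m n] that assms(4) by (cases "mdeg m \<ge> 2") (auto simp: cps_ord_ge_def not_le)
  thus ?thesis
    by (auto simp: fps_agree_def cps_subst_def intro!: sum.cong)
qed

section \<open>Norm estimates for substitution and the Picard limit\<close>

lemma cps_subst_maj: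
  fixes f :: "'n::finite cps"
  assumes "\<And>i. fps_maj t r (\<gamma> i)" "arc \<gamma>" "0 \<le> t"
    and S: "\<And>M. finite M \<Longrightarrow> (\<Sum>m\<in>M. norm (cps_coeff f m) * r ^ mdeg m) \<le> S"
  shows "fps_maj t S (cps_subst \<gamma> f)"
  unfolding fps_maj_def
proof
  fix n
  interpret arc \<gamma> by fact
  let ?M = "{m :: 'n \<Rightarrow> nat. mdeg m \<le> n}"
  have "(\<Sum>k\<le>n. norm (fps_nth (cps_subst \<gamma> f) k) * t ^ k) \<le>
      (\<Sum>k\<le>n. \<Sum>m\<in>?M. norm (cps_coeff f m) * (norm (fps_nth (fps_mon \<gamma> m) k) * t ^ k))"
  proof (rule sum_mono)
    fix k assume "k \<in> {..n}"
    hence "norm (fps_nth (cps_subst \<gamma> f) k) * t ^ k \<le>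
       (\<Sum>m\<in>?M. norm (cps_coeff f m * fps_nth (fps_mon \<gamma> m) k)) * t ^ k"
      using assms(3) by (intro mult_right_mono) (auto simp: subst_nth[of k n] intro: norm_sum)
    thus "norm (fps_nth (cps_subst \<gamma> f) k) * t ^ k \<le>
        (\<Sum>m\<in>?M. norm (cps_coeff f m) * (norm (fps_nth (fps_mon \<gamma> m) k) * t ^ k))"
      by (simp add: sum_distrib_right norm_mult mult.assoc)
  qed
  also have "\<dots> = (\<Sum>m\<in>?M. norm (cps_coeff f m) * (\<Sum>k\<le>n. norm (fps_nth (fps_mon \<gamma> m) k) * t ^ k))"
    unfolding sum_distrib_left by (rule sum.swap)
  also have "\<dots> \<le> (\<Sum>m\<in>?M. norm (cps_coeff f m) * r ^ mdeg m)"
    by (intro sum_mono mult_left_mono fps_majD fps_mon_maj assms) auto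
  also have "\<dots> \<le> S" by (rule S) simp
  finally show "(\<Sum>k\<le>n. norm (fps_nth (cps_subst \<gamma> f) k) * t ^ k) \<le> S" .
qed

text \<open>Only degrees \<open>d \<ge> 2\<close> occur, and
  \<open>(r / \<rho>) ^ d \<le> (r / \<rho>)\<^sup>2\<close> for \<open>r \<le> \<rho>\<close>. A
  bound quadratic in \<open>r\<close> is what a small ball of radius \<open>r\<close> can
  absorb.\<close>

lemma cps_quadratic_bound:
  fixes h :: "'n::finite cps"
  assumes "cps_ord_ge 2 h"
  obtains K \<rho> where "0 \<le> K" "0 < \<rho>"
    "\<And>r M. 0 \<le> r \<Longrightarrow> r \<le> \<rho> \<Longrightarrow> finite M \<Longrightarrow> (\<Sum>m\<in>M. norm (cps_coeff h m) * r ^ mdeg m) \<le> K * r\<^sup>2"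
proof -
  obtain \<rho> where \<rho>: "\<rho> > 0" "(\<lambda>m. norm (cps_coeff h m) * \<rho> ^ mdeg m) summable_on UNIV"
    using cps_coeff[of h] by (auto simp: cps_convergent_def)
  define S where "S = infsum (\<lambda>m. norm (cps_coeff h m) * \<rho> ^ mdeg m) UNIV"
  have "0 \<le> S" unfolding S_def using \<rho>(1) by (intro infsum_nonneg) auto
  have "(\<Sum>m\<in>M. norm (cps_coeff h m) * r ^ mdeg m) \<le> S / \<rho>\<^sup>2 * r\<^sup>2"
    if r: "0 \<le> r" "r \<le> \<rho>" and M: "finite M" for r M
  proof -
    have "(\<Sum>m\<in>M. norm (cps_coeff h m) * r ^ mdeg m) \<le>
        (\<Sum>m\<in>M. (r / \<rho>)\<^sup>2 * (norm (cps_coeff h m) * \<rho> ^ mdeg m))"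
    proof (rule sum_mono)
      fix m
      show "norm (cps_coeff h m) * r ^ mdeg m \<le> (r / \<rho>)\<^sup>2 * (norm (cps_coeff h m) * \<rho> ^ mdeg m)"
      proof (cases "mdeg m < 2")
        case True
        thus ?thesis using assms by (simp add: cps_ord_ge_def)
      next
        case False
        have "r ^ mdeg m = (r / \<rho>) ^ mdeg m * \<rho> ^ mdeg m"
          using \<rho>(1) by (simp add: power_divide)
        also have "\<dots> \<le> (r / \<rho>)\<^sup>2 * \<rho> ^ mdeg m"
          using False r \<rho>(1) by (intro mult_right_mono power_decreasing) auto
        finally have "norm (cps_coeff h m) * r ^ mdeg m \<le> norm (cps_coeff h m) * ((r / \<rho>)\<^sup>2 * \<rho> ^ mdeg m)"
          by (intro mult_left_mono) auto
        thus ?thesis by (simp add: mult_ac)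
      qed
    qed
    also have "\<dots> = (r / \<rho>)\<^sup>2 * (\<Sum>m\<in>M. norm (cps_coeff h m) * \<rho> ^ mdeg m)"
      by (simp add: sum_distrib_left)
    also have "\<dots> \<le> (r / \<rho>)\<^sup>2 * S"
      unfolding S_def using M \<rho> by (intro mult_left_mono finite_sum_le_infsum) auto
    finally show ?thesis by (simp add: power_divide mult_ac)
  qed
  thus thesis using that[of "S / \<rho>\<^sup>2" \<rho>] \<open>0 \<le> S\<close> \<rho>(1) by simp
qed

text \<open>Picard iteration. The quadratic bound on \<open>h\<close> keeps the iterates inside a fixed ball of the
  weighted \<open>\<ell>\<^sup>1\<close>-norm, which makes the limit converge.\<close>

lemma resolvent_fixed_point:
  fixes h :: "'n::finite \<Rightarrow> 'n cps" and v :: "complex ^ 'n" and R :: "nat \<Rightarrow> complex ^ 'n \<Rightarrow> complex ^ 'n"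
  assumes h: "\<And>i. cps_ord_ge 2 (h i)"
    and R: "\<And>k w i. 2 \<le> k \<Longrightarrow> norm (R k w $ i) \<le> B * (\<Sum>j\<in>UNIV. norm (w $ j))"
    and "0 < r0"
  obtains \<gamma> t r where "arc \<gamma>" "0 < t" "0 \<le> r" "r \<le> r0" "\<And>i. fps_maj t r (\<gamma> i)"
    "\<And>i. fps_nth (\<gamma> i) 1 = v $ i"
    "\<And>i k. 2 \<le> k \<Longrightarrow> fps_nth (\<gamma> i) k = R k (\<chi> j. fps_nth (cps_subst \<gamma> (h j)) k) $ i"
proof -
  have "\<exists>K \<rho>. 0 \<le> K \<and> 0 < \<rho> \<and> (\<forall>r M. 0 \<le> r \<longrightarrow> r \<le> \<rho> \<longrightarrow> finite M \<longrightarrow>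
      (\<Sum>m\<in>M. norm (cps_coeff (h i) m) * r ^ mdeg m) \<le> K * r\<^sup>2)" for i
    using cps_quadratic_bound[OF h[of i]] by (smt (verit))
  then obtain K where "\<forall>i. \<exists>\<rho>. 0 \<le> K i \<and> 0 < \<rho> \<and> (\<forall>r M. 0 \<le> r \<longrightarrow> r \<le> \<rho> \<longrightarrow> finite M \<longrightarrow>
      (\<Sum>m\<in>M. norm (cps_coeff (h i) m) * r ^ mdeg m) \<le> K i * r\<^sup>2)"
    using choice[of "\<lambda>i K. \<exists>\<rho>. 0 \<le> K \<and> 0 < \<rho> \<and> (\<forall>r M. 0 \<le> r \<longrightarrow> r \<le> \<rho> \<longrightarrow> finite M \<longrightarrow>
      (\<Sum>m\<in>M. norm (cps_coeff (h i) m) * r ^ mdeg m) \<le> K * r\<^sup>2)"] by blast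
  from choice[OF this] obtain \<rho> where K\<rho>: "\<And>i. 0 \<le> K i" "\<And>i. 0 < \<rho> i" "\<And>i r M. 0 \<le> r \<Longrightarrow> r \<le> \<rho> i \<Longrightarrow> finite M \<Longrightarrow>
      (\<Sum>m\<in>M. norm (cps_coeff (h i) m) * r ^ mdeg m) \<le> K i * r\<^sup>2"
    by blast
  \<comment> \<open>The linear term takes at most half of the radius \<open>r = 2 * V * t\<close>,
    and \<open>t \<le> 1 / Q\<close> keeps the nonlinear term within the other half
    \<open>V * t\<close>. The summands 1 make \<open>V\<close> and \<open>Q\<close>
    positive.\<close>
  define V where "V = norm v + 1"
  define Q where "Q = \<bar>B\<bar> * (\<Sum>i\<in>UNIV. K i) * 4 * V + 1"
  define t where "t = min (1 / Q) (Min (insert r0 (range \<rho>)) / (2 * V))"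
  define r where "r = 2 * V * t"
  have V: "V > 0" "norm (v $ i) \<le> V" for i
    using Finite_Cartesian_Product.norm_nth_le[of v i] by (auto simp: V_def add_nonneg_pos intro: order_trans)
  have Q: "Q > 0" using V K\<rho>(1) by (auto simp: Q_def intro!: add_nonneg_pos mult_nonneg_nonneg sum_nonneg)
  have t: "t > 0" unfolding t_def using Q V K\<rho>(2) \<open>0 < r0\<close> by (auto simp: Min_gr_iff)
  have r: "r \<ge> 0" using t V by (simp add: r_def)
  have "2 * V * t \<le> Min (insert r0 (range \<rho>))"
  proof -
    have "t \<le> Min (insert r0 (range \<rho>)) / (2 * V)" unfolding t_def by (rule min.cobounded2)
    thus ?thesis using V by (simp add: pos_le_divide_eq mult_ac del: Min_insert)
  qed
  hence r_le: "r \<le> r0" "r \<le> \<rho> i" for i by (auto simp: r_def Min_ge_iff)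
  have contr: "V * t + \<bar>B\<bar> * (\<Sum>i\<in>UNIV. K i * r\<^sup>2) \<le> r"
  proof -
    have "t \<le> 1 / Q" unfolding t_def by (rule min.cobounded1)
    hence "t * Q \<le> 1" using Q by (simp add: field_simps)
    hence "t * (\<bar>B\<bar> * (\<Sum>i\<in>UNIV. K i) * 4 * V) \<le> 1" using t by (simp add: Q_def algebra_simps)
    hence "(V * t) * (t * (\<bar>B\<bar> * (\<Sum>i\<in>UNIV. K i) * 4 * V)) \<le> (V * t) * 1"
      using V t by (intro mult_left_mono) auto
    thus ?thesis by (simp add: r_def power2_eq_square flip: sum_distrib_right) (simp add: algebra_simps)
  qed
  define G where "G \<gamma> i = Abs_fps (\<lambda>k. if k = 0 then 0 else if k = 1 then v $ i
      else R k (\<chi> j. fps_nth (cps_subst \<gamma> (h j)) k) $ i)" for \<gamma> i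
  define y where "y n = (G ^^ n) (\<lambda>i. fps_const (v $ i) * fps_X)" for n
  have y_Suc: "y (Suc n) = G (y n)" for n by (simp add: y_def)
  have arc_G: "arc (G \<gamma>)" for \<gamma> by (simp add: arc_def G_def)
  have arc_y: "arc (y n)" for n
    by (cases n) (auto simp: y_Suc arc_G, auto simp: y_def arc_def)
  have y_1: "fps_nth (y n i) 1 = v $ i" for n i
    by (cases n) (auto simp: y_Suc G_def, auto simp: y_def)
  have G_agree: "fps_agree (Suc k) (G \<gamma> i) (G \<gamma>' i)"
    if "arc \<gamma>" "arc \<gamma>'" "\<And>i. fps_agree k (\<gamma> i) (\<gamma>' i)" for \<gamma> \<gamma>' i k
    using cps_subst_agree[OF that h] by (auto simp: fps_agree_def G_def)
  \<comment> \<open>The operator \<open>G\<close> prescribes coefficients 0 and 1, whence the head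
    start of 2; each further application gains one order.\<close>
  have y_agree: "fps_agree (n + 2) (y n i) (y (Suc n) i)" for n i
  proof (induction n arbitrary: i)
    case 0
    have "fps_nth (y 0 i) j = fps_nth (y (Suc 0) i) j" if "j < 2" for j
      using y_1[of 0 i] y_1[of "Suc 0" i] arc_y[of 0] arc_y[of "Suc 0"] that
      by (cases j) (auto simp: arc_def)
    thus ?case by (simp add: fps_agree_def)
  next
    case (Suc n)
    have "fps_agree (Suc (n + 2)) (G (y n) i) (G (y (Suc n)) i)"
      by (intro G_agree arc_y Suc.IH)
    thus ?case by (simp only: y_Suc add_Suc)
  qed
  \<comment> \<open>Coefficient \<open>k\<close> no longer changes from iterate \<open>k\<close> on,
    so the limit can be read off the diagonal.\<close>
  define \<gamma> where "\<gamma> i = Abs_fps (\<lambda>k. fps_nth (y k i) k)" for i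
  have \<gamma>_agree: "fps_agree (Suc n) (\<gamma> i) (y n i)" for n i
  proof -
    have stable: "fps_nth (y k i) k = fps_nth (y (k + d) i) k" for k d
    proof (induction d)
      case (Suc d)
      have "fps_nth (y (k + d) i) k = fps_nth (y (Suc (k + d)) i) k"
        using y_agree[of "k + d" i] by (simp add: fps_agree_def)
      thus ?case using Suc by simp
    qed simp
    show ?thesis
      unfolding fps_agree_def \<gamma>_def
    proof (intro allI impI)
      fix k assume "k < Suc n"
      thus "fps_nth (Abs_fps (\<lambda>k. fps_nth (y k i) k)) k = fps_nth (y n i) k"
        using stable[of k "n - k"] by simp
    qed
  qed
  have arc: "arc \<gamma>"
    using arc_y by (auto simp: arc_def \<gamma>_def)
  have maj_y: "fps_maj t r (y n i)" for n i
  proof (induction n arbitrary: i)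
    case 0
    have "(\<Sum>k\<le>n. norm (fps_nth (y 0 i) k) * t ^ k) \<le> r" for n
    proof -
      have "(\<Sum>k\<le>n. norm (fps_nth (y 0 i) k) * t ^ k) \<le> (\<Sum>k\<le>n. if k = 1 then norm (v $ i) * t else 0)"
        by (intro sum_mono) (auto simp: y_def)
      also have "\<dots> \<le> norm (v $ i) * t" using t by auto
      also have "\<dots> \<le> (2 * V) * t" using V(1) V(2)[of i] t by (intro mult_right_mono) auto
      finally show ?thesis by (simp add: r_def)
    qed
    thus ?case by (simp add: fps_maj_def)
  next
    case (Suc n)
    define H where "H k = (\<Sum>j\<in>UNIV. norm (fps_nth (cps_subst (y n) (h j)) k))" for k
    have "(\<Sum>k\<le>N. norm (fps_nth (G (y n) i) k) * t ^ k) \<le> r" for N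
    proof -
      have "(\<Sum>k\<le>N. norm (fps_nth (G (y n) i) k) * t ^ k) \<le>
          (\<Sum>k\<le>N. (if k = 1 then norm (v $ i) * t else 0) + \<bar>B\<bar> * (H k * t ^ k))"
      proof (rule sum_mono)
        fix k
        have Hk: "0 \<le> H k" by (simp add: H_def sum_nonneg)
        show "norm (fps_nth (G (y n) i) k) * t ^ k \<le>
          (if k = 1 then norm (v $ i) * t else 0) + \<bar>B\<bar> * (H k * t ^ k)"
        proof (cases "k < 2")
          case True
          hence "k = 0 \<or> k = 1" by auto
          thus ?thesis using t Hk by (auto simp: G_def)
        next
          case False
          have "norm (fps_nth (G (y n) i) k) \<le> B * H k"
            using False R[of k "\<chi> j. fps_nth (cps_subst (y n) (h j)) k" i] by (simp add: G_def H_def)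
          also have "\<dots> \<le> \<bar>B\<bar> * H k" using Hk by (intro mult_right_mono) auto
          finally have "norm (fps_nth (G (y n) i) k) * t ^ k \<le> \<bar>B\<bar> * H k * t ^ k"
            using t by (intro mult_right_mono) auto
          thus ?thesis using False by (simp add: mult.assoc)
        qed
      qed
      also have "\<dots> = (\<Sum>k\<le>N. if k = 1 then norm (v $ i) * t else 0) +
          \<bar>B\<bar> * (\<Sum>j\<in>UNIV. \<Sum>k\<le>N. norm (fps_nth (cps_subst (y n) (h j)) k) * t ^ k)"
        by (simp add: sum.distrib H_def sum_distrib_right sum_distrib_left) (rule sum.swap)
      also have "\<dots> \<le> V * t + \<bar>B\<bar> * (\<Sum>j\<in>UNIV. K j * r\<^sup>2)"
      proof (intro add_mono mult_left_mono sum_mono)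
        show "(\<Sum>k\<le>N. if k = 1 then norm (v $ i) * t else 0) \<le> V * t"
          using t V(1) V(2)[of i] by auto
        fix j
        have "fps_maj t (K j * r\<^sup>2) (cps_subst (y n) (h j))"
          using t r r_le by (intro cps_subst_maj[OF Suc.IH arc_y] K\<rho>(3)) auto
        thus "(\<Sum>k\<le>N. norm (fps_nth (cps_subst (y n) (h j)) k) * t ^ k) \<le> K j * r\<^sup>2"
          by (rule fps_majD)
      qed auto
      also have "\<dots> \<le> r" by (rule contr)
      finally show ?thesis .
    qed
    thus ?case by (simp add: fps_maj_def y_Suc)
  qed
  have maj: "fps_maj t r (\<gamma> i)" for i
  proof -
    have "(\<Sum>k\<le>n. norm (fps_nth (\<gamma> i) k) * t ^ k) = (\<Sum>k\<le>n. norm (fps_nth (y n i) k) * t ^ k)" for n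
      using \<gamma>_agree[of n i] by (intro sum.cong) (auto simp: fps_agree_def)
    thus ?thesis using fps_majD[OF maj_y] by (simp add: fps_maj_def)
  qed
  have fixp: "fps_nth (\<gamma> i) k = R k (\<chi> j. fps_nth (cps_subst \<gamma> (h j)) k) $ i" if "2 \<le> k" for i k
  proof -
    have "fps_agree (Suc (Suc k)) (G \<gamma> i) (G (y k) i)"
      by (intro G_agree arc arc_y \<gamma>_agree)
    hence "fps_nth (\<gamma> i) k = fps_nth (G \<gamma> i) k"
      using \<gamma>_agree[of "Suc k" i] by (simp add: fps_agree_def y_Suc)
    thus ?thesis using that by (simp add: G_def)
  qed
  have "fps_nth (\<gamma> i) 1 = v $ i" for i
    using y_1 by (simp add: \<gamma>_def)
  thus thesis using fixp by (intro that[OF arc t r r_le(1) maj]) auto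
qed


section \<open>Nilpotency of linear parts\<close>

lemma mat_mult_vec: "mat c *v u = c *s (u :: 'a::comm_semiring_1 ^ 'n)"
proof -
  have "(\<Sum>j\<in>UNIV. (if i = j then c else 0) * u $ j) = c * u $ i" for i
  proof -
    have "(\<Sum>j\<in>UNIV. (if i = j then c else 0) * u $ j) = (\<Sum>j\<in>UNIV. if i = j then c * u $ j else 0)"
      by (rule sum.cong) auto
    thus ?thesis by simp
  qed
  thus ?thesis by (simp add: vec_eq_iff matrix_vector_mult_def mat_def)
qed

text \<open>The bound must be uniform in \<open>k\<close>. Below \<open>k0\<close> there are
  finitely many inverse matrices; from \<open>k0\<close> on, \<open>k\<close> exceeds the operator
  norm of \<open>A\<close> by at least 1, and \<open>k R w = w + A R w\<close> gives norm at most 1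
  for the resolvent.\<close>

lemma bounded_resolvent:
  fixes A :: "complex ^ 'n ^ 'n"
  assumes "\<And>k u. 2 \<le> k \<Longrightarrow> A *v u = of_nat k *s u \<Longrightarrow> u = 0"
  obtains R B where "\<And>k w. 2 \<le> k \<Longrightarrow> of_nat k *s R k w - A *v R k w = w"
    "\<And>k w i. 2 \<le> k \<Longrightarrow> norm (R k w $ i) \<le> B * (\<Sum>j\<in>UNIV. norm (w $ j))"
proof -
  have "\<exists>N. 2 \<le> k \<longrightarrow> (mat (of_nat k) - A) ** N = mat 1" for k
  proof (cases "2 \<le> k")
    case True
    have "\<forall>u. (mat (of_nat k) - A) *v u = 0 \<longrightarrow> u = 0"
      using assms[OF True] by (auto simp: matrix_vector_mult_diff_rdistrib mat_mult_vec)
    then obtain N where "N ** (mat (of_nat k) - A) = mat 1"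
      using matrix_left_invertible_ker by blast
    thus ?thesis using matrix_left_right_inverse by blast
  qed auto
  then obtain N where N: "\<And>k. 2 \<le> k \<Longrightarrow> (mat (of_nat k) - A) ** N k = mat 1" by metis
  define R where "R k w = N k *v w" for k w
  have R: "of_nat k *s R k w - A *v R k w = w" if "2 \<le> k" for k w
  proof -
    have "of_nat k *s R k w - A *v R k w = (mat (of_nat k) - A) *v (N k *v w)"
      by (simp only: R_def matrix_vector_mult_diff_rdistrib mat_mult_vec)
    thus ?thesis using N[OF that] by (simp add: matrix_vector_mul_assoc)
  qed
  have bl: "bounded_linear (\<lambda>u. M *v u)" for M :: "complex ^ 'n ^ 'n"
    by (intro linear_conv_bounded_linear[THEN iffD1]) simp
  define k0 where "k0 = nat \<lceil>onorm ((*v) A)\<rceil> + 1"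
  define B where "B = 1 + (\<Sum>k<k0. onorm ((*v) (N k)))"
  have onorm_nonneg: "0 \<le> onorm ((*v) (N k))" for k
    by (rule onorm_pos_le[OF bl])
  have "norm (R k w) \<le> B * norm w" if "2 \<le> k" for k w
  proof (cases "k < k0")
    case True
    have "norm (R k w) \<le> onorm ((*v) (N k)) * norm w"
      unfolding R_def by (rule onorm[OF bl])
    also have "\<dots> \<le> B * norm w"
    proof (rule mult_right_mono)
      have "onorm ((*v) (N k)) \<le> (\<Sum>k<k0. onorm ((*v) (N k)))"
        using True onorm_nonneg by (intro member_le_sum) auto
      thus "onorm ((*v) (N k)) \<le> B" by (simp add: B_def)
    qed simp
    finally show ?thesis .
  next
    case False
    have scal: "of_nat k *s R k w = real k *\<^sub>R R k w"
      by (simp only: vec_eq_iff vector_smult_component vector_scaleR_component) (simp add: scaleR_conv_of_real)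
    have "onorm ((*v) A) + 1 \<le> real k0" unfolding k0_def by linarith
    also have "\<dots> \<le> real k" using False by simp
    finally have "(onorm ((*v) A) + 1) * norm (R k w) \<le> real k * norm (R k w)"
      by (rule mult_right_mono) simp
    also have "\<dots> = norm (w + A *v R k w)"
      using R[OF that, of w] scal by (metis diff_add_cancel norm_scaleR abs_of_nat)
    also have "\<dots> \<le> norm w + onorm ((*v) A) * norm (R k w)"
      using norm_triangle_ineq[of w "A *v R k w"] onorm[OF bl, of A "R k w"] by linarith
    finally have "norm (R k w) \<le> norm w" by (simp add: algebra_simps)
    also have "\<dots> \<le> B * norm w"
      using sum_nonneg[of "{..<k0}" "\<lambda>k. onorm ((*v) (N k))"] onorm_nonneg
      by (simp add: B_def algebra_simps)
    finally show ?thesis .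
  qed
  hence bound: "norm (R k w) \<le> B * norm w" if "2 \<le> k" for k w using that by blast
  have "0 \<le> B" unfolding B_def using onorm_nonneg by (intro add_nonneg_nonneg sum_nonneg) auto
  have "norm (R k w $ i) \<le> B * (\<Sum>j\<in>UNIV. norm (w $ j))" if "2 \<le> k" for k w i
  proof -
    have "norm (R k w $ i) \<le> norm (R k w)" by (rule Finite_Cartesian_Product.norm_nth_le)
    also have "\<dots> \<le> B * norm w" by (rule bound[OF that])
    also have "norm w \<le> (\<Sum>j\<in>UNIV. norm (w $ j))"
      unfolding norm_vec_def by (rule L2_set_le_sum) simp
    finally show ?thesis using \<open>0 \<le> B\<close> by (simp add: mult_left_mono)
  qed
  with R show thesis by (rule that)
qed

lemma mdeg_eq_1_cases:
  assumes "mdeg m < 2" obtains "m = 0" | j where "m = mexp j"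
proof (cases "m = 0")
  case False
  then obtain j where "m j \<noteq> 0" by (auto simp: fun_eq_iff)
  hence le: "mexp j \<le> m" by (simp add: mexp_le_iff)
  hence "mdeg (m - mexp j) = 0" using mdeg_diff[OF le] assms unfolding mdeg_mexp by linarith
  hence "m - mexp j = 0" by simp
  hence "m = mexp j" using le by (metis diff_diff_fun diff_zero)
  thus thesis by (rule that)
qed

lemma cps_common_radius:
  fixes P :: "'n::finite cps set"
  assumes "finite P"
  shows "\<exists>r0>0. \<forall>p\<in>P. \<forall>r. 0 \<le> r \<longrightarrow> r \<le> r0 \<longrightarrow> (\<lambda>m. norm (cps_coeff p m) * r ^ mdeg m) summable_on UNIV"
  using assms
proof (induction P rule: finite_induct)
  case empty
  show ?case by (intro exI[of _ 1]) auto
next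
  case (insert p P)
  then obtain r0 where r0: "r0 > 0"
    "\<And>q r. q \<in> P \<Longrightarrow> 0 \<le> r \<Longrightarrow> r \<le> r0 \<Longrightarrow> (\<lambda>m. norm (cps_coeff q m) * r ^ mdeg m) summable_on UNIV"
    by blast
  obtain r1 where r1: "r1 > 0" "(\<lambda>m. norm (cps_coeff p m) * r1 ^ mdeg m) summable_on UNIV"
    using cps_coeff[of p] by (auto simp: cps_convergent_def)
  have "(\<lambda>m. norm (cps_coeff p m) * r ^ mdeg m) summable_on UNIV" if "0 \<le> r" "r \<le> r1" for r
    by (rule summable_on_comparison_test[OF r1(2)])
       (use that in \<open>auto intro!: mult_left_mono power_mono\<close>)
  thus ?case using r0 r1(1) by (intro exI[of _ "min r0 r1"]) auto
qed

definition linear_part :: "('n::finite cps \<Rightarrow> 'n cps) \<Rightarrow> complex ^ 'n ^ 'n" where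
  "linear_part \<theta> = (\<chi> i j. cps_coeff (\<theta> (cps_var i)) (mexp j))"

lemma fps_mult_nth_low:
  assumes "\<And>j. j < k \<Longrightarrow> fps_nth p j = (0 :: complex)"
  shows "fps_nth (a * p) k = fps_nth a 0 * fps_nth p k"
proof -
  have "fps_nth (a * p) k = (\<Sum>j=0..k. if j = 0 then fps_nth a 0 * fps_nth p k else 0)"
    unfolding fps_mult_nth by (intro sum.cong) (use assms in auto)
  thus ?thesis by simp
qed

text \<open>Since 1 is an eigenvalue of the linear part but no integer of absolute value at least 2 is,
  there is a convergent arc \<open>\<gamma>(s) = v s + \<dots>\<close> with \<open>s \<gamma>' = \<theta>(\<gamma>)\<close>.  The lowest order terms of
  \<open>f \<circ> \<gamma>\<close> and \<open>\<nabla>f \<circ> \<gamma>\<close> are eigenvectors for an excluded eigenvalue, so both vanish.\<close>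

lemma no_singular_arc:
  fixes f :: "'n::finite cps"
  assumes iso: "isolated_singularity f" and ord: "cps_ord_ge 3 f"
    and \<theta>: "\<theta> \<in> cps_Der" and \<theta>f: "\<theta> f = g * f" and g: "cps_coeff g 0 = 0"
    and \<theta>0: "\<And>i. cps_coeff (\<theta> (cps_var i)) 0 = 0"
    and v: "linear_part \<theta> *v v = v" "v \<noteq> 0"
    and res: "\<And>k u. 2 \<le> k \<Longrightarrow> linear_part \<theta> *v u = of_nat k *s u \<Longrightarrow> u = 0"
    and res': "\<And>k u. 2 \<le> k \<Longrightarrow> linear_part \<theta> *v u = (- of_nat k) *s u \<Longrightarrow> u = 0"
  shows False
proof -
  define A where "A = linear_part \<theta>"
  define h where "h i = \<theta> (cps_var i) - (\<Sum>j\<in>UNIV. cps_const (A $ i $ j) * cps_var j)" for i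
  have h: "cps_ord_ge 2 (h i)" for i
    unfolding cps_ord_ge_def
  proof (intro allI impI)
    fix m :: "'n \<Rightarrow> nat" assume "mdeg m < 2"
    thus "cps_coeff (h i) m = 0"
    proof (cases rule: mdeg_eq_1_cases)
      case 1
      thus ?thesis by (simp add: h_def \<theta>0 cps_monom.rep_eq)
    next
      case (2 j)
      thus ?thesis
        by (simp add: h_def cps_monom.rep_eq A_def linear_part_def if_distrib[of "\<lambda>x. _ * x"] cong: if_cong)
    qed
  qed
  obtain R B where R: "\<And>k w. 2 \<le> k \<Longrightarrow> of_nat k *s R k w - A *v R k w = w"
    and B: "\<And>k w i. 2 \<le> k \<Longrightarrow> norm (R k w $ i) \<le> B * (\<Sum>j\<in>UNIV. norm (w $ j))"
    using bounded_resolvent[of A] res unfolding A_def by blast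
  \<comment> \<open>Fixed before the arc is built, so that the arc can be kept where
    \<open>f\<close> and its partial derivatives converge absolutely.\<close>
  obtain r0 where r0: "0 < r0" "\<And>p r. p \<in> insert f (range (\<lambda>i. cps_pderiv i f)) \<Longrightarrow> 0 \<le> r \<Longrightarrow> r \<le> r0 \<Longrightarrow>
      (\<lambda>m. norm (cps_coeff p m) * r ^ mdeg m) summable_on UNIV"
    using cps_common_radius[of "insert f (range (\<lambda>i. cps_pderiv i f))"] by auto
  obtain \<gamma> t r where arc: "arc \<gamma>" and t: "0 < t" and r: "0 \<le> r" "r \<le> r0" and maj: "\<And>i. fps_maj t r (\<gamma> i)"
    and \<gamma>1: "\<And>i. fps_nth (\<gamma> i) 1 = v $ i"
    and \<gamma>k: "\<And>i k. 2 \<le> k \<Longrightarrow> fps_nth (\<gamma> i) k = R k (\<chi> j. fps_nth (cps_subst \<gamma> (h j)) k) $ i"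
    by (rule resolvent_fixed_point[where h = h and R = R and B = B and v = v and ?r0.0 = r0])
       (rule h | rule r0(1) | (rule B, assumption) | blast)+
  interpret arc \<gamma> by fact
  \<comment> \<open>Order 0 is trivial, order 1 says that \<open>v\<close> is an eigenvector for 1,
    and order \<open>k \<ge> 2\<close> is the equation solved by \<open>R k\<close>.\<close>
  have ode: "fps_X * fps_deriv (\<gamma> i) = cps_subst \<gamma> (\<theta> (cps_var i))" for i
  proof (rule fps_ext)
    fix k
    have "cps_subst \<gamma> (\<theta> (cps_var i)) = cps_subst \<gamma> (h i + (\<Sum>j\<in>UNIV. cps_const (A $ i $ j) * cps_var j))"
      by (simp add: h_def)
    also have "\<dots> = cps_subst \<gamma> (h i) + (\<Sum>j\<in>UNIV. fps_const (A $ i $ j) * \<gamma> j)"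
      by (simp add: subst_add subst_sum subst_mult subst_const)
    finally have eq: "fps_nth (cps_subst \<gamma> (\<theta> (cps_var i))) k =
        fps_nth (cps_subst \<gamma> (h i)) k + (\<Sum>j\<in>UNIV. A $ i $ j * fps_nth (\<gamma> j) k)"
      by (simp add: fps_sum_nth)
    have lhs: "fps_nth (fps_X * fps_deriv (\<gamma> i)) k = of_nat k * fps_nth (\<gamma> i) k"
      by (cases k) simp_all
    consider "k = 0" | "k = 1" | "2 \<le> k" by linarith
    thus "fps_nth (fps_X * fps_deriv (\<gamma> i)) k = fps_nth (cps_subst \<gamma> (\<theta> (cps_var i))) k"
    proof cases
      case 1
      thus ?thesis by (simp add: \<theta>0)
    next
      case 2
      have "v $ i = (\<Sum>j\<in>UNIV. A $ i $ j * v $ j)"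
        using v(1) by (simp add: A_def vec_eq_iff matrix_vector_mult_def)
      moreover have "fps_nth (cps_subst \<gamma> (h i)) 1 = 0"
        by (rule subst_ord_ge[OF h]) simp
      ultimately show ?thesis unfolding lhs eq using 2 \<gamma>1 by simp
    next
      case 3
      define w where "w = (\<chi> j. fps_nth (cps_subst \<gamma> (h j)) k)"
      have "of_nat k * (R k w $ i) - (\<Sum>j\<in>UNIV. A $ i $ j * (R k w $ j)) = w $ i"
        using R[OF 3, of w] by (simp add: vec_eq_iff matrix_vector_mult_def)
      thus ?thesis unfolding lhs eq \<gamma>k[OF 3] w_def by (simp add: algebra_simps)
    qed
  qed
  \<comment> \<open>Along the arc \<open>\<theta>\<close> becomes the Euler operator of the
    parameter, which multiplies coefficient \<open>k\<close> by \<open>k\<close>.\<close>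
  have chain: "fps_X * fps_deriv (cps_subst \<gamma> a) = cps_subst \<gamma> (\<theta> a)" for a
  proof -
    have "fps_X * fps_deriv (cps_subst \<gamma> a) =
        (\<Sum>i\<in>UNIV. cps_subst \<gamma> (cps_pderiv i a) * (fps_X * fps_deriv (\<gamma> i)))"
      by (simp add: subst_chain_rule sum_distrib_left mult_ac)
    also have "\<dots> = cps_subst \<gamma> (\<Sum>i\<in>UNIV. \<theta> (cps_var i) * cps_pderiv i a)"
      by (simp add: ode subst_sum subst_mult mult.commute)
    finally show ?thesis by (simp flip: cps_Der_expand[OF \<theta>])
  qed
  have euler: "of_nat k * fps_nth (cps_subst \<gamma> a) k = fps_nth (cps_subst \<gamma> (\<theta> a)) k" for k a
    unfolding chain[symmetric] by (cases k) simp_all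
  \<comment> \<open>Since \<open>g\<close> has no constant term, the right-hand side contributes
    nothing in the lowest order, leaving \<open>k\<close> times the coefficient equal to 0.\<close>
  have u: "cps_subst \<gamma> f = 0"
  proof (rule fps_ext)
    fix k show "fps_nth (cps_subst \<gamma> f) k = fps_nth 0 k"
    proof (induction k rule: less_induct)
      case (less k)
      show ?case
      proof (cases "k = 0")
        case True
        thus ?thesis using subst_ord_ge[OF ord, of 0] by simp
      next
        case False
        have "of_nat k * fps_nth (cps_subst \<gamma> f) k = fps_nth (cps_subst \<gamma> g * cps_subst \<gamma> f) k"
          by (simp add: euler \<theta>f subst_mult)
        also have "\<dots> = 0" using less by (subst fps_mult_nth_low) (auto simp: g)
        finally show ?thesis using False by simp
      qed
    qed
  qed
  define p where "p i = cps_subst \<gamma> (cps_pderiv i f)" for i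
  \<comment> \<open>Differentiate \<open>\<theta> f = g * f\<close> and solve for the part with
    second derivatives, which is \<open>\<theta>\<close> applied to
    \<open>cps_pderiv i f\<close>.\<close>
  have deriv: "\<theta> (cps_pderiv i f) = cps_pderiv i g * f + g * cps_pderiv i f -
      (\<Sum>j\<in>UNIV. cps_pderiv i (\<theta> (cps_var j)) * cps_pderiv j f)" for i
  proof -
    have "cps_pderiv i (\<theta> f) = cps_pderiv i (\<Sum>j\<in>UNIV. \<theta> (cps_var j) * cps_pderiv j f)"
      by (simp flip: cps_Der_expand[OF \<theta>])
    also have "\<dots> = (\<Sum>j\<in>UNIV. cps_pderiv i (\<theta> (cps_var j)) * cps_pderiv j f) +
        (\<Sum>j\<in>UNIV. \<theta> (cps_var j) * cps_pderiv j (cps_pderiv i f))"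
      by (simp add: cps_Der_sum[OF cps_pderiv_Der] cps_pderiv_mult sum.distrib
          cps_pderiv_commute[of i])
    also have "(\<Sum>j\<in>UNIV. \<theta> (cps_var j) * cps_pderiv j (cps_pderiv i f)) = \<theta> (cps_pderiv i f)"
      by (rule cps_Der_expand[OF \<theta>, symmetric])
    finally show ?thesis by (simp add: \<theta>f cps_pderiv_mult)
  qed
  have p0: "fps_nth (p i) k = 0" for i k
  proof (induction k arbitrary: i rule: less_induct)
    case (less k)
    show ?case
    proof (cases "k < 2")
      \<comment> \<open>Here order 3 of \<open>f\<close> is decisive: coefficient 1 would lead to
        the eigenvalue -1, which \<open>res'\<close> does not exclude.\<close>
      case True
      have "cps_ord_ge 2 (cps_pderiv i f)"
        by (rule cps_ord_ge_pderiv) (use ord in \<open>simp add: numeral_3_eq_3 numeral_2_eq_2\<close>)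
      thus ?thesis unfolding p_def using subst_ord_ge True by blast
    next
      case False
      have "of_nat k * fps_nth (p i) k = - (\<Sum>j\<in>UNIV. A $ j $ i * fps_nth (p j) k)" for i
      proof -
        have "of_nat k * fps_nth (p i) k = fps_nth (cps_subst \<gamma> (\<theta> (cps_pderiv i f))) k"
          by (simp add: p_def euler)
        also have "cps_subst \<gamma> (\<theta> (cps_pderiv i f)) =
            cps_subst \<gamma> g * p i - (\<Sum>j\<in>UNIV. cps_subst \<gamma> (cps_pderiv i (\<theta> (cps_var j))) * p j)"
          by (simp add: deriv subst_diff subst_add subst_sum subst_mult u p_def)
        also have "fps_nth \<dots> k = - (\<Sum>j\<in>UNIV. A $ j $ i * fps_nth (p j) k)"
          using less by (simp add: fps_sum_nth fps_mult_nth_low g cps_coeff_pderiv A_def linear_part_def)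
        finally show ?thesis .
      qed
      hence *: "transpose (mat (of_nat k) + A) *v (\<chi> j. fps_nth (p j) k) = 0"
      proof -
        have "transpose (mat (of_nat k) + A) = mat (of_nat k) + transpose A"
          by (simp add: vec_eq_iff transpose_def mat_def)
        thus ?thesis
          using \<open>\<And>i. of_nat k * fps_nth (p i) k = _ i\<close>
          by (simp add: matrix_vector_mult_add_rdistrib mat_mult_vec del: transpose_matrix_vector)
             (simp add: vec_eq_iff matrix_vector_mult_def transpose_def del: transpose_matrix_vector)
      qed
      \<comment> \<open>Injectivity is known for \<open>k + A\<close>, whereas the gradient
        satisfies the transposed system; invertibility carries over by transposition.\<close>
      have "\<forall>u. (mat (of_nat k) + A) *v u = 0 \<longrightarrow> u = 0"
        using res'[of k] False
        by (auto simp: matrix_vector_mult_add_rdistrib mat_mult_vec A_def add_eq_0_iff)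
      then obtain N where "N ** (mat (of_nat k) + A) = mat 1"
        using matrix_left_invertible_ker by blast
      hence "transpose N ** transpose (mat (of_nat k) + A) = mat 1"
        by (metis matrix_left_right_inverse matrix_transpose_mul transpose_mat)
      hence "(\<chi> j. fps_nth (p j) k) = 0"
        using * by (metis matrix_vector_mul_assoc matrix_vector_mul_lid matrix_vector_mult_0_right)
      thus ?thesis by (simp add: vec_eq_iff)
    qed
  qed
  define z where "z s = (\<chi> i. eval_fps (\<gamma> i) s)" for s
  have zero: "cps_eval f (z s) = 0" "cps_eval (cps_pderiv i f) (z s) = 0" if "norm s < t" for s i
  proof -
    have "p i = 0" using p0 by (intro fps_ext) simp
    thus "cps_eval f (z s) = 0" "cps_eval (cps_pderiv i f) (z s) = 0"
      using cps_eval_arc_eq_0[OF arc maj that r0(2)[OF _ r]] u by (auto simp: z_def p_def)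
  qed
  have rad: "ereal 0 < fps_conv_radius (\<gamma> i)" for i
    using fps_maj_conv_radius[OF maj[of i]] t by (meson ereal_less(2) less_ereal.simps(1) less_imp_le less_le_trans)
  have "z \<midarrow>0\<rightarrow> 0"
  proof (rule vec_tendstoI)
    fix i
    have "(eval_fps (\<gamma> i) \<longlongrightarrow> eval_fps (\<gamma> i) 0) (at 0)"
      using rad[of i] by (intro continuous_within[THEN iffD1] continuous_eval_fps) (simp add: zero_ereal_def)
    thus "((\<lambda>s. z s $ i) \<longlongrightarrow> 0 $ i) (at 0)"
      by (simp add: z_def eval_fps_at_0)
  qed
  hence ev1: "eventually (\<lambda>s. cps_eval f (z s) = 0 \<and> (\<forall>i. cps_eval (cps_pderiv i f) (z s) = 0) \<longleftrightarrow> z s = 0) (at 0)"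
    using iso unfolding isolated_singularity_def by (rule eventually_compose_filterlim[rotated])
  \<comment> \<open>A nonzero component of \<open>v\<close> makes \<open>\<gamma> i\<close> divided
    by the parameter nonzero near 0, so the arc does leave the origin.\<close>
  obtain i where i: "v $ i \<noteq> 0" using v(2) by (auto simp: vec_eq_iff)
  have "(eval_fps (fps_shift 1 (\<gamma> i)) \<longlongrightarrow> eval_fps (fps_shift 1 (\<gamma> i)) 0) (at 0)"
    using rad[of i] by (intro continuous_within[THEN iffD1] continuous_eval_fps) (simp add: zero_ereal_def)
  hence ev2: "eventually (\<lambda>s. eval_fps (fps_shift 1 (\<gamma> i)) s \<noteq> 0) (at 0)"
    by (rule tendsto_imp_eventually_ne) (use i \<gamma>1 in \<open>simp add: eval_fps_at_0\<close>)
  have ev3: "eventually (\<lambda>s :: complex. norm s < t \<and> s \<noteq> 0) (at 0)"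
    using t by (auto simp: eventually_at intro!: exI[of _ t])
  have "eventually (\<lambda>s :: complex. False) (at 0)"
    using ev1 ev2 ev3
  proof eventually_elim
    case (elim s)
    have st: "ereal (norm s) < fps_conv_radius (\<gamma> i)"
      using fps_maj_conv_radius[OF maj[of i]] t elim(3) by (meson less_ereal.simps(1) less_imp_le less_le_trans)
    have "eval_fps (\<gamma> i) s = eval_fps (fps_X * fps_shift 1 (\<gamma> i)) s"
      using fps_eq_X_times_shift[of "\<gamma> i"] by simp
    also have "\<dots> = s * eval_fps (fps_shift 1 (\<gamma> i)) s"
      using st by (subst eval_fps_mult) auto
    also have "\<dots> \<noteq> 0" using elim by simp
    finally have "z s \<noteq> 0" by (auto simp: z_def vec_eq_iff)
    thus False using elim zero[of s] by blast
  qed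
  thus False by simp
qed

lemma linear_part_no_eigenvalue:
  fixes f :: "'n::finite cps"
  assumes iso: "isolated_singularity f" and ord: "cps_ord_ge 3 f"
    and \<theta>: "\<theta> \<in> cps_Der" and \<theta>f: "\<theta> f = g * f" and g: "cps_coeff g 0 = 0"
    and \<theta>0: "\<And>i. cps_coeff (\<theta> (cps_var i)) 0 = 0"
    and eig: "linear_part \<theta> *v u = \<kappa> *s u" "u \<noteq> 0"
  shows "\<kappa> = 0"
proof (rule ccontr)
  assume "\<kappa> \<noteq> 0"
  define A where "A = linear_part \<theta>"
  have bl: "bounded_linear (\<lambda>u. A *v u)"
    by (intro linear_conv_bounded_linear[THEN iffD1]) simp
  \<comment> \<open>Pairs of an eigenvalue and a unit eigenvector form a compact set, so an
    eigenvalue of maximal modulus exists without recourse to the characteristic polynomial.\<close>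
  define E where "E = {(\<mu>, u). norm u = 1 \<and> A *v u = \<mu> *s u}"
  have norm_sc: "norm (\<mu> *s u) = norm \<mu> * norm u" for \<mu> and u :: "complex ^ 'n"
    by (simp add: norm_vec_def norm_mult L2_set_right_distrib)
  have normalise: "\<exists>u'. (\<mu>, u') \<in> E" if "A *v u = \<mu> *s u" "u \<noteq> 0" for \<mu> u
  proof -
    have "A *v (of_real (1 / norm u) *s u) = \<mu> *s (of_real (1 / norm u) *s u)"
      using that(1) by (simp add: vector_scalar_commute mult_ac)
    moreover have "norm (of_real (1 / norm u) *s u) = 1"
      using that(2) by (simp add: norm_sc norm_divide)
    ultimately show ?thesis by (auto simp: E_def)
  qed
  have "closed E"
  proof -
    have "E = {x. norm (snd x) = 1} \<inter> (\<Inter>i. {x. (\<Sum>j\<in>UNIV. A $ i $ j * (snd x $ j)) = fst x * (snd x $ i)})"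
      by (auto simp: E_def vec_eq_iff matrix_vector_mult_def)
    also have "closed \<dots>"
      by (intro closed_Int closed_INT ballI closed_Collect_eq continuous_intros)
    finally show ?thesis .
  qed
  moreover have "bounded E"
  proof -
    have "E \<subseteq> cball 0 (onorm ((*v) A)) \<times> cball 0 1"
    proof
      fix x assume "x \<in> E"
      then obtain \<mu> u where x: "x = (\<mu>, u)" "norm u = 1" "A *v u = \<mu> *s u" by (auto simp: E_def)
      have "norm \<mu> = norm (A *v u)" using x by (simp add: norm_sc)
      also have "\<dots> \<le> onorm ((*v) A)" using onorm[OF bl, of u] x by simp
      finally show "x \<in> cball 0 (onorm ((*v) A)) \<times> cball 0 1" using x by simp
    qed
    thus ?thesis by (rule bounded_subset[OF bounded_Times[OF bounded_cball bounded_cball]])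
  qed
  ultimately have "compact E" by (simp add: compact_eq_bounded_closed)
  moreover obtain u' where u': "(\<kappa>, u') \<in> E" using normalise eig unfolding A_def by blast
  ultimately obtain x where x: "x \<in> E" "\<And>y. y \<in> E \<Longrightarrow> norm (fst y) \<le> norm (fst x)"
    using continuous_attains_sup[of E "\<lambda>x. norm (fst x)"] by (force intro!: continuous_intros)
  obtain \<mu> v where \<mu>v: "x = (\<mu>, v)" by force
  have max: "norm \<nu> \<le> norm \<mu>" if "(\<nu>, w) \<in> E" for \<nu> w using x(2)[OF that] \<mu>v by simp
  have "\<mu> \<noteq> 0" using max[OF u'] \<open>\<kappa> \<noteq> 0\<close> by auto
  have v: "A *v v = \<mu> *s v" "v \<noteq> 0" using x(1) \<mu>v by (auto simp: E_def)
  define \<eta> where "\<eta> = vf_scale (cps_const (1 / \<mu>)) \<theta>"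
  have lin: "linear_part \<eta> *v w = (1 / \<mu>) *s (A *v w)" for w
    by (simp add: linear_part_def \<eta>_def vf_scale_def A_def vec_eq_iff matrix_vector_mult_def
        sum_divide_distrib)
  have ev: "A *v w = (\<mu> * c) *s w" if "linear_part \<eta> *v w = c *s w" for w c
  proof -
    have "A *v w = \<mu> *s (linear_part \<eta> *v w)" using \<open>\<mu> \<noteq> 0\<close> by (simp add: lin)
    thus ?thesis by (simp add: that)
  qed
  have res: "w = 0" if "linear_part \<eta> *v w = c *s w" "norm c \<ge> 2" for w c
  proof (rule ccontr)
    note ev_w = ev[OF that(1)]
    assume "w \<noteq> 0"
    then obtain w' where w': "(\<mu> * c, w') \<in> E" using normalise[OF ev_w] by blast
    have "norm \<mu> * norm c \<le> norm \<mu> * 1" using max[OF w'] by (simp add: norm_mult)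
    hence "norm c \<le> 1" using \<open>\<mu> \<noteq> 0\<close> by simp
    thus False using that(2) by simp
  qed
  show False
  proof (rule no_singular_arc[OF iso ord])
    show "\<eta> \<in> cps_Der"
      by (rule cps_DerI) (simp_all add: \<eta>_def cps_DerD[OF \<theta>] vf_scale_def distrib_left mult_ac)
    show "\<eta> f = (cps_const (1 / \<mu>) * g) * f" by (simp add: \<eta>_def vf_scale_def \<theta>f mult.assoc)
    show "linear_part \<eta> *v v = v" using v \<open>\<mu> \<noteq> 0\<close> by (simp add: lin)
    show "u = 0" if "2 \<le> k" "linear_part \<eta> *v u = of_nat k *s u" for k u
      by (rule res[OF that(2)]) (use that(1) in simp)
    show "u = 0" if "2 \<le> k" "linear_part \<eta> *v u = (- of_nat k) *s u" for k u
      by (rule res[OF that(2)]) (use that(1) in simp)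
  qed (use g \<theta>0 v in \<open>auto simp: \<eta>_def vf_scale_def\<close>)
qed


section \<open>Engel's theorem\<close>

definition mprod :: "('a::semiring_1 ^ 'n ^ 'n) list \<Rightarrow> 'a ^ 'n ^ 'n" where
  "mprod xs = foldr (**) xs (mat 1)"

lemma mprod_simps [simp]: "mprod [] = mat 1" "mprod (x # xs) = x ** mprod xs"
  by (simp_all add: mprod_def)

lemma mprod_append: "mprod (xs @ ys) = mprod xs ** mprod ys"
  by (induction xs) (simp_all add: matrix_mul_assoc)

text \<open>Over a field, a basis-free form of simultaneous strict triangularity.\<close>

definition nil_products :: "nat \<Rightarrow> ('a::semiring_1 ^ 'n ^ 'n) set \<Rightarrow> bool" where
  "nil_products N S \<longleftrightarrow> (\<forall>xs. set xs \<subseteq> S \<longrightarrow> length xs = N \<longrightarrow> mprod xs = 0)"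

lemma matrix_mul_0 [simp]: "0 ** A = (0 :: 'a::semiring_1 ^ 'n ^ 'n)" "A ** 0 = (0 :: 'a ^ 'n ^ 'n)"
  by (simp_all add: matrix_matrix_mult_def vec_eq_iff)

lemma nil_products_ge:
  assumes "nil_products N S" "set xs \<subseteq> S" "N \<le> length xs"
  shows "mprod xs = 0"
proof -
  have "mprod (take N xs) = 0"
    using assms set_take_subset[of N xs] by (auto simp: nil_products_def)
  moreover have "mprod xs = mprod (take N xs) ** mprod (drop N xs)"
    by (simp flip: mprod_append)
  ultimately show ?thesis by simp
qed

lemma iterate_eq_mprod: "((*v) A ^^ k) u = mprod (replicate k A) *v u"
  by (induction k) (simp_all add: matrix_vector_mul_assoc)

lemma no_eigenvalue_imp_nilpotent_at:
  fixes A :: "complex ^ 'n ^ 'n"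
  assumes eig: "\<And>c w. A *v w = c *s w \<Longrightarrow> w \<noteq> 0 \<Longrightarrow> c = 0"
  shows "\<exists>M. ((*v) A ^^ M) u = 0"
proof -
  define it where "it k = ((*v) A ^^ k) u" for k
  have it_Suc: "A *v it k = it (Suc k)" for k by (simp add: it_def)
  \<comment> \<open>\<open>P p k\<close> is the vector \<open>p(A) A^k u\<close>.\<close>
  define P where "P p k = (\<Sum>i\<le>Polynomial.degree p. Polynomial.coeff p i *s it (i + k))" for p k
  have P_alt: "P p k = (\<Sum>i\<le>d. Polynomial.coeff p i *s it (i + k))" if "Polynomial.degree p \<le> d" for p k d
    unfolding P_def using that
    by (intro sum.mono_neutral_left) (auto simp: coeff_eq_0)
  have shift: "A *v P q k = P q (Suc k)" for q k
    unfolding P_def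
    by (simp add: vec.linear_sum[OF matrix_vector_mul_linear_gen] vector_scalar_commute it_Suc)
  have mult: "P ([:- l, 1:] * q) k = A *v P q k - l *s P q k" for l q k
  proof -
    define d where "d = Suc (Polynomial.degree q)"
    have "Polynomial.degree ([:- l, 1:] * q) \<le> d"
      using Polynomial.degree_mult_le[of "[:- l, 1:]" q] by (simp add: d_def)
    hence "P ([:- l, 1:] * q) k = (\<Sum>i\<le>d. Polynomial.coeff ([:- l, 1:] * q) i *s it (i + k))"
      by (rule P_alt)
    moreover have "Polynomial.coeff ([:- l, 1:] * q) i = Polynomial.coeff (pCons 0 q) i - l * Polynomial.coeff q i" for i
      by simp
    ultimately have "P ([:- l, 1:] * q) k =
        (\<Sum>i\<le>d. Polynomial.coeff (pCons 0 q) i *s it (i + k)) - (\<Sum>i\<le>d. (l * Polynomial.coeff q i) *s it (i + k))"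
      by (simp only: vec.scale_left_diff_distrib sum_subtractf)
    moreover have "(\<Sum>i\<le>d. Polynomial.coeff (pCons 0 q) i *s it (i + k)) = A *v P q k"
      unfolding d_def shift by (subst sum.atMost_Suc_shift) (simp add: P_def)
    moreover have "(\<Sum>i\<le>d. (l * Polynomial.coeff q i) *s it (i + k)) = l *s P q k"
      using P_alt[of q d k] by (simp add: d_def vec.scale_sum_right)
    ultimately show ?thesis by simp
  qed
  have main: "\<exists>M. it M = 0" if "P p k = 0" "p \<noteq> 0" for p k
    using that
  proof (induction "Polynomial.degree p" arbitrary: p k)
    case 0
    then obtain c where "p = [:c:]" by (metis degree_eq_zeroE)
    thus ?case using 0 by (intro exI[of _ k]) (auto simp: P_def)
  next
    case (Suc d)
    have "\<not> constant (poly p)" using Suc.hyps(2) by (simp add: constant_degree)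
    then obtain l where "poly p l = 0" using fundamental_theorem_of_algebra by blast
    then obtain q where q: "p = [:- l, 1:] * q" by (metis poly_eq_0_iff_dvd dvdE)
    have q0: "q \<noteq> 0" using q Suc.prems by auto
    have "Polynomial.degree p = Polynomial.degree [:- l, 1:] + Polynomial.degree q"
      unfolding q by (rule Polynomial.degree_mult_eq) (use q0 in auto)
    hence deg: "d = Polynomial.degree q" using Suc.hyps(2) by simp
    have eq: "A *v P q k = l *s P q k" using Suc.prems(1) unfolding q mult by simp
    show ?case
    proof (cases "l = 0")
      case True
      hence "P q (Suc k) = 0" using eq shift by simp
      thus ?thesis using Suc.hyps(1)[OF deg _ q0] by blast
    next
      case False
      hence "P q k = 0" using eig[OF eq] by blast
      thus ?thesis using Suc.hyps(1)[OF deg _ q0] by blast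
    qed
  qed
  show ?thesis
  \<comment> \<open>Linear dependence concerns sets of vectors, so repeated iterates are treated
    apart; they are killed by the difference of two monomials.\<close>
  proof (cases "inj_on it {..CARD('n)}")
    case False
    then obtain i j where ij: "i < j" "it i = it j"
      by (auto simp: inj_on_def) (metis linorder_neqE_nat)
    define p where "p = Polynomial.monom 1 j - Polynomial.monom (1 :: complex) i"
    have "Polynomial.coeff p j = 1" using ij by (simp add: p_def)
    hence "p \<noteq> 0" by auto
    moreover have "P p 0 = 0"
    proof -
      have "Polynomial.degree p \<le> j"
        using ij by (intro degree_le) (auto simp: p_def)
      hence "P p 0 = (\<Sum>n\<le>j. Polynomial.coeff p n *s it n)"
        using P_alt[of p j 0] by simp
      also have "\<dots> = (\<Sum>n\<le>j. (if n = j then it j else 0) - (if n = i then it i else 0))"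
        using ij by (intro sum.cong) (auto simp: p_def)
      finally have "P p 0 = (\<Sum>n\<le>j. (if n = j then it j else 0) - (if n = i then it i else 0))" .
      thus ?thesis using ij by (simp add: sum_subtractf)
    qed
    ultimately show ?thesis using main unfolding it_def by blast
  next
    case True
    define S where "S = it ` {..CARD('n)}"
    have "card S = Suc CARD('n)" unfolding S_def using card_image[OF True] by simp
    hence "vec.dependent S"
      using vec.independent_card_le_dim[of S UNIV] by (auto simp: vec.dim_UNIV S_def card_cart_basis)
    then obtain c where c: "(\<Sum>v\<in>S. c v *s v) = 0" "\<exists>v\<in>S. c v \<noteq> 0"
      using vec.dependent_finite[of S] by (auto simp: S_def)
    define p where "p = Abs_poly (\<lambda>i. if i \<le> CARD('n) then c (it i) else 0)"
    have coeff: "Polynomial.coeff p i = (if i \<le> CARD('n) then c (it i) else 0)" for i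
      unfolding p_def by (subst coeff_Abs_poly[of "CARD('n)"]) auto
    have "P p 0 = (\<Sum>i\<le>CARD('n). c (it i) *s it i)"
      by (subst P_alt[of p "CARD('n)"]) (auto simp: coeff intro!: degree_le)
    also have "\<dots> = (\<Sum>v\<in>S. c v *s v)"
      unfolding S_def by (simp add: sum.reindex[OF True])
    finally have "P p 0 = 0" using c(1) by simp
    moreover have "p \<noteq> 0"
    proof -
      obtain i where "i \<le> CARD('n)" "c (it i) \<noteq> 0" using c(2) by (auto simp: S_def)
      thus ?thesis using coeff[of i] by auto
    qed
    ultimately show ?thesis using main unfolding it_def by blast
  qed
qed

lemma no_eigenvalue_imp_nilpotent:
  fixes A :: "complex ^ 'n ^ 'n"
  assumes eig: "\<And>c w. A *v w = c *s w \<Longrightarrow> w \<noteq> 0 \<Longrightarrow> c = 0"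
  shows "\<exists>M. mprod (replicate M A) = 0"
proof -
  have "\<exists>M. ((*v) A ^^ M) (axis i 1) = 0" for i
    by (rule no_eigenvalue_imp_nilpotent_at[OF eig])
  then obtain m where m: "\<And>i. ((*v) A ^^ m i) (axis i 1) = 0" by metis
  define M where "M = Max (range m)"
  have "mprod (replicate M A) *v axis i 1 = 0" for i
  proof -
    have "m i \<le> M" by (simp add: M_def)
    hence "((*v) A ^^ M) (axis i 1) = ((*v) A ^^ (M - m i)) (((*v) A ^^ m i) (axis i 1))"
      using funpow_add[of "M - m i" "m i" "(*v) A"] by simp
    moreover have "((*v) A ^^ n) 0 = 0" for n by (induction n) simp_all
    ultimately show ?thesis by (simp add: m flip: iterate_eq_mprod)
  qed
  hence "mprod (replicate M A) $ k $ i = 0" for k i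
    by (simp add: vec_eq_iff matrix_vector_mult_def axis_def if_distrib[of "\<lambda>x. _ * x"] cong: if_cong)
  hence "mprod (replicate M A) = 0" by (simp add: vec_eq_iff)
  thus ?thesis by blast
qed

definition mcomm :: "complex ^ 'n ^ 'n \<Rightarrow> complex ^ 'n ^ 'n \<Rightarrow> complex ^ 'n ^ 'n" where
  "mcomm A B = A ** B - B ** A"

lemma matrix_mult_bilinear_simps:
  fixes A B C :: "complex ^ 'n ^ 'n"
  shows "A ** (B + C) = A ** B + A ** C" "(A + B) ** C = A ** C + B ** C"
    "A ** (B - C) = A ** B - A ** C" "(A - B) ** C = A ** C - B ** C"
    "A ** (c *\<^sub>R B) = c *\<^sub>R (A ** B)" "(c *\<^sub>R A) ** B = c *\<^sub>R (A ** B)"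
  by (simp_all add: matrix_matrix_mult_def vec_eq_iff distrib_left distrib_right sum.distrib
      left_diff_distrib right_diff_distrib sum_subtractf scaleR_sum_right)

lemma matrix_vector_mult_scaleR_complex:
  fixes A :: "complex ^ 'n ^ 'n"
  shows "A *v (c *\<^sub>R x) = c *\<^sub>R (A *v x)" "(c *\<^sub>R A) *v x = c *\<^sub>R (A *v x)"
  by (simp_all add: matrix_vector_mult_def vec_eq_iff scaleR_sum_right)

text \<open>The span \<open>V\<^sub>p\<close> of the images of \<open>p\<close>-fold products from \<open>H\<close> is stable under \<open>y\<close>.  A product of \<open>M\<close>
  elements of \<open>H'\<close> agrees on \<open>V\<^sub>p\<close> with a multiple of \<open>y\<^sup>M = 0\<close> modulo \<open>V\<^sub>p\<^sub>+\<^sub>1\<close>.\<close>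

lemma nil_products_extend:
  fixes H :: "(complex ^ 'n ^ 'n) set"
  assumes N: "nil_products N H"
    and comm: "\<And>h. h \<in> H \<Longrightarrow> mcomm y h \<in> H"
    and M: "mprod (replicate M y) = 0"
    and H': "\<And>x. x \<in> H' \<Longrightarrow> \<exists>h\<in>H. \<exists>c. x = h + c *\<^sub>R y"
  shows "nil_products (N * M) H'"
proof -
  define V where "V p = span {mprod hs *v u | hs u. set hs \<subseteq> H \<and> length hs = p}" for p
  have subsp: "subspace (V p)" for p by (simp add: V_def)
  have V_map: "A *v v \<in> W" if "v \<in> V p" "subspace W"
    "\<And>hs u. set hs \<subseteq> H \<Longrightarrow> length hs = p \<Longrightarrow> A *v (mprod hs *v u) \<in> W" for A :: "complex ^ 'n ^ 'n" and v p W
    using that(1) unfolding V_def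
  proof (induction rule: span_induct_alt)
    case base
    show ?case using subspace_0[OF that(2)] by simp
  next
    case (step c x z)
    then obtain hs u where x: "x = mprod hs *v u" "set hs \<subseteq> H" "length hs = p" by blast
    have "A *v (c *\<^sub>R x + z) = c *\<^sub>R (A *v x) + A *v z"
      by (simp add: matrix_vector_right_distrib matrix_vector_mult_scaleR_complex)
    thus ?case using step that x by (simp add: subspace_add subspace_scale)
  qed
  have base: "mprod hs *v u \<in> V p" if "set hs \<subseteq> H" "length hs = p" for hs u p
    unfolding V_def using that by (intro span_base) blast
  have hV: "h *v v \<in> V (Suc p)" if "h \<in> H" "v \<in> V p" for h v p
  proof (rule V_map[OF that(2) subsp])
    fix hs u assume "set hs \<subseteq> H" "length hs = p"
    thus "h *v (mprod hs *v u) \<in> V (Suc p)"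
      using base[of "h # hs" "Suc p" u] that(1) by (simp add: matrix_vector_mul_assoc)
  qed
  \<comment> \<open>Moving \<open>y\<close> past a factor \<open>h\<close> leaves the commutator,
    which is again in \<open>H\<close>, so the number of factors from \<open>H\<close> is
    preserved.\<close>
  have yV: "y *v v \<in> V p" if "v \<in> V p" for v p
  proof (rule V_map[OF that subsp])
    fix hs u assume "set hs \<subseteq> H" "length hs = p"
    thus "y *v (mprod hs *v u) \<in> V p"
    proof (induction hs arbitrary: p)
      case Nil
      thus ?case using base[of "[]" 0 "y *v u"] by simp
    next
      case (Cons h hs)
      then obtain q where q: "p = Suc q" "length hs = q" by auto
      have "y *v (mprod (h # hs) *v u) = mcomm y h *v (mprod hs *v u) + h *v (y *v (mprod hs *v u))"
        by (simp add: matrix_vector_mul_assoc matrix_mul_assoc mcomm_def matrix_vector_mult_diff_rdistrib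
              matrix_mult_bilinear_simps)
      moreover have "mcomm y h *v (mprod hs *v u) \<in> V p"
        using Cons.prems q comm[of h] by (auto intro!: hV base)
      moreover have "h *v (y *v (mprod hs *v u)) \<in> V p"
        unfolding q(1) using Cons q by (intro hV) auto
      ultimately show ?case by (simp add: subspace_add[OF subsp])
    qed
  qed
  \<comment> \<open>The last factor is absorbed into the vector to which the product is
    applied.\<close>
  have dec: "v \<in> V p" if "v \<in> V (Suc p)" for v p
  proof -
    have "mat 1 *v v \<in> V p"
    proof (rule V_map[OF that subsp])
      fix hs u assume hs: "set hs \<subseteq> H" "length hs = Suc p"
      then obtain hs' h where "hs = hs' @ [h]" by (cases hs rule: rev_cases) auto
      thus "mat 1 *v (mprod hs *v u) \<in> V p"
        using base[of hs' p "h *v u"] hs by (simp add: mprod_append matrix_vector_mul_assoc)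
    qed
    thus ?thesis by simp
  qed
  have ypow: "mprod (replicate k y) *v v \<in> V p" if "v \<in> V p" for k v p
    unfolding iterate_eq_mprod[symmetric] by (induction k) (use that yV in auto)
  have mod: "\<exists>c. mprod xs *v v - c *\<^sub>R (mprod (replicate (length xs) y) *v v) \<in> V (Suc p)"
    if "v \<in> V p" "set xs \<subseteq> H'" for xs v p
    using that(2)
  proof (induction xs)
    case Nil
    show ?case by (rule exI[of _ 1]) (simp add: subspace_0[OF subsp])
  next
    case (Cons x xs)
    define w where "w = mprod xs *v v"
    define z where "z = mprod (replicate (length xs) y) *v v"
    obtain c where c: "w - c *\<^sub>R z \<in> V (Suc p)" using Cons by (auto simp: w_def z_def)
    have z: "z \<in> V p" unfolding z_def by (rule ypow[OF that(1)])
    have "w = (w - c *\<^sub>R z) + c *\<^sub>R z" by simp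
    also have "\<dots> \<in> V p" by (rule subspace_add[OF subsp dec[OF c] subspace_scale[OF subsp z]])
    finally have w: "w \<in> V p" .
    obtain h d where x: "h \<in> H" "x = h + d *\<^sub>R y" using H'[of x] Cons.prems by auto
    have "x *v w - (d * c) *\<^sub>R (y *v z) = h *v w + d *\<^sub>R (y *v (w - c *\<^sub>R z))"
      by (simp add: x(2) matrix_vector_mult_add_rdistrib matrix_vector_mult_diff_distrib
          matrix_vector_mult_scaleR_complex scaleR_diff_right)
    also have "\<dots> \<in> V (Suc p)"
      by (rule subspace_add[OF subsp hV[OF x(1) w] subspace_scale[OF subsp yV[OF c]]])
    finally show ?case
      by (intro exI[of _ "d * c"]) (simp add: w_def z_def matrix_vector_mul_assoc)
  qed
  have main: "mprod xs *v u \<in> V p" if "set xs \<subseteq> H'" "length xs = p * M" for xs u p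
    using that
  proof (induction p arbitrary: xs)
    case 0
    thus ?case using base[of "[]" 0 u] by simp
  next
    case (Suc p)
    define as bs where "as = take M xs" and "bs = drop M xs"
    have xs: "xs = as @ bs" "length as = M" "length bs = p * M"
      using Suc.prems by (simp_all add: as_def bs_def)
    have "mprod bs *v u \<in> V p" using Suc xs by auto
    from mod[OF this, of as] have "mprod as *v (mprod bs *v u) \<in> V (Suc p)"
      using Suc.prems xs M by auto
    thus ?case by (simp add: xs(1) mprod_append matrix_vector_mul_assoc)
  qed
  have "V N = {0}"
  proof -
    have "{mprod hs *v u | hs u. set hs \<subseteq> H \<and> length hs = N} \<subseteq> {0}"
      using N by (auto simp: nil_products_def)
    hence "V N \<subseteq> span {0}" unfolding V_def by (rule span_mono)
    thus ?thesis using subspace_0[OF subsp] by auto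
  qed
  hence "mprod xs *v u = 0" if "set xs \<subseteq> H'" "length xs = N * M" for xs u
    using main[OF that] by auto
  thus ?thesis unfolding nil_products_def by (metis matrix_eq matrix_vector_mult_0)
qed

text \<open>Engel's theorem: a strictly triangular subalgebra of maximal dimension is everything, since
  otherwise its nilpotent adjoint action yields a normalising element outside it.\<close>

theorem engel:
  fixes L :: "(complex ^ 'n ^ 'n) set"
  assumes L: "subspace L" "\<And>x y. x \<in> L \<Longrightarrow> y \<in> L \<Longrightarrow> mcomm x y \<in> L"
    and nil: "\<And>x. x \<in> L \<Longrightarrow> \<exists>M. mprod (replicate M x) = 0"
  shows "\<exists>N. nil_products N L"
proof -
  \<comment> \<open>\<open>subspace\<close> and \<open>dim\<close> refer to real scalars; the matrix
    space has finite real dimension, which is all that the choice of a maximal \<open>H\<close>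
    requires.\<close>
  define Q where "Q H \<longleftrightarrow> subspace H \<and> H \<subseteq> L \<and> (\<forall>x\<in>H. \<forall>y\<in>H. mcomm x y \<in> H) \<and> (\<exists>N. nil_products N H)" for H
  have "Q {0}"
    using subspace_0[OF L(1)]
    by (auto simp: Q_def mcomm_def nil_products_def length_Suc_conv subspace_single_0 intro!: exI[of _ "Suc 0"])
  moreover have "\<forall>H. Q H \<longrightarrow> dim H < Suc (DIM(complex ^ 'n ^ 'n))"
    using dim_subset_UNIV le_imp_less_Suc by blast
  ultimately obtain H where H: "Q H" "\<And>H'. Q H' \<Longrightarrow> dim H' \<le> dim H"
    using ex_has_greatest_nat[of Q "{0}" dim] by blast
  obtain N where N: "nil_products N H" using H(1) by (auto simp: Q_def)
  have subH: "subspace H" "H \<subseteq> L" and commH: "\<And>x y. x \<in> H \<Longrightarrow> y \<in> H \<Longrightarrow> mcomm x y \<in> H"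
    using H(1) by (auto simp: Q_def)
  have "H = L"
  proof (rule ccontr)
    assume "H \<noteq> L"
    then obtain x where x: "x \<in> L" "x \<notin> H" using subH by blast
    \<comment> \<open>Expanding \<open>p\<close> nested commutators with \<open>x\<close> gives
      words with \<open>p\<close> factors from \<open>H\<close> around \<open>x\<close>. With
      \<open>2 * N\<close> factors one side has at least \<open>N\<close> of them and the word
      vanishes.\<close>
    define Z where "Z p = span {mprod as ** x ** mprod bs | as bs.
        set as \<subseteq> H \<and> set bs \<subseteq> H \<and> length as + length bs = p}" for p
    have Z_step: "mcomm h z \<in> Z (Suc p)" if "z \<in> Z p" "h \<in> H" for z h p
      using that(1) unfolding Z_def
    proof (induction rule: span_induct_alt)
      case base
      show ?case by (simp add: mcomm_def span_0)
    next
      case (step c w z)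
      then obtain as bs where w: "w = mprod as ** x ** mprod bs" "set as \<subseteq> H" "set bs \<subseteq> H"
        "length as + length bs = p" by blast
      have "mcomm h w = mprod (h # as) ** x ** mprod bs - mprod as ** x ** mprod (bs @ [h])"
        by (simp add: w(1) mcomm_def mprod_append matrix_mul_assoc)
      also have "\<dots> \<in> Z (Suc p)"
      proof -
        have "mprod (h # as) ** x ** mprod bs \<in> Z (Suc p)"
          unfolding Z_def using w that(2) by (intro span_base CollectI exI[of _ "h # as"] exI[of _ bs]) auto
        moreover have "mprod as ** x ** mprod (bs @ [h]) \<in> Z (Suc p)"
          unfolding Z_def using w that(2) by (intro span_base CollectI exI[of _ as] exI[of _ "bs @ [h]"]) auto
        ultimately show ?thesis unfolding Z_def by (rule span_diff)
      qed
      finally have "mcomm h w \<in> Z (Suc p)" .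
      moreover have "mcomm h (c *\<^sub>R w + z) = c *\<^sub>R mcomm h w + mcomm h z"
        by (simp add: mcomm_def matrix_mult_bilinear_simps algebra_simps)
      ultimately show ?case using step by (simp add: Z_def span_add span_scale)
    qed
    have ad_Z: "foldr mcomm hs x \<in> Z (length hs)" if "set hs \<subseteq> H" for hs
      using that
    proof (induction hs)
      case Nil
      have "mprod [] ** x ** mprod [] \<in> Z 0"
        unfolding Z_def by (intro span_base CollectI exI[of _ "[]"]) auto
      thus ?case by simp
    qed (auto intro: Z_step)
    have Z0: "Z (2 * N) = {0}"
    proof -
      have "{mprod as ** x ** mprod bs | as bs. set as \<subseteq> H \<and> set bs \<subseteq> H \<and> length as + length bs = 2 * N} \<subseteq> {0}"
      proof clarify
        fix as bs assume *: "set as \<subseteq> H" "set bs \<subseteq> H" "length as + length bs = 2 * N"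
        hence "N \<le> length as \<or> N \<le> length bs" by linarith
        thus "mprod as ** x ** mprod bs = 0"
          using nil_products_ge[OF N] * by auto
      qed
      hence "Z (2 * N) \<subseteq> span {0}" unfolding Z_def by (rule span_mono)
      thus ?thesis using span_0 unfolding Z_def by auto
    qed
    \<comment> \<open>Otherwise each element of \<open>L\<close> outside \<open>H\<close> could be
      sent outside \<open>H\<close> again by some commutator, and \<open>2 * N\<close> nested
      commutators would avoid \<open>H\<close> although they give 0.\<close>
    have "\<exists>y\<in>L. y \<notin> H \<and> (\<forall>h\<in>H. mcomm h y \<in> H)"
    proof (rule ccontr)
      assume neg: "\<not> ?thesis"
      have "\<exists>hs. set hs \<subseteq> H \<and> length hs = k \<and> foldr mcomm hs x \<in> L \<and> foldr mcomm hs x \<notin> H" for k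
      proof (induction k)
        case (Suc k)
        then obtain hs where hs: "set hs \<subseteq> H" "length hs = k" "foldr mcomm hs x \<in> L" "foldr mcomm hs x \<notin> H"
          by blast
        then obtain h where h: "h \<in> H" "mcomm h (foldr mcomm hs x) \<notin> H" using neg by blast
        thus ?case using hs L(2) subH(2) by (intro exI[of _ "h # hs"]) auto
      qed (use x in auto)
      then obtain hs where hs: "set hs \<subseteq> H" "length hs = 2 * N" "foldr mcomm hs x \<notin> H" by blast
      hence "foldr mcomm hs x = 0" using ad_Z[OF hs(1)] Z0 by simp
      thus False using hs subspace_0[OF subH(1)] by simp
    qed
    then obtain y where y: "y \<in> L" "y \<notin> H" "\<And>h. h \<in> H \<Longrightarrow> mcomm h y \<in> H" by blast
    have y': "mcomm y h \<in> H" if "h \<in> H" for h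
      using subspace_neg[OF subH(1) y(3)[OF that]] by (simp add: mcomm_def)
    define H' where "H' = span (insert y H)"
    have H'_iff: "z \<in> H' \<longleftrightarrow> (\<exists>c. z - c *\<^sub>R y \<in> H)" for z
      unfolding H'_def span_insert using subH(1) by (simp add: span_eq_iff[THEN iffD2])
    have H'_ex: "\<exists>h\<in>H. \<exists>c. z = h + c *\<^sub>R y" if "z \<in> H'" for z
      using that unfolding H'_iff by (metis diff_add_cancel)
    have "Q H'"
      unfolding Q_def
    proof (intro conjI ballI)
      show "subspace H'" by (simp add: H'_def)
      show "H' \<subseteq> L" unfolding H'_def using y(1) subH(2) L(1) by (intro span_minimal) auto
      obtain M where "mprod (replicate M y) = 0" using nil[OF y(1)] by blast
      thus "\<exists>N. nil_products N H'" using nil_products_extend[OF N y' _ H'_ex] by blast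
      fix a b assume "a \<in> H'" "b \<in> H'"
      then obtain h1 c1 h2 c2 where ab: "a = h1 + c1 *\<^sub>R y" "b = h2 + c2 *\<^sub>R y" and h: "h1 \<in> H" "h2 \<in> H"
        using H'_ex by metis
      have "mcomm a b = mcomm h1 h2 + c2 *\<^sub>R mcomm h1 y - c1 *\<^sub>R mcomm h2 y"
        by (simp add: ab mcomm_def matrix_mult_bilinear_simps algebra_simps)
      also have "\<dots> \<in> H"
        by (intro subspace_add subspace_diff subspace_scale subH(1) commH h y)
      finally show "mcomm a b \<in> H'" unfolding H'_def by (intro span_base) auto
    qed
    hence "dim H' \<le> dim H" by (rule H(2))
    moreover have "dim H' = dim H + 1"
      using y(2) subH(1) by (simp add: H'_def dim_insert span_eq_iff[THEN iffD2])
    ultimately show False by simp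
  qed
  thus ?thesis using N by blast
qed


section \<open>A monomial order on free modules\<close>

lemma nat_seq_incseq_subseq:
  fixes h :: "nat \<Rightarrow> nat"
  shows "\<exists>r. strict_mono r \<and> incseq (\<lambda>k. h (r k))"
proof -
  obtain f where f: "strict_mono f" "monoseq (\<lambda>n. h (f n))" using seq_monosub by blast
  show ?thesis
  proof (cases "incseq (\<lambda>n. h (f n))")
    case False
    hence dec: "decseq (\<lambda>n. h (f n))" using f(2) by (simp add: monoseq_iff)
    obtain k0 where k0: "\<And>k. h (f k0) \<le> h (f k)"
      using ex_has_least_nat[of "\<lambda>_. True" 0 "\<lambda>k. h (f k)"] by blast
    have "h (f (k0 + k)) = h (f k0)" for k
      using k0[of "k0 + k"] decseqD[OF dec, of k0 "k0 + k"] by simp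
    moreover have "strict_mono (\<lambda>k. f (k0 + k))"
      using f(1) by (simp add: strict_mono_def)
    ultimately show ?thesis by (intro exI[of _ "\<lambda>k. f (k0 + k)"]) (simp add: incseq_def)
  qed (use f in blast)
qed

lemma fun_seq_incseq_subseq:
  fixes g :: "nat \<Rightarrow> 'n \<Rightarrow> nat"
  assumes "finite I"
  shows "\<exists>r. strict_mono r \<and> (\<forall>i\<in>I. incseq (\<lambda>k. g (r k) i))"
  using assms
proof (induction I rule: finite_induct)
  case empty
  show ?case using strict_mono_id by blast
next
  case (insert i I)
  then obtain r where r: "strict_mono r" "\<forall>i\<in>I. incseq (\<lambda>k. g (r k) i)" by blast
  obtain r' where r': "strict_mono r'" "incseq (\<lambda>k. g (r (r' k)) i)"
    using nat_seq_incseq_subseq[of "\<lambda>k. g (r k) i"] by blast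
  have "strict_mono (r \<circ> r')" using r(1) r'(1) by (rule strict_mono_o)
  moreover have "incseq (\<lambda>k. g (r (r' k)) j)" if "j \<in> I" for j
    using r(2) that r'(1) by (auto simp: incseq_def strict_mono_less_eq)
  ultimately show ?case using r'(2) by (intro exI[of _ "r \<circ> r'"]) (auto simp: o_def)
qed

text \<open>The minimal elements serve: an element of least degree below \<open>x\<close> is
  minimal, and infinitely many minimal elements would contain a componentwise increasing sequence,
  hence two comparable ones.\<close>

lemma dickson:
  fixes S :: "('n::finite \<Rightarrow> nat) set"
  obtains F where "finite F" "F \<subseteq> S" "\<And>x. x \<in> S \<Longrightarrow> \<exists>b\<in>F. b \<le> x"
proof -
  define F where "F = {x \<in> S. \<forall>y\<in>S. y \<le> x \<longrightarrow> y = x}"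
  have "\<exists>b\<in>F. b \<le> x" if "x \<in> S" for x
  proof -
    note x = that
    obtain b where b: "b \<in> S" "b \<le> x" "\<And>y. y \<in> S \<Longrightarrow> y \<le> x \<Longrightarrow> mdeg b \<le> mdeg y"
      using ex_has_least_nat[of "\<lambda>y. y \<in> S \<and> y \<le> x" x mdeg, OF conjI[OF x order_refl]] by blast
    have "y = b" if "y \<in> S" "y \<le> b" for y
    proof -
      have "mdeg b \<le> mdeg y" using b that by (meson order_trans)
      hence "mdeg (b - y) = 0" using mdeg_diff[OF that(2)] by linarith
      hence "b - y = 0" by simp
      thus ?thesis using that(2) by (metis diff_diff_fun diff_zero fun_diff_def zero_fun_def ext)
    qed
    thus ?thesis using b by (auto simp: F_def)
  qed
  moreover have "finite F"
  proof (rule ccontr)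
    assume "infinite F"
    then obtain g :: "nat \<Rightarrow> 'n \<Rightarrow> nat" where g: "inj g" "range g \<subseteq> F"
      using infinite_countable_subset by blast
    obtain r where r: "strict_mono r" "\<And>i. incseq (\<lambda>k. g (r k) i)"
      using fun_seq_incseq_subseq[of UNIV g] by auto
    have "g (r 0) \<le> g (r 1)" using r(2) by (auto simp: le_fun_def incseq_def)
    moreover have "g (r 0) \<in> F" "g (r 1) \<in> F" using g(2) by auto
    ultimately have "g (r 0) = g (r 1)" by (auto simp: F_def)
    hence "r 0 = r 1" using g(1) by (simp add: inj_eq)
    thus False using r(1) by (metis strict_mono_eq zero_neq_one)
  qed
  ultimately show thesis using that[of F] by (auto simp: F_def)
qed

section \<open>Monomials of the free module and their weights\<close>

type_synonym 'n vexp = "('n \<Rightarrow> nat) \<times> 'n"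

lemma dickson_vexp:
  fixes E :: "'n::finite vexp set"
  obtains F where "finite F" "F \<subseteq> E" "\<And>e. e \<in> E \<Longrightarrow> \<exists>b\<in>F. fst b \<le> fst e \<and> snd b = snd e"
proof -
  have "\<exists>F. finite F \<and> F \<subseteq> {m. (m, j) \<in> E} \<and> (\<forall>m. (m, j) \<in> E \<longrightarrow> (\<exists>b\<in>F. b \<le> m))" for j
    by (rule dickson[of "{m. (m, j) \<in> E}"]) blast
  then obtain F where F: "\<And>j. finite (F j)" "\<And>j. F j \<subseteq> {m. (m, j) \<in> E}"
    "\<And>j m. (m, j) \<in> E \<Longrightarrow> \<exists>b\<in>F j. b \<le> m" by metis
  have *: "\<exists>b\<in>(\<Union>j. (\<lambda>m. (m, j)) ` F j). fst b \<le> fst e \<and> snd b = snd e" if "e \<in> E" for e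
    using F(3)[of "fst e" "snd e"] that by force
  show thesis
    by (rule that[of "\<Union>j. (\<lambda>m. (m, j)) ` F j"]) (use F(1,2) * in auto)
qed

text \<open>One prime for each variable (\<open>Inl\<close>) and one for each basis vector
  (\<open>Inr\<close>), all distinct; which primes are chosen is immaterial.\<close>

definition wprime :: "'n::finite + 'n \<Rightarrow> nat" where
  "wprime = (SOME p. inj p \<and> (\<forall>x. Factorial_Ring.prime (p x)))"

lemma wprime: "inj (wprime :: 'n::finite + 'n \<Rightarrow> nat)" "Factorial_Ring.prime (wprime (x :: 'n + 'n))"
proof -
  obtain B :: "nat set" where B: "finite B" "card B = CARD('n + 'n)" "B \<subseteq> {p. Factorial_Ring.prime p}"
    using infinite_arbitrarily_large[OF primes_infinite] by metis
  obtain p where "bij_betw p (UNIV :: ('n + 'n) set) B"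
    using finite_same_card_bij[of "UNIV :: ('n + 'n) set" B] B by auto
  hence "inj p \<and> (\<forall>x. Factorial_Ring.prime (p x))" using B(3) by (auto simp: bij_betw_def)
  hence "inj (wprime :: 'n + 'n \<Rightarrow> nat) \<and> (\<forall>x :: 'n + 'n. Factorial_Ring.prime (wprime x))"
    unfolding wprime_def using someI[where P = "\<lambda>p :: 'n + 'n \<Rightarrow> nat. inj p \<and> (\<forall>x. Factorial_Ring.prime (p x))"] by blast
  thus "inj (wprime :: 'n + 'n \<Rightarrow> nat)" "Factorial_Ring.prime (wprime x)" by auto
qed

lemma prime_powers_eq_imp_eq:
  fixes p :: "'a::finite \<Rightarrow> nat"
  assumes "inj p" "\<And>x. Factorial_Ring.prime (p x)" "(\<Prod>x\<in>UNIV. p x ^ c x) = (\<Prod>x\<in>UNIV. p x ^ d x)"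
  shows "c = d"
proof
  fix x
  have *: "multiplicity (p x) (\<Prod>y\<in>UNIV. p y ^ c y) = c x" for c
  proof -
    have "(\<Prod>y\<in>UNIV. p y ^ c y) = (\<Prod>q\<in>range p. q ^ c (the_inv p q))"
      using assms(1) by (simp add: prod.reindex the_inv_f_f)
    also have "multiplicity (p x) \<dots> = c x"
      using assms(1,2) by (subst multiplicity_prod_prime_powers) (auto simp: the_inv_f_f)
    finally show ?thesis .
  qed
  show "c x = d x" using *[of c] *[of d] assms(3) by simp
qed

definition mwt :: "('n::finite \<Rightarrow> nat) \<Rightarrow> nat" where
  "mwt m = (\<Prod>i\<in>UNIV. wprime (Inl i :: 'n + 'n) ^ m i)"

text \<open>By unique factorisation, this weight is a total order on the monomials of a free module
  that is compatible with multiplication.\<close>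

definition wt :: "'n::finite vexp \<Rightarrow> nat" where
  "wt e = mwt (fst e) * wprime (Inr (snd e) :: 'n + 'n)"

lemma mwt_add: "mwt (k + m) = mwt k * mwt m"
  by (simp add: mwt_def power_add prod.distrib)

lemma wt_add: "wt (k + m, j) = mwt k * wt (m, j)"
  by (simp add: wt_def mwt_add mult.assoc)

lemma wt_diff:
  assumes "k \<le> m" shows "wt (m, j) = mwt k * wt (m - k, j)"
proof -
  have "k + (m - k) = m" using assms by (auto simp: le_fun_def fun_eq_iff)
  thus ?thesis using wt_add[of k "m - k" j] by simp
qed

lemma wprime_ge_2: "2 \<le> wprime x"
  by (rule prime_ge_2_nat[OF wprime(2)])

text \<open>With \<open>mwt_le\<close> this compares negative powers of the weights with powers of a
  radius: a large exponent \<open>s\<close> corresponds to a small radius.\<close>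

lemma mwt_ge: "2 ^ mdeg m \<le> mwt m"
  unfolding mwt_def mdeg_def power_sum by (intro prod_mono) (auto intro: power_mono wprime_ge_2)

lemma mwt_le:
  obtains P :: nat where "1 \<le> P" "\<And>m :: 'n::finite \<Rightarrow> nat. mwt m \<le> P ^ mdeg m"
proof -
  define P where "P = Max (range (wprime :: 'n + 'n \<Rightarrow> nat))"
  have P: "wprime x \<le> P" for x :: "'n + 'n" by (simp add: P_def)
  have "mwt m \<le> P ^ mdeg m" for m :: "'n \<Rightarrow> nat"
    unfolding mwt_def mdeg_def power_sum by (intro prod_mono) (auto intro: power_mono P)
  moreover have "1 \<le> P" using P wprime_ge_2 by (meson one_le_numeral order_trans)
  ultimately show thesis using that by blast
qed

lemma mwt_pos [simp]: "0 < mwt m"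
  by (rule less_le_trans[OF _ mwt_ge]) simp

lemma mwt_le_wt: "mwt (fst e) \<le> wt e"
proof -
  have "1 \<le> wprime (Inr (snd e) :: 'a + 'a)" using wprime_ge_2 by (rule order_trans[rotated]) simp
  thus ?thesis by (simp add: wt_def)
qed

lemma wt_pos [simp]: "0 < wt e"
  by (rule less_le_trans[OF mwt_pos mwt_le_wt])

lemma mdeg_less_wt: "mdeg (fst e) < wt e"
  using less_exp[of "mdeg (fst e)"] mwt_ge[of "fst e"] mwt_le_wt[of e] by linarith

lemma wt_inj: "wt e = wt e' \<longleftrightarrow> e = e'"
proof
  assume *: "wt e = wt e'"
  define c where "c e = case_sum (fst e) (\<lambda>j. if j = snd e then 1 else 0 :: nat)" for e :: "'a vexp"
  have wt: "wt e = (\<Prod>x\<in>UNIV. wprime x ^ c e x)" for e :: "'a vexp"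
  proof -
    have "(\<Prod>x\<in>UNIV <+> UNIV. wprime x ^ c e x) =
        (\<Prod>i\<in>UNIV. wprime (Inl i) ^ fst e i) * (\<Prod>j\<in>UNIV. wprime (Inr j) ^ (if j = snd e then 1 else 0))"
      by (subst prod.Plus) (simp_all add: c_def)
    also have "(\<Prod>j\<in>UNIV. wprime (Inr j) ^ (if j = snd e then 1 else 0)) =
        (\<Prod>j\<in>UNIV. if j = snd e then wprime (Inr j) else 1)"
      by (intro prod.cong) auto
    finally have "(\<Prod>x\<in>UNIV <+> UNIV. wprime x ^ c e x) = wt e"
      by (simp add: wt_def mwt_def)
    thus ?thesis by simp
  qed
  have "c e = c e'"
    by (rule prime_powers_eq_imp_eq[OF wprime]) (use * in \<open>simp add: wt\<close>)
  hence "c e (Inl i) = c e' (Inl i)" "c e (Inr j) = c e' (Inr j)" for i j by simp_all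
  thus "e = e'" by (cases e; cases e') (auto simp: c_def fun_eq_iff split: if_splits; metis zero_neq_one)
qed simp

text \<open>Being injective into the naturals, the weight leaves finitely many monomials below each
  one, so division is a recursion over finite sums.\<close>

lemma finite_wt_le: "finite {e. wt e \<le> K}" "finite {e. wt e < K}"
  by (rule finite_imageD[of wt], rule finite_subset[of _ "{..K}"], auto intro!: inj_onI simp: wt_inj)+

section \<open>Coefficient vectors and weighted norms\<close>

definition vcoeff :: "('n \<Rightarrow> 'n::finite cps) \<Rightarrow> 'n vexp \<Rightarrow> complex" where
  "vcoeff u e = cps_coeff (u (snd e)) (fst e)"

lemma vcoeff_eqI: "(\<And>e. vcoeff u e = vcoeff v e) \<Longrightarrow> u = v"
  by (intro ext cps_eqI) (auto simp: vcoeff_def)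

text \<open>The weight is at least 2 to the degree, so for large \<open>s\<close> the factor
  \<open>(1 / wt) ^ s\<close> falls below the radius power at which all components converge. One
  constant serves all such \<open>s\<close>, which may thus be enlarged later.\<close>

lemma vcoeff_bound:
  fixes u :: "'n \<Rightarrow> 'n::finite cps"
  obtains C s1 where "\<And>s A. s1 \<le> s \<Longrightarrow> finite A \<Longrightarrow> (\<Sum>e\<in>A. norm (vcoeff u e) * (1 / real (wt e)) ^ s) \<le> C"
proof -
  obtain r0 where r0: "r0 > 0" "\<And>j. (\<lambda>m. norm (cps_coeff (u j) m) * r0 ^ mdeg m) summable_on UNIV"
    using cps_common_radius[of "range u"] by (auto simp: less_imp_le)
  obtain s1 where s1: "(1 / 2) ^ s1 < r0" using real_arch_pow_inv[OF r0(1), of "1 / 2"] by auto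
  define C where "C = (\<Sum>j\<in>UNIV. infsum (\<lambda>m. norm (cps_coeff (u j) m) * r0 ^ mdeg m) UNIV)"
  have "(\<Sum>e\<in>A. norm (vcoeff u e) * (1 / real (wt e)) ^ s) \<le> C" if "s1 \<le> s" "finite A" for s A
  proof -
    have wt: "(1 / real (wt e)) ^ s \<le> r0 ^ mdeg (fst e)" for e :: "'n vexp"
    proof -
      have "2 ^ mdeg (fst e) \<le> wt e" using mwt_ge mwt_le_wt order_trans by blast
      hence "2 ^ mdeg (fst e) \<le> real (wt e)" by (metis of_nat_le_iff of_nat_numeral of_nat_power)
      hence "(1 / real (wt e)) ^ s \<le> (1 / 2 ^ mdeg (fst e)) ^ s"
        by (intro power_mono divide_left_mono) auto
      also have "\<dots> = ((1 / 2) ^ s) ^ mdeg (fst e)"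
        by (simp add: power_divide mult.commute flip: power_mult)
      also have "\<dots> \<le> r0 ^ mdeg (fst e)"
      proof (rule power_mono)
        have "(1 / 2 :: real) ^ s \<le> (1 / 2) ^ s1" using that(1) by (intro power_decreasing) auto
        thus "(1 / 2) ^ s \<le> r0" using s1 by linarith
      qed simp
      finally show ?thesis .
    qed
    have "(\<Sum>e\<in>A. norm (vcoeff u e) * (1 / real (wt e)) ^ s) \<le>
        (\<Sum>e\<in>A. norm (cps_coeff (u (snd e)) (fst e)) * r0 ^ mdeg (fst e))"
      unfolding vcoeff_def by (intro sum_mono mult_left_mono wt) auto
    also have "\<dots> \<le> (\<Sum>e\<in>fst ` A \<times> UNIV. norm (cps_coeff (u (snd e)) (fst e)) * r0 ^ mdeg (fst e))"
      using that(2) r0(1) by (intro sum_mono2) force+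
    also have "\<dots> = (\<Sum>m\<in>fst ` A. \<Sum>j\<in>UNIV. norm (cps_coeff (u j) m) * r0 ^ mdeg m)"
      by (simp add: sum.cartesian_product case_prod_unfold)
    also have "\<dots> = (\<Sum>j\<in>UNIV. \<Sum>m\<in>fst ` A. norm (cps_coeff (u j) m) * r0 ^ mdeg m)"
      by (rule sum.swap)
    also have "\<dots> \<le> C"
      unfolding C_def using that(2) r0 by (intro sum_mono finite_sum_le_infsum) auto
    finally show ?thesis .
  qed
  thus thesis by (rule that)
qed

lemma cps_convergent_wtI:
  assumes "\<And>m. norm (a m) * (1 / real (mwt m)) ^ s \<le> C"
  shows "cps_convergent a"
proof -
  obtain P where P: "1 \<le> P" "\<And>m :: 'a \<Rightarrow> nat. mwt m \<le> P ^ mdeg m" by (rule mwt_le) blast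
  have C: "0 \<le> C" using assms[of 0] by (rule order_trans[rotated]) simp
  show ?thesis
  proof (rule cps_convergentI)
    show "1 \<le> real P ^ s" using P(1) by simp
    fix m
    have "norm (a m) = norm (a m) * (1 / real (mwt m)) ^ s * real (mwt m) ^ s"
      by (simp add: power_divide)
    also have "\<dots> \<le> C * real (mwt m) ^ s" by (intro mult_right_mono assms) auto
    also have "real (mwt m) \<le> real P ^ mdeg m" using P(2)[of m] by (metis of_nat_le_iff of_nat_power)
    hence "C * real (mwt m) ^ s \<le> C * (real P ^ mdeg m) ^ s"
      using C by (intro mult_left_mono power_mono) auto
    also have "(real P ^ mdeg m) ^ s = (real P ^ s) ^ mdeg m"
      by (simp add: mult.commute flip: power_mult)
    finally show "norm (a m) \<le> C * (real P ^ s) ^ mdeg m" .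
  qed
qed

text \<open>Every later monomial has weight at least \<open>wt e + 1\<close>, so relative to
  \<open>e\<close> its factor shrinks by at least \<open>q = wt e / (wt e + 1)\<close> for each unit
  of \<open>s\<close>. Beyond \<open>s1\<close>, where the sum is bounded, \<open>n\<close> more
  units press the tail below one half.\<close>

lemma tail_small:
  fixes u :: "'n \<Rightarrow> 'n::finite cps"
  assumes init: "\<And>e'. wt e' < wt e \<Longrightarrow> vcoeff u e' = 0"
  obtains s0 where "\<And>s A. s0 \<le> s \<Longrightarrow> finite A \<Longrightarrow> e \<notin> A \<Longrightarrow>
    (\<Sum>d\<in>A. norm (vcoeff u d) * (1 / real (wt d)) ^ s) \<le> (1 / 2) * (1 / real (wt e)) ^ s"
proof -
  obtain C s1 where C: "\<And>s A. s1 \<le> s \<Longrightarrow> finite A \<Longrightarrow> (\<Sum>d\<in>A. norm (vcoeff u d) * (1 / real (wt d)) ^ s) \<le> C"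
    by (rule vcoeff_bound[of u]) blast
  define q where "q = real (wt e) / (real (wt e) + 1)"
  have q: "0 < q" "q < 1" by (auto simp: q_def add_pos_pos)
  have C0: "0 \<le> C" using C[of s1 "{}"] by simp
  define D where "D = C * real (wt e) ^ s1"
  have D0: "0 \<le> D" using C0 by (simp add: D_def)
  obtain n where n: "q ^ n < 1 / (2 * (D + 1))"
    using real_arch_pow_inv[of "1 / (2 * (D + 1))" q] q D0 by auto
  have "D * q ^ n \<le> (D + 1) * (1 / (2 * (D + 1)))"
    using n D0 q by (intro mult_mono) auto
  also have "\<dots> = 1 / 2" using D0 by (simp add: field_simps)
  finally have Dq: "D * q ^ n \<le> 1 / 2" .
  have "(\<Sum>d\<in>A. norm (vcoeff u d) * (1 / real (wt d)) ^ s) \<le> (1 / 2) * (1 / real (wt e)) ^ s"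
    if s: "s1 + n \<le> s" and A: "finite A" "e \<notin> A" for s A
  proof -
    have "norm (vcoeff u d) * (1 / real (wt d)) ^ s \<le>
        (1 / real (wt e)) ^ s * (real (wt e) ^ s1 * q ^ n * (norm (vcoeff u d) * (1 / real (wt d)) ^ s1))"
      if "d \<in> A" for d
    proof (cases "wt d < wt e")
      case True
      thus ?thesis by (simp add: init)
    next
      case False
      hence gt: "real (wt e) + 1 \<le> real (wt d)" using that A(2) wt_inj[of d e]
        by (metis Suc_leI linorder_neqE_nat of_nat_Suc of_nat_le_iff add.commute)
      define x where "x = real (wt e) / real (wt d)"
      have "x \<le> q" unfolding x_def q_def using gt by (intro divide_left_mono) auto
      have x: "0 \<le> x" by (simp add: x_def)
      have x1: "x \<le> 1" using \<open>x \<le> q\<close> q by linarith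
      have "x ^ s \<le> x ^ (s1 + n)" using s x x1 by (intro power_decreasing) auto
      also have "\<dots> = x ^ s1 * x ^ n" by (rule power_add)
      also have "\<dots> \<le> x ^ s1 * q ^ n" using x \<open>x \<le> q\<close> by (intro mult_left_mono power_mono) auto
      finally have "(1 / real (wt e)) ^ s * x ^ s \<le> (1 / real (wt e)) ^ s * (x ^ s1 * q ^ n)"
        by (intro mult_left_mono) auto
      moreover have "(1 / real (wt e)) ^ s * x ^ s = (1 / real (wt d)) ^ s"
        using wt_pos[of e] by (simp add: x_def del: wt_pos flip: power_mult_distrib)
      moreover have "x ^ s1 = real (wt e) ^ s1 * (1 / real (wt d)) ^ s1"
        by (simp add: x_def power_divide)
      ultimately have "norm (vcoeff u d) * (1 / real (wt d)) ^ s \<le>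
          norm (vcoeff u d) * ((1 / real (wt e)) ^ s * (real (wt e) ^ s1 * (1 / real (wt d)) ^ s1 * q ^ n))"
        by (intro mult_left_mono) auto
      thus ?thesis by (simp only: mult_ac)
    qed
    hence "(\<Sum>d\<in>A. norm (vcoeff u d) * (1 / real (wt d)) ^ s) \<le>
        (\<Sum>d\<in>A. (1 / real (wt e)) ^ s * (real (wt e) ^ s1 * q ^ n * (norm (vcoeff u d) * (1 / real (wt d)) ^ s1)))"
      by (rule sum_mono)
    also have "\<dots> = (1 / real (wt e)) ^ s * (real (wt e) ^ s1 * q ^ n * (\<Sum>d\<in>A. norm (vcoeff u d) * (1 / real (wt d)) ^ s1))"
      by (simp only: sum_distrib_left)
    also have "\<dots> \<le> (1 / real (wt e)) ^ s * (real (wt e) ^ s1 * q ^ n * C)"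
      using q C[of s1 A] A by (intro mult_left_mono) auto
    also have "\<dots> = (1 / real (wt e)) ^ s * (D * q ^ n)" by (simp add: D_def mult_ac)
    also have "\<dots> \<le> (1 / real (wt e)) ^ s * (1 / 2)" by (intro mult_left_mono Dq) simp
    finally show ?thesis by (simp add: mult.commute)
  qed
  thus thesis by (rule that)
qed

text \<open>Forward substitution for a system that is lower triangular with respect to
  \<open>w\<close> and is taken to have unit diagonal; only entries of \<open>c\<close> strictly
  below the diagonal enter. Termination rests on \<open>w\<close> alone, since a sum over an
  infinite set defaults to 0.\<close>

function triangular_solution ::
  "('e \<Rightarrow> nat) \<Rightarrow> ('e \<Rightarrow> complex) \<Rightarrow> ('e \<Rightarrow> 'e \<Rightarrow> complex) \<Rightarrow> 'e \<Rightarrow> complex" where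
  "triangular_solution w \<theta> c e =
     \<theta> e - (\<Sum>e'\<in>{e'. w e' < w e}. c e e' * triangular_solution w \<theta> c e')"
  by auto
termination by (relation "Wellfounded.measure (\<lambda>(w, \<theta>, c, e). w e)") auto

declare triangular_solution.simps [simp del]

text \<open>On a finite initial segment the weighted sum \<open>S\<close> of the solution satisfies
  \<open>S \<le> B + S / 2\<close>, because each column below the diagonal has at most half the
  weight of its index.\<close>

lemma triangular_solution_bound:
  fixes w :: "'e \<Rightarrow> nat" and v :: "'e \<Rightarrow> real"
  assumes fin: "\<And>K. finite {e. w e \<le> K}" and v: "\<And>e. 0 \<le> v e"
    and c: "\<And>e' A. finite A \<Longrightarrow> (\<And>e. e \<in> A \<Longrightarrow> w e' < w e) \<Longrightarrow> (\<Sum>e\<in>A. norm (c e e') * v e) \<le> (1 / 2) * v e'"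
    and \<theta>: "\<And>A. finite A \<Longrightarrow> (\<Sum>e\<in>A. norm (\<theta> e) * v e) \<le> B"
  shows "norm (triangular_solution w \<theta> c e) * v e \<le> 2 * B"
proof -
  define a where "a = triangular_solution w \<theta> c"
  define W where "W = {e'. w e' \<le> w e}"
  have finW: "finite W" by (simp add: W_def fin)
  define S where "S = (\<Sum>e\<in>W. norm (a e) * v e)"
  have "S \<le> (\<Sum>e\<in>W. norm (\<theta> e) * v e + (\<Sum>e'\<in>{e'. w e' < w e}. norm (a e') * (norm (c e e') * v e)))"
    unfolding S_def
  proof (rule sum_mono)
    fix e
    have "norm (a e) \<le> norm (\<theta> e) + norm (\<Sum>e'\<in>{e'. w e' < w e}. c e e' * a e')"
      unfolding a_def by (subst triangular_solution.simps) (rule norm_triangle_ineq4)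
    also have "\<dots> \<le> norm (\<theta> e) + (\<Sum>e'\<in>{e'. w e' < w e}. norm (c e e') * norm (a e'))"
      by (intro add_left_mono order_trans[OF norm_sum]) (simp add: norm_mult)
    finally have "norm (a e) * v e \<le> (norm (\<theta> e) + (\<Sum>e'\<in>{e'. w e' < w e}. norm (c e e') * norm (a e'))) * v e"
      using v by (intro mult_right_mono) auto
    thus "norm (a e) * v e \<le> norm (\<theta> e) * v e + (\<Sum>e'\<in>{e'. w e' < w e}. norm (a e') * (norm (c e e') * v e))"
      by (simp only: distrib_right sum_distrib_right mult.assoc mult.left_commute)
  qed
  also have "\<dots> = (\<Sum>e\<in>W. norm (\<theta> e) * v e) + (\<Sum>e\<in>W. \<Sum>e'\<in>{e'. w e' < w e}. norm (a e') * (norm (c e e') * v e))"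
    by (rule sum.distrib)
  also have "(\<Sum>e\<in>W. \<Sum>e'\<in>{e'. w e' < w e}. norm (a e') * (norm (c e e') * v e)) =
      (\<Sum>e\<in>W. \<Sum>e'\<in>{e' \<in> W. w e' < w e}. norm (a e') * (norm (c e e') * v e))"
    by (intro sum.cong) (auto simp: W_def)
  also have "\<dots> = (\<Sum>e'\<in>W. \<Sum>e\<in>{e \<in> W. w e' < w e}. norm (a e') * (norm (c e e') * v e))"
    by (rule sum.swap_restrict[OF finW finW])
  also have "\<dots> = (\<Sum>e'\<in>W. norm (a e') * (\<Sum>e\<in>{e \<in> W. w e' < w e}. norm (c e e') * v e))"
    by (simp only: sum_distrib_left)
  also have "(\<Sum>e\<in>W. norm (\<theta> e) * v e) + \<dots> \<le> B + (\<Sum>e'\<in>W. norm (a e') * ((1 / 2) * v e'))"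
    using finW by (intro add_mono \<theta> sum_mono mult_left_mono c) auto
  also have "(\<Sum>e'\<in>W. norm (a e') * ((1 / 2) * v e')) = S / 2"
    by (simp add: S_def sum_divide_distrib)
  finally have "S \<le> 2 * B" by simp
  moreover have "norm (a e) * v e \<le> S"
    unfolding S_def using finW v by (intro member_le_sum) (auto simp: W_def)
  ultimately show ?thesis by (simp add: a_def)
qed


section \<open>The division theorem\<close>

text \<open>Division with remainder by elements whose initial monomials generate all initial monomials
  of \<open>M\<close>.  The unknown quotients solve a triangular system, and for large \<open>s\<close> the off-diagonal part
  has norm at most 1/2 for the weighted \<open>\<ell>\<^sup>1\<close>-norm with weights \<open>wt\<^sup>-\<^sup>s\<close>, so they converge.\<close>

theorem high_order_in_max_ideal_multiple:
  fixes M :: "('n::finite \<Rightarrow> 'n cps) set"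
  assumes add: "\<And>u v. u \<in> M \<Longrightarrow> v \<in> M \<Longrightarrow> (\<lambda>j. u j + v j) \<in> M"
    and scale: "\<And>g u. u \<in> M \<Longrightarrow> (\<lambda>j. g * u j) \<in> M"
  obtains K where "\<And>u. u \<in> M \<Longrightarrow> (\<And>j. cps_ord_ge K (u j)) \<Longrightarrow>
    \<exists>F q ub. finite F \<and> (\<forall>b\<in>F. q b \<in> cps_max_ideal \<and> ub b \<in> M) \<and> u = (\<lambda>j. \<Sum>b\<in>(F :: 'n vexp set). q b * ub b j)"
proof -
  define init where "init u e \<longleftrightarrow> vcoeff u e \<noteq> 0 \<and> (\<forall>e'. wt e' < wt e \<longrightarrow> vcoeff u e' = 0)"
    for u :: "'n \<Rightarrow> 'n cps" and e
  define E where "E = {e. \<exists>u\<in>M. init u e}"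
  have ex_init: "\<exists>e. init u e" if "vcoeff u e0 \<noteq> 0" for u e0
  proof -
    obtain e where "vcoeff u e \<noteq> 0" "\<And>e'. vcoeff u e' \<noteq> 0 \<Longrightarrow> wt e \<le> wt e'"
      using ex_has_least_nat[of "\<lambda>e. vcoeff u e \<noteq> 0" e0 wt] \<open>vcoeff u e0 \<noteq> 0\<close> by blast
    thus ?thesis unfolding init_def by (meson not_le)
  qed
  obtain F where F: "finite F" "F \<subseteq> E" "\<And>e. e \<in> E \<Longrightarrow> \<exists>b\<in>F. fst b \<le> fst e \<and> snd b = snd e"
    using dickson_vexp by blast
  have "\<exists>v\<in>M. vcoeff v b = 1 \<and> (\<forall>e'. wt e' < wt b \<longrightarrow> vcoeff v e' = 0)" if b: "b \<in> E" for b
  proof -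
    obtain u where u: "u \<in> M" "init u b" using b by (auto simp: E_def)
    show ?thesis
      by (rule bexI[OF _ scale[OF u(1), of "cps_const (1 / vcoeff u b)"]])
         (use u(2) in \<open>auto simp: init_def vcoeff_def\<close>)
  qed
  then obtain ub where ub: "\<And>b. b \<in> E \<Longrightarrow> ub b \<in> M" "\<And>b. b \<in> E \<Longrightarrow> vcoeff (ub b) b = 1"
    "\<And>b e. b \<in> E \<Longrightarrow> wt e < wt b \<Longrightarrow> vcoeff (ub b) e = 0"
    by metis
  obtain bs where bs: "\<And>e. e \<in> E \<Longrightarrow> bs e \<in> F" "\<And>e. e \<in> E \<Longrightarrow> fst (bs e) \<le> fst e"
    "\<And>e. e \<in> E \<Longrightarrow> snd (bs e) = snd e"
    using F(3) by metis
  define k where "k e = fst e - fst (bs e)" for e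
  have k_le: "k e \<le> fst e" for e by (simp add: k_def le_fun_def)
  have k_bs: "fst e - k e = fst (bs e)" if "e \<in> E" for e
    using bs(2)[OF that] by (simp add: k_def diff_diff_fun)
  have wt_bs: "wt e = mwt (k e) * wt (bs e)" if "e \<in> E" for e
    using wt_diff[OF k_le[of e], of "snd e"] k_bs[OF that] bs(3)[OF that] by (metis prod.collapse)
  \<comment> \<open>Column \<open>e'\<close> lists the coefficients of \<open>ub (bs e')\<close>
    multiplied by the monomial \<open>k e'\<close>. For \<open>e'\<close> outside \<open>E\<close>
    the column is zero, and the unknown at \<open>e'\<close> becomes a coefficient of the
    remainder.\<close>
  define c where "c e e' = (if e' \<in> E \<and> k e' \<le> fst e then vcoeff (ub (bs e')) (fst e - k e', snd e) else 0)"
    for e e'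
  have c_diag: "c e e = (if e \<in> E then 1 else 0)" for e
    using ub(2)[of "bs e"] bs F(2) k_bs[of e] k_le[of e] by (auto simp: c_def) (metis prod.collapse subsetD)
  have c_upper: "c e e' = 0" if lt: "wt e < wt e'" for e e'
  proof (cases "e' \<in> E \<and> k e' \<le> fst e")
    case True
    have "wt e = mwt (k e') * wt (fst e - k e', snd e)"
      using wt_diff[of "k e'" "fst e" "snd e"] True by simp
    hence "wt (fst e - k e', snd e) < wt (bs e')"
      using lt wt_bs[of e'] True by simp
    thus ?thesis using ub(3)[of "bs e'"] bs(1)[of e'] F(2) True by (auto simp: c_def)
  qed (auto simp: c_def)
  \<comment> \<open>Above the weights of all divisors \<open>b\<close>. As degrees are smaller than
    weights, order \<open>K\<close> forces the unknowns at the \<open>b\<close> themselves to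
    vanish, and these are the constant terms of the quotients.\<close>
  define K where "K = Suc (\<Sum>b\<in>F. wt b)"
  have K: "wt b < K" if "b \<in> F" for b
    using member_le_sum[of b F wt] that F(1) by (simp add: K_def)
  have "\<exists>s0. \<forall>s A. s0 \<le> s \<longrightarrow> finite A \<longrightarrow> b \<notin> A \<longrightarrow>
      (\<Sum>d\<in>A. norm (vcoeff (ub b) d) * (1 / real (wt d)) ^ s) \<le> (1 / 2) * (1 / real (wt b)) ^ s"
    if b: "b \<in> E" for b
  proof (rule tail_small[of b "ub b"])
    show "vcoeff (ub b) e' = 0" if "wt e' < wt b" for e' by (rule ub(3)[OF b that])
  next
    fix s0
    assume "\<And>s A. s0 \<le> s \<Longrightarrow> finite A \<Longrightarrow> b \<notin> A \<Longrightarrow>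
      (\<Sum>d\<in>A. norm (vcoeff (ub b) d) * (1 / real (wt d)) ^ s) \<le> (1 / 2) * (1 / real (wt b)) ^ s"
    thus ?thesis by (intro exI[of _ s0] allI impI)
  qed
  hence "\<forall>b\<in>E. \<exists>s0. \<forall>s A. s0 \<le> s \<longrightarrow> finite A \<longrightarrow> b \<notin> A \<longrightarrow>
      (\<Sum>d\<in>A. norm (vcoeff (ub b) d) * (1 / real (wt d)) ^ s) \<le> (1 / 2) * (1 / real (wt b)) ^ s"
    by (rule ballI)
  from bchoice[OF this] obtain s0 where s0: "\<And>b s A. b \<in> E \<Longrightarrow> s0 b \<le> s \<Longrightarrow> finite A \<Longrightarrow> b \<notin> A \<Longrightarrow>
      (\<Sum>d\<in>A. norm (vcoeff (ub b) d) * (1 / real (wt d)) ^ s) \<le> (1 / 2) * (1 / real (wt b)) ^ s"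
    by blast
  show thesis
  proof (rule that[of K])
    fix \<theta> assume \<theta>: "\<theta> \<in> M" "\<And>j. cps_ord_ge K (\<theta> j)"
    obtain B s1 where B: "\<And>s A. s1 \<le> s \<Longrightarrow> finite A \<Longrightarrow> (\<Sum>e\<in>A. norm (vcoeff \<theta> e) * (1 / real (wt e)) ^ s) \<le> B"
      by (rule vcoeff_bound[of \<theta>]) blast
    define s where "s = s1 + (\<Sum>b\<in>F. s0 b)"
    have s: "s1 \<le> s" "\<And>b. b \<in> F \<Longrightarrow> s0 b \<le> s"
      using member_le_sum[of _ F s0] F(1) by (auto simp: s_def intro: trans_le_add2)
    define v where "v e = (1 / real (wt e)) ^ s" for e :: "'n vexp"
    define a where "a = triangular_solution wt (vcoeff \<theta>) c"
    have a: "a e = vcoeff \<theta> e - (\<Sum>e'\<in>{e'. wt e' < wt e}. c e e' * a e')" for e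
      unfolding a_def by (rule triangular_solution.simps)
    \<comment> \<open>Multiplication by the monomial \<open>k e'\<close> scales all weights by
      \<open>mwt (k e')\<close>, so the tail estimate for the divisor \<open>bs e'\<close> carries
      over to its multiples.\<close>
    have col: "(\<Sum>e\<in>A. norm (c e e') * v e) \<le> (1 / 2) * v e'"
      if A: "finite A" "\<And>e. e \<in> A \<Longrightarrow> wt e' < wt e" for e' A
    proof (cases "e' \<in> E")
      case False
      thus ?thesis by (simp add: c_def v_def)
    next
      case True
      define A' where "A' = {e \<in> A. k e' \<le> fst e}"
      define d where "d e = (fst e - k e', snd e)" for e :: "'n vexp"
      have wt_d: "wt e = mwt (k e') * wt (d e)" if "e \<in> A'" for e
        using wt_diff[of "k e'" "fst e" "snd e"] that by (simp add: A'_def d_def)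
      have inj: "inj_on d A'"
      proof (rule inj_onI)
        fix e1 e2 assume e: "e1 \<in> A'" "e2 \<in> A'" "d e1 = d e2"
        hence "wt e1 = wt e2" using wt_d by metis
        thus "e1 = e2" by (simp add: wt_inj)
      qed
      have "bs e' \<notin> d ` A'"
      proof
        assume "bs e' \<in> d ` A'"
        then obtain e where e: "e \<in> A'" "bs e' = d e" by blast
        hence "wt e = wt e'" using wt_d wt_bs[OF True] by simp
        thus False using A(2)[of e] e(1) by (simp add: A'_def)
      qed
      hence "(\<Sum>x\<in>d ` A'. norm (vcoeff (ub (bs e')) x) * (1 / real (wt x)) ^ s) \<le> (1 / 2) * (1 / real (wt (bs e'))) ^ s"
        using A(1) bs(1)[OF True] F(2) s(2) by (intro s0) (auto simp: A'_def)
      hence *: "(\<Sum>e\<in>A'. norm (vcoeff (ub (bs e')) (d e)) * (1 / real (wt (d e))) ^ s) \<le> (1 / 2) * (1 / real (wt (bs e'))) ^ s"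
        by (simp add: sum.reindex[OF inj])
      have "(\<Sum>e\<in>A. norm (c e e') * v e) = (\<Sum>e\<in>A'. norm (c e e') * v e)"
        using A(1) by (intro sum.mono_neutral_right) (auto simp: A'_def c_def)
      also have "\<dots> = (\<Sum>e\<in>A'. (1 / real (mwt (k e'))) ^ s * (norm (vcoeff (ub (bs e')) (d e)) * (1 / real (wt (d e))) ^ s))"
      proof (rule sum.cong[OF refl])
        fix e assume e: "e \<in> A'"
        have "c e e' = vcoeff (ub (bs e')) (d e)" using e True by (simp add: c_def d_def A'_def)
        moreover have "v e = (1 / real (mwt (k e'))) ^ s * (1 / real (wt (d e))) ^ s"
          by (simp add: v_def wt_d[OF e] power_mult_distrib power_divide)
        ultimately show "norm (c e e') * v e =
            (1 / real (mwt (k e'))) ^ s * (norm (vcoeff (ub (bs e')) (d e)) * (1 / real (wt (d e))) ^ s)"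
          by (simp only: mult.left_commute)
      qed
      also have "\<dots> = (1 / real (mwt (k e'))) ^ s * (\<Sum>e\<in>A'. norm (vcoeff (ub (bs e')) (d e)) * (1 / real (wt (d e))) ^ s)"
        by (simp only: sum_distrib_left)
      also have "\<dots> \<le> (1 / real (mwt (k e'))) ^ s * ((1 / 2) * (1 / real (wt (bs e'))) ^ s)"
        by (intro mult_left_mono *) simp
      also have "\<dots> = (1 / 2) * v e'"
        by (simp add: v_def wt_bs[OF True] power_mult_distrib power_divide)
      finally show ?thesis .
    qed
    have bound: "norm (a e) * v e \<le> 2 * B" for e
      unfolding a_def
      by (rule triangular_solution_bound) (use finite_wt_le col B[OF s(1)] in \<open>auto simp: v_def\<close>)
    have a_low: "a e = 0" if "wt e < K" for e
      using that
    proof (induction "wt e" arbitrary: e rule: less_induct)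
      case less
      have "mdeg (fst e) < K" using mdeg_less_wt less.prems by (rule less_trans)
      hence "vcoeff \<theta> e = 0" using \<theta>(2)[of "snd e"] by (simp add: vcoeff_def cps_ord_ge_def)
      moreover have "(\<Sum>e'\<in>{e'. wt e' < wt e}. c e e' * a e') = 0"
        using less by (intro sum.neutral ballI) simp
      ultimately show ?case by (subst a) simp
    qed
    \<comment> \<open>The unknowns at those \<open>e\<close> for which \<open>bs e = b\<close> are
      collected into one quotient, shifted by the exponent of \<open>b\<close>.\<close>
    define qc where "qc b m = (if (m + fst b, snd b) \<in> E \<and> bs (m + fst b, snd b) = b then a (m + fst b, snd b) else 0)" for b m
    define q where "q b = Abs_cps (qc b)" for b
    have q: "cps_coeff (q b) = qc b" for b
    proof -
      have "norm (qc b m) * (1 / real (mwt m)) ^ s \<le> max 0 (2 * B / v b)" for m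
      proof (cases "qc b m = 0")
        case False
        hence "qc b m = a (m + fst b, snd b)" by (auto simp: qc_def split: if_splits)
        hence "norm (qc b m) * ((1 / real (mwt m)) ^ s * v b) \<le> 2 * B"
          using bound[of "(m + fst b, snd b)"] wt_add[of m "fst b" "snd b"]
          by (simp add: v_def power_mult_distrib power_divide)
        moreover have "v b > 0" by (simp add: v_def)
        ultimately have "norm (qc b m) * (1 / real (mwt m)) ^ s \<le> 2 * B / v b"
          by (simp add: field_simps)
        thus ?thesis by simp
      qed simp
      hence "cps_convergent (qc b)" by (rule cps_convergent_wtI)
      thus ?thesis unfolding q_def by (intro Abs_cps_inverse) simp
    qed
    define r where "r = (\<lambda>j. \<theta> j - (\<Sum>b\<in>F. q b * ub b j))"
    have zeroM: "(\<lambda>j. 0) \<in> M" using scale[OF \<theta>(1), of 0] by simp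
    have "(\<lambda>j. \<Sum>b\<in>G. q b * ub b j) \<in> M" if "G \<subseteq> F" for G
      using finite_subset[OF that F(1)] that
    proof (induction G rule: finite_induct)
      case (insert b G)
      thus ?case using add[OF scale[OF ub(1)[of b], of "q b"], of "\<lambda>j. \<Sum>b\<in>G. q b * ub b j"] F(2) by auto
    qed (simp add: zeroM)
    from scale[OF this[OF order_refl], of "-1"] have "r \<in> M"
      using add[OF \<theta>(1)] by (fastforce simp: r_def)
    have prod: "vcoeff (\<lambda>j. \<Sum>b\<in>F. q b * ub b j) e = (\<Sum>e'\<in>{e'. wt e' \<le> wt e}. c e e' * a e')" for e
    proof -
      define T where "T = {e' \<in> E. k e' \<le> fst e}"
      have T_bij: "T = (\<lambda>(b, m). (m + fst b, snd b)) ` {(b, m). b \<in> F \<and> m \<le> fst e \<and>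
          (m + fst b, snd b) \<in> E \<and> bs (m + fst b, snd b) = b}" (is "_ = _ ` ?P")
      proof (intro equalityI subsetI)
        fix e' assume e': "e' \<in> T"
        hence E': "e' \<in> E" by (simp add: T_def)
        have "(k e' + fst (bs e'), snd (bs e')) = e'"
          using bs(2,3)[OF E'] by (cases e') (auto simp: k_def fun_eq_iff le_fun_def)
        thus "e' \<in> (\<lambda>(b, m). (m + fst b, snd b)) ` ?P"
          using e' bs(1,3)[OF E'] by (intro image_eqI[of _ _ "(bs e', k e')"]) (auto simp: T_def)
      next
        fix e' assume "e' \<in> (\<lambda>(b, m). (m + fst b, snd b)) ` ?P"
        thus "e' \<in> T" by (auto simp: T_def k_def le_fun_def)
      qed
      have fin: "finite ?P"
        by (rule finite_subset[of _ "F \<times> {..fst e}"]) (use F(1) in auto)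
      have inj: "inj_on (\<lambda>(b, m). (m + fst b, snd b)) ?P"
        by (auto simp: inj_on_def)
      have "vcoeff (\<lambda>j. \<Sum>b\<in>F. q b * ub b j) e =
          (\<Sum>(b, m)\<in>F \<times> {..fst e}. qc b m * vcoeff (ub b) (fst e - m, snd e))"
        by (simp add: vcoeff_def times_cps.rep_eq q sum.cartesian_product)
      also have "\<dots> = (\<Sum>(b, m)\<in>?P. qc b m * vcoeff (ub b) (fst e - m, snd e))"
        using F(1) by (intro sum.mono_neutral_right) (auto simp: qc_def split: if_splits)
      also have "\<dots> = (\<Sum>e'\<in>T. c e e' * a e')"
        unfolding T_bij sum.reindex[OF inj]
        by (intro sum.cong refl) (auto simp: qc_def c_def k_def)
      also have "\<dots> = (\<Sum>e'\<in>{e' \<in> T. wt e' \<le> wt e}. c e e' * a e')"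
        using fin c_upper by (intro sum.mono_neutral_right) (auto simp: T_bij not_le)
      also have "\<dots> = (\<Sum>e'\<in>{e'. wt e' \<le> wt e}. c e e' * a e')"
        using finite_wt_le(1) by (intro sum.mono_neutral_left) (auto simp: T_def c_def)
      finally show ?thesis .
    qed
    have r_coeff: "vcoeff r e = (if e \<in> E then 0 else a e)" for e
    proof -
      have "{e'. wt e' \<le> wt e} = insert e {e'. wt e' < wt e}"
        by (auto simp: wt_inj le_less)
      moreover have "z = y - x" if "x = y - z" for x y z :: complex
        using that by simp
      from this[OF a[of e]]
      have "(\<Sum>e'\<in>{e'. wt e' < wt e}. c e e' * a e') = vcoeff \<theta> e - a e" .
      ultimately have "(\<Sum>e'\<in>{e'. wt e' \<le> wt e}. c e e' * a e') = c e e * a e + (vcoeff \<theta> e - a e)"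
        by (simp add: finite_wt_le)
      thus ?thesis
        using prod[of e] by (simp add: r_def vcoeff_def c_diag)
    qed
    \<comment> \<open>A nonzero remainder lies in \<open>M\<close> and has its initial monomial in
      \<open>E\<close>, yet all its coefficients at \<open>E\<close> are zero.\<close>
    have "r = (\<lambda>j. 0)"
    proof (rule ccontr)
      assume "r \<noteq> (\<lambda>j. 0)"
      then obtain e0 where "vcoeff r e0 \<noteq> 0"
        using vcoeff_eqI[of r "\<lambda>j. 0"] by (auto simp: vcoeff_def)
      then obtain e where e: "init r e" using ex_init by blast
      hence "e \<in> E" using \<open>r \<in> M\<close> by (auto simp: E_def)
      thus False using e r_coeff[of e] by (simp add: init_def)
    qed
    hence "\<theta> = (\<lambda>j. \<Sum>b\<in>F. q b * ub b j)" by (auto simp: r_def fun_eq_iff)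
    moreover have "q b \<in> cps_max_ideal" if "b \<in> F" for b
    proof -
      have "a (0 + fst b, snd b) = 0" using a_low[of b] K[OF that] by simp
      thus ?thesis by (simp add: cps_max_ideal_def q qc_def)
    qed
    ultimately show "\<exists>F q ub. finite F \<and> (\<forall>b\<in>F. q b \<in> cps_max_ideal \<and> ub b \<in> M) \<and>
        \<theta> = (\<lambda>j. \<Sum>b\<in>(F :: 'n vexp set). q b * ub b j)"
      using F(1,2) ub(1) by (intro exI[of _ F] exI[of _ q] exI[of _ ub]) auto
  qed
qed


section \<open>Solvability\<close>

context lie_ideal
begin

lemma lie_quotient_submodule:
  assumes "submodule N R L"
  shows "submodule ((\<lambda>x. I +>\<^bsub>L\<^esub> x) ` N) R (lie_quotient L I)"
proof -
  interpret N: submodule N R L by fact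
  interpret Q: lie_algebra R "lie_quotient L I" by (rule lie_algebra_lie_quotient)
  have N: "x \<in> carrier L" if "x \<in> N" for x using that N.subset by auto
  show ?thesis
  proof (rule Q.submoduleI)
    show "(\<lambda>x. I +>\<^bsub>L\<^esub> x) ` N \<subseteq> carrier (lie_quotient L I)"
      using N by (auto simp: lie_quotient_carrier)
    have "\<zero>\<^bsub>L\<^esub> \<in> N" using N.one_closed by simp
    thus "\<zero>\<^bsub>lie_quotient L I\<^esub> \<in> (\<lambda>x. I +>\<^bsub>L\<^esub> x) ` N"
      by (auto simp: lie_quotient_ops)
  next
    fix a A assume "a \<in> carrier R" "A \<in> (\<lambda>x. I +>\<^bsub>L\<^esub> x) ` N"
    thus "a \<odot>\<^bsub>lie_quotient L I\<^esub> A \<in> (\<lambda>x. I +>\<^bsub>L\<^esub> x) ` N"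
      using N N.smult_closed by (auto simp: lie_quotient_ops)
  next
    fix A B assume "A \<in> (\<lambda>x. I +>\<^bsub>L\<^esub> x) ` N" "B \<in> (\<lambda>x. I +>\<^bsub>L\<^esub> x) ` N"
    thus "A \<oplus>\<^bsub>lie_quotient L I\<^esub> B \<in> (\<lambda>x. I +>\<^bsub>L\<^esub> x) ` N"
      using N N.m_closed by (auto simp: lie_quotient_ops)
  next
    fix A assume "A \<in> (\<lambda>x. I +>\<^bsub>L\<^esub> x) ` N"
    then obtain x where x: "x \<in> N" "A = I +>\<^bsub>L\<^esub> x" by blast
    have "\<ominus>\<^bsub>L\<^esub> x \<in> N" using N.m_inv_closed[OF x(1)] by (simp add: a_inv_def)
    moreover have "\<ominus>\<^bsub>lie_quotient L I\<^esub> A = I +>\<^bsub>L\<^esub> (\<ominus>\<^bsub>L\<^esub> x)"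
      unfolding x(2) using N[OF x(1)]
      by (intro Q.M.minus_equality) (auto simp: lie_quotient_ops lie_quotient_carrier M.l_neg)
    ultimately show "\<ominus>\<^bsub>lie_quotient L I\<^esub> A \<in> (\<lambda>x. I +>\<^bsub>L\<^esub> x) ` N" by blast
  qed
qed

text \<open>Lets the argument run on vector fields instead of cosets: orders are not defined on
  cosets, whereas a chain \<open>P\<close> of submodules upstairs can record them.\<close>

lemma lie_quotient_derived_series_subset:
  assumes "P 0 = carrier L" "\<And>k. submodule (P k) R L"
    and "\<And>k x y. x \<in> P k \<Longrightarrow> y \<in> P k \<Longrightarrow> x \<otimes>\<^bsub>L\<^esub> y \<in> P (Suc k)"
  shows "lie_derived_series R (lie_quotient L I) k \<subseteq> (\<lambda>x. I +>\<^bsub>L\<^esub> x) ` P k"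
proof (induction k)
  case 0
  show ?case by (simp add: lie_quotient_carrier assms(1))
next
  case (Suc k)
  have P: "x \<in> carrier L" if "x \<in> P k" for x
    using submoduleE(1)[OF assms(2)[of k]] that by auto
  have "\<forall>A\<in>lie_derived_series R (lie_quotient L I) k. \<forall>B\<in>lie_derived_series R (lie_quotient L I) k.
      A \<otimes>\<^bsub>lie_quotient L I\<^esub> B \<in> (\<lambda>x. I +>\<^bsub>L\<^esub> x) ` P (Suc k)"
  proof (intro ballI)
    fix A B assume "A \<in> lie_derived_series R (lie_quotient L I) k" "B \<in> lie_derived_series R (lie_quotient L I) k"
    then obtain x y where "x \<in> P k" "y \<in> P k" "A = I +>\<^bsub>L\<^esub> x" "B = I +>\<^bsub>L\<^esub> y"
      using Suc by blast
    thus "A \<otimes>\<^bsub>lie_quotient L I\<^esub> B \<in> (\<lambda>x. I +>\<^bsub>L\<^esub> x) ` P (Suc k)"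
      using assms(3) P by (auto simp: lie_quotient_ops)
  qed
  thus ?case
    using lie_quotient_submodule[OF assms(2)] by (auto simp: lie_bracket_span_def)
qed

lemma lie_quotient_derived_series_eq_zero:
  assumes "P 0 = carrier L" "\<And>k. submodule (P k) R L"
    and "\<And>k x y. x \<in> P k \<Longrightarrow> y \<in> P k \<Longrightarrow> x \<otimes>\<^bsub>L\<^esub> y \<in> P (Suc k)" and "P k \<subseteq> I"
  shows "lie_derived_series R (lie_quotient L I) k = {\<zero>\<^bsub>lie_quotient L I\<^esub>}"
proof (rule subset_antisym)
  interpret Q: lie_algebra R "lie_quotient L I" by (rule lie_algebra_lie_quotient)
  have zero: "I +>\<^bsub>L\<^esub> x = \<zero>\<^bsub>lie_quotient L I\<^esub>" if "x \<in> I" for x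
    using coset_absorb[OF that M.zero_closed] that a_subset by (auto simp: lie_quotient_ops)
  show "lie_derived_series R (lie_quotient L I) k \<subseteq> {\<zero>\<^bsub>lie_quotient L I\<^esub>}"
  proof
    fix A assume "A \<in> lie_derived_series R (lie_quotient L I) k"
    then obtain x where "x \<in> P k" "A = I +>\<^bsub>L\<^esub> x"
      using lie_quotient_derived_series_subset[OF assms(1-3), of k] by blast
    thus "A \<in> {\<zero>\<^bsub>lie_quotient L I\<^esub>}" using zero assms(4) by blast
  qed
  have "\<zero>\<^bsub>lie_quotient L I\<^esub> \<in> lie_derived_series R (lie_quotient L I) k"
  proof (cases k)
    case (Suc j)
    have "\<zero>\<^bsub>lie_quotient L I\<^esub> \<in> N" if "submodule N R (lie_quotient L I)" for N
    proof -
      interpret N: submodule N R "lie_quotient L I" by fact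
      show ?thesis using N.one_closed by simp
    qed
    thus ?thesis by (auto simp: Suc lie_bracket_span_def)
  qed simp
  thus "{\<zero>\<^bsub>lie_quotient L I\<^esub>} \<subseteq> lie_derived_series R (lie_quotient L I) k" by simp
qed

end

section \<open>Submodules and the defining ideal of logarithmic fields\<close>

lemma submodule_vf_lieI:
  assumes "N \<subseteq> log_Der f" "0 \<in> N" "\<And>\<theta> \<eta>. \<theta> \<in> N \<Longrightarrow> \<eta> \<in> N \<Longrightarrow> \<theta> + \<eta> \<in> N"
    and "\<And>c \<theta>. \<theta> \<in> N \<Longrightarrow> vf_scale (cps_const c) \<theta> \<in> N"
  shows "submodule N complex_ring (vf_lie (log_Der f))"
proof -
  interpret L: lie_algebra complex_ring "vf_lie (log_Der f)"
    by (rule lie_algebra_log_Der)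
  show ?thesis
  proof (rule L.submoduleI)
    fix \<theta> assume \<theta>: "\<theta> \<in> N"
    have "vf_scale (cps_const (- 1)) \<theta> + \<theta> = 0"
    proof -
      have "cps_const (- 1) * g + g = 0" for g :: "'a cps" by (rule cps_eqI) simp
      thus ?thesis by (simp add: vf_scale_def fun_eq_iff)
    qed
    hence "\<ominus>\<^bsub>vf_lie (log_Der f)\<^esub> \<theta> = vf_scale (cps_const (- 1)) \<theta>"
      using assms(1,4) \<theta> by (intro L.M.minus_equality) (auto simp: vf_lie_def)
    thus "\<ominus>\<^bsub>vf_lie (log_Der f)\<^esub> \<theta> \<in> N" using assms(4)[OF \<theta>] by simp
  qed (use assms in \<open>auto simp: vf_lie_def\<close>)
qed

text \<open>In \<open>[\<eta>, g \<theta>] = g [\<eta>, \<theta>] + \<eta>(g) \<theta>\<close> the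
  factor \<open>\<eta>(g)\<close> lies in the maximal ideal, as logarithmic fields vanish at 0. The
  induction carries \<open>\<theta> \<in> J\<close> along for the second summand of the scaling
  step.\<close>

lemma lie_ideal_max_ideal_log_Der:
  assumes "log_Der f \<subseteq> ideal_smult vf_scale cps_max_ideal cps_Der"
  shows "lie_ideal (ideal_smult vf_scale cps_max_ideal (log_Der f)) complex_ring (vf_lie (log_Der f))"
proof -
  define J where "J = ideal_smult vf_scale cps_max_ideal (log_Der f)"
  note closed = ideal_smult_closed[where I = cps_max_ideal and M = "log_Der f", OF module_vf_scale,
      folded J_def]
  have sub: "J \<subseteq> log_Der f"
  proof
    fix \<theta> assume "\<theta> \<in> J"
    with module_vf_scale show "\<theta> \<in> log_Der f"
      unfolding J_def by (induction rule: ideal_smult_induct) (blast intro: log_Der_closed)+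
  qed
  have br: "vf_bracket \<eta> \<theta> \<in> J" if \<theta>: "\<theta> \<in> J" and \<eta>: "\<eta> \<in> log_Der f" for \<theta> \<eta>
  proof -
    note D = cps_DerD[OF log_DerD(1)[OF \<eta>]]
    have maps: "\<eta> h \<in> cps_max_ideal" for h
      using assms \<eta> max_ideal_Der_maps by blast
    have "\<theta> \<in> J \<and> vf_bracket \<eta> \<theta> \<in> J"
      using module_vf_scale \<theta>[unfolded J_def]
    proof (induction rule: ideal_smult_induct)
      case (gen g \<theta>)
      thus ?case using vf_scale_bracket_mem[of \<theta> f \<eta> g] \<eta> maps closed(1) by (simp add: J_def)
    next
      case zero
      have "vf_bracket \<eta> 0 = 0" by (simp add: vf_bracket_def fun_eq_iff D)
      thus ?case using closed(2) by metis
    next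
      case (add \<theta> \<theta>')
      have "vf_bracket \<eta> (\<theta> + \<theta>') = vf_bracket \<eta> \<theta> + vf_bracket \<eta> \<theta>'"
        by (simp add: vf_bracket_def fun_eq_iff D algebra_simps)
      thus ?case using add closed(3) by metis
    next
      case (scale g \<theta>)
      have "vf_bracket \<eta> (vf_scale g \<theta>) = vf_scale g (vf_bracket \<eta> \<theta>) + vf_scale (\<eta> g) \<theta>"
        by (simp add: vf_scale_def vf_bracket_def fun_eq_iff D algebra_simps)
      thus ?case using scale closed(3,4) by metis
    qed
    thus ?thesis by simp
  qed
  have "submodule J complex_ring (vf_lie (log_Der f))"
    by (rule submodule_vf_lieI[OF sub closed(2,3,4)])
  moreover have "vf_bracket \<theta> \<eta> \<in> J" if "\<theta> \<in> J" "\<eta> \<in> log_Der f" for \<theta> \<eta>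
  proof -
    have "vf_bracket \<theta> \<eta> = vf_scale (- 1) (vf_bracket \<eta> \<theta>)"
      by (simp add: vf_scale_def vf_bracket_def fun_eq_iff)
    thus ?thesis using closed(4)[OF br[OF that], of "- 1"] by simp
  qed
  ultimately have "lie_ideal J complex_ring (vf_lie (log_Der f))"
    by (intro lie_ideal.intro lie_ideal_axioms.intro lie_algebra_log_Der) (auto simp: vf_lie_def br)
  thus ?thesis by (simp add: J_def)
qed

text \<open>Differentiation costs one order, so a field with components of order
  \<open>a + 1\<close> raises orders by \<open>a\<close>. Fields without linear part therefore have
  brackets of larger order.\<close>

lemma cps_Der_ord_ge:
  assumes "\<theta> \<in> cps_Der" "\<And>i. cps_ord_ge (Suc a) (\<theta> (cps_var i))" "cps_ord_ge (Suc b) h"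
  shows "cps_ord_ge (Suc a + b) (\<theta> h)"
  unfolding cps_Der_expand[OF assms(1), of h]
  by (intro cps_ord_ge_sum cps_ord_ge_mult assms(2) cps_ord_ge_pderiv assms(3))

lemma linear_part_add: "linear_part (\<theta> + \<eta>) = linear_part \<theta> + linear_part \<eta>"
  by (simp add: linear_part_def vec_eq_iff)

lemma linear_part_scale: "linear_part (vf_scale (cps_const c) \<theta>) $ i $ j = c * linear_part \<theta> $ i $ j"
  by (simp add: linear_part_def vf_scale_def)

lemma cps_coeff_linear_mult:
  assumes "cps_coeff a 0 = 0"
  shows "cps_coeff (a * b) (mexp j) = cps_coeff a (mexp j) * cps_coeff b 0"
proof -
  have *: "{..mexp j} = {0, mexp j}"
  proof (intro equalityI subsetI)
    fix k assume "k \<in> {..mexp j}"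
    hence k: "k \<le> mexp j" by simp
    hence "mdeg k < 2" using mdeg_mono[OF k] by simp
    thus "k \<in> {0, mexp j}"
    proof (cases rule: mdeg_eq_1_cases)
      case (2 i)
      hence "mexp j i \<noteq> 0" using k by (auto simp: mexp_le_iff)
      thus ?thesis using 2 by (auto simp: mexp_def split: if_splits)
    qed simp
  qed (auto simp: le_fun_def)
  have "mexp j - mexp j = 0" by (simp add: fun_eq_iff)
  thus ?thesis unfolding times_cps.rep_eq * using assms by simp
qed

text \<open>As the fields vanish at 0, composing derivations multiplies their Jacobians at 0, in
  reversed order; hence the exchanged arguments of \<open>mcomm\<close>.\<close>

lemma linear_part_bracket:
  fixes \<theta> \<eta> :: "'n::finite cps \<Rightarrow> 'n cps"
  assumes "\<theta> \<in> cps_Der" "\<eta> \<in> cps_Der"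
    and "\<And>i. cps_coeff (\<theta> (cps_var i)) 0 = 0" "\<And>i. cps_coeff (\<eta> (cps_var i)) 0 = 0"
  shows "linear_part (vf_bracket \<theta> \<eta>) = mcomm (linear_part \<eta>) (linear_part \<theta>)"
proof -
  have *: "cps_coeff (\<theta> (\<eta> (cps_var i))) (mexp j) =
      (\<Sum>k\<in>UNIV. cps_coeff (\<eta> (cps_var i)) (mexp k) * cps_coeff (\<theta> (cps_var k)) (mexp j))"
    if "\<theta> \<in> cps_Der" "\<And>i. cps_coeff (\<theta> (cps_var i)) 0 = 0" for \<theta> \<eta> :: "'n cps \<Rightarrow> 'n cps" and i j
    by (subst cps_Der_expand[OF that(1)])
       (simp add: cps_coeff_linear_mult[OF that(2)] cps_coeff_pderiv mult.commute)
  show ?thesis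
    by (simp add: linear_part_def vf_bracket_def mcomm_def vec_eq_iff matrix_matrix_mult_def * assms)
qed

theorem proposition1p4:
  fixes f :: "'n::finite cps"
  assumes "f \<in> cps_max_ideal"
    and "cps_reduced f"
    and "log_Der f \<subseteq> ideal_smult vf_scale cps_max_ideal cps_Der"
    and "isolated_singularity f"
    and "cps_order f \<ge> 3"
  shows "solvable_lie_algebra complex_ring (initial_log_lie_algebra f)"
proof -
  define J where "J = ideal_smult vf_scale cps_max_ideal (log_Der f)"
  interpret J: lie_ideal J complex_ring "vf_lie (log_Der f)"
    unfolding J_def by (rule lie_ideal_max_ideal_log_Der[OF assms(3)])
  have ord: "cps_ord_ge 3 f"
    using assms(2,5) by (intro cps_order_ord_ge) (auto simp: cps_reduced_def)
  note Der = log_DerD(1)[of _ f]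
  have maps0: "cps_coeff (\<theta> h) 0 = 0" if "\<theta> \<in> log_Der f" for \<theta> h
    using max_ideal_Der_maps[of \<theta> cps_Der h] assms(3) that by (auto simp: cps_max_ideal_def)
  define L0 where "L0 = {\<theta> \<in> log_Der f. \<exists>g. cps_coeff g 0 = 0 \<and> \<theta> f = g * f}"
  have L0_D: "\<theta> \<in> log_Der f" if "\<theta> \<in> L0" for \<theta> using that by (simp add: L0_def)
  have L0_zero: "0 \<in> L0"
    by (auto simp: L0_def log_Der_closed intro!: exI[of _ 0])
  have L0_add: "\<theta> + \<eta> \<in> L0" if \<theta>: "\<theta> \<in> L0" and \<eta>: "\<eta> \<in> L0" for \<theta> \<eta>
  proof -
    obtain g where "cps_coeff g 0 = 0" "\<theta> f = g * f" using \<theta> by (auto simp: L0_def)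
    moreover obtain h where "cps_coeff h 0 = 0" "\<eta> f = h * f" using \<eta> by (auto simp: L0_def)
    ultimately
    show ?thesis using \<theta> \<eta>
      by (auto simp: L0_def log_Der_closed distrib_right intro!: exI[of _ "g + h"])
  qed
  have L0_scale: "vf_scale (cps_const c) \<theta> \<in> L0" if \<theta>: "\<theta> \<in> L0" for c \<theta>
  proof -
    obtain g where g: "cps_coeff g 0 = 0" "\<theta> f = g * f" using \<theta> by (auto simp: L0_def)
    hence "vf_scale (cps_const c) \<theta> f = (cps_const c * g) * f" by (simp add: vf_scale_def mult.assoc)
    thus ?thesis using \<theta> g(1)
      by (auto simp: L0_def log_Der_closed intro!: exI[of _ "cps_const c * g"])
  qed
  have L0_bracket: "vf_bracket \<theta> \<eta> \<in> L0" if \<theta>: "\<theta> \<in> log_Der f" and \<eta>: "\<eta> \<in> log_Der f" for \<theta> \<eta>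
  proof -
    obtain a b where ab: "\<theta> f = f * a" "\<eta> f = f * b"
      using log_DerD(2)[OF \<theta>] log_DerD(2)[OF \<eta>] by (elim dvdE)
    \<comment> \<open>The products of \<open>a\<close> and \<open>b\<close> cancel, and the
      remaining multiplier has no constant term because logarithmic fields vanish at 0.\<close>
    have "vf_bracket \<theta> \<eta> f = (\<theta> b - \<eta> a) * f"
      by (simp add: vf_bracket_def ab cps_DerD[OF Der[OF \<theta>]] cps_DerD[OF Der[OF \<eta>]] algebra_simps)
    thus ?thesis
      using maps0[OF \<theta>, of b] maps0[OF \<eta>, of a] log_Der_closed(4)[OF \<theta> \<eta>]
      by (auto simp: L0_def intro!: exI[of _ "\<theta> b - \<eta> a"])
  qed
  have lin_bracket: "linear_part (vf_bracket \<theta> \<eta>) = mcomm (linear_part \<eta>) (linear_part \<theta>)"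
    if "\<theta> \<in> log_Der f" "\<eta> \<in> log_Der f" for \<theta> \<eta>
    by (rule linear_part_bracket) (use that Der maps0 in auto)
  define n where "n = linear_part ` L0"
  have "\<exists>N. nil_products N n"
  proof (rule engel)
    show "subspace n"
    proof (rule subspaceI)
      show "0 \<in> n"
        unfolding n_def by (rule image_eqI[OF _ L0_zero]) (simp add: linear_part_def vec_eq_iff)
      show "A + B \<in> n" if "A \<in> n" "B \<in> n" for A B
        using that L0_add unfolding n_def by (auto simp flip: linear_part_add)
      show "c *\<^sub>R A \<in> n" if A: "A \<in> n" for c A
      proof -
        obtain \<theta> where \<theta>: "\<theta> \<in> L0" "A = linear_part \<theta>" using A by (auto simp: n_def)
        have "c *\<^sub>R A = linear_part (vf_scale (cps_const (of_real c)) \<theta>)"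
          by (simp only: vec_eq_iff linear_part_scale \<theta>(2) vector_scaleR_component)
             (simp add: scaleR_conv_of_real)
        thus ?thesis using L0_scale[OF \<theta>(1)] by (simp add: n_def)
      qed
    qed
    show "mcomm A B \<in> n" if "A \<in> n" "B \<in> n" for A B
      using that L0_bracket L0_D unfolding n_def by (auto simp: lin_bracket[symmetric])
    show "\<exists>M. mprod (replicate M A) = 0" if A: "A \<in> n" for A
    proof -
      obtain \<theta> where \<theta>: "\<theta> \<in> L0" "A = linear_part \<theta>" using A by (auto simp: n_def)
      then obtain g where g: "cps_coeff g 0 = 0" "\<theta> f = g * f" by (auto simp: L0_def)
      show ?thesis
        unfolding \<theta>(2)
        by (rule no_eigenvalue_imp_nilpotent,
            rule linear_part_no_eigenvalue[OF assms(4) ord Der[OF L0_D[OF \<theta>(1)]] g(2,1) maps0[OF L0_D[OF \<theta>(1)]]])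
    qed
  qed
  then obtain N0 where "nil_products N0 n" by blast
  \<comment> \<open>The successor makes \<open>N\<close> positive, so that \<open>N \<le> k\<close>
    rules out the exceptional case \<open>k = 0\<close> of \<open>P\<close>.\<close>
  define N where "N = Suc N0"
  have N: "mprod xs = 0" if "set xs \<subseteq> n" "N \<le> length xs" for xs
    using nil_products_ge[OF \<open>nil_products N0 n\<close> that(1)] that(2) by (simp add: N_def)
  \<comment> \<open>The annihilation property shared by all \<open>k\<close>-fold products of elements of \<open>n\<close>.\<close>
  define Ann where "Ann k = {A :: complex ^ 'n ^ 'n. \<forall>xs. set xs \<subseteq> n \<longrightarrow> N \<le> length xs + k \<longrightarrow> A ** mprod xs = 0}" for k
  \<comment> \<open>Before step \<open>N\<close> only vanishing at 0 is known. At step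
    \<open>N\<close> the linear part is gone, which means order 2, and each later bracket gains at
    least one order.\<close>
  define vo where "vo k = (if k < N then 1 else k - N + 2)" for k
  define P where "P k = (if k = 0 then log_Der f else
      {\<theta> \<in> L0. linear_part \<theta> \<in> Ann k \<and> (\<forall>i. cps_ord_ge (vo k) (\<theta> (cps_var i)))})" for k
  have P_D: "\<theta> \<in> log_Der f" if "\<theta> \<in> P k" for \<theta> k
    using that L0_D by (auto simp: P_def split: if_splits)
  have P_sub: "submodule (P k) complex_ring (vf_lie (log_Der f))" for k
  proof (rule submodule_vf_lieI)
    show "P k \<subseteq> log_Der f" using P_D by blast
    show "0 \<in> P k"
    proof -
      have "linear_part 0 = (0 :: complex ^ 'n ^ 'n)" by (simp add: linear_part_def vec_eq_iff)
      thus ?thesis using L0_zero by (simp add: P_def log_Der_closed Ann_def)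
    qed
    show "\<theta> + \<eta> \<in> P k" if "\<theta> \<in> P k" "\<eta> \<in> P k" for \<theta> \<eta>
      using that L0_add
      by (auto simp: P_def log_Der_closed Ann_def linear_part_add matrix_mult_bilinear_simps
          intro: cps_ord_ge_add split: if_splits)
    show "vf_scale (cps_const c) \<theta> \<in> P k" if \<theta>: "\<theta> \<in> P k" for c \<theta>
    proof -
      have "linear_part (vf_scale (cps_const c) \<theta>) ** B = 0" if "linear_part \<theta> ** B = 0" for B :: "complex ^ 'n ^ 'n"
        using that by (simp add: vec_eq_iff matrix_matrix_mult_def linear_part_scale mult.assoc
            flip: sum_distrib_left)
      moreover have "cps_ord_ge m (vf_scale (cps_const c) \<theta> h)" if "cps_ord_ge m (\<theta> h)" for m h
        using that by (simp add: cps_ord_ge_def vf_scale_def)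
      ultimately show ?thesis
        using \<theta> L0_scale by (auto simp: P_def log_Der_closed Ann_def split: if_splits)
    qed
  qed
  have P_bracket: "vf_bracket \<theta> \<eta> \<in> P (Suc k)" if \<theta>: "\<theta> \<in> P k" and \<eta>: "\<eta> \<in> P k" for \<theta> \<eta> k
  proof -
    note \<theta>L = P_D[OF \<theta>] and \<eta>L = P_D[OF \<eta>]
    have br0: "vf_bracket \<theta> \<eta> \<in> L0" by (rule L0_bracket[OF \<theta>L \<eta>L])
    have ann: "linear_part (vf_bracket \<theta> \<eta>) \<in> Ann (Suc k)"
    proof (cases "k = 0")
      case True
      have "linear_part (vf_bracket \<theta> \<eta>) \<in> n" using br0 by (simp add: n_def)
      hence "linear_part (vf_bracket \<theta> \<eta>) ** mprod xs = 0" if "set xs \<subseteq> n" "N \<le> length xs + 1" for xs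
        using N[of "linear_part (vf_bracket \<theta> \<eta>) # xs"] that by simp
      thus ?thesis using True by (simp add: Ann_def)
    next
      case False
      \<comment> \<open>The linear part of \<open>\<eta>\<close> is itself in \<open>n\<close> and
        counts as one more letter of the word annihilated by that of
        \<open>\<theta>\<close>.\<close>
      have *: "(linear_part \<theta> ** linear_part \<eta>) ** mprod xs = 0"
        if "\<theta> \<in> P k" "\<eta> \<in> P k" "set xs \<subseteq> n" "N \<le> length xs + Suc k" for \<theta> \<eta> xs
      proof -
        have "linear_part \<eta> \<in> n" "linear_part \<theta> \<in> Ann k"
          using that(1,2) False by (auto simp: P_def n_def)
        moreover have "set (linear_part \<eta> # xs) \<subseteq> n" "N \<le> length (linear_part \<eta> # xs) + k"
          using that(3,4) \<open>linear_part \<eta> \<in> n\<close> by auto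
        ultimately have "linear_part \<theta> ** mprod (linear_part \<eta> # xs) = 0"
          unfolding Ann_def by blast
        thus ?thesis by (simp add: matrix_mul_assoc)
      qed
      thus ?thesis
        using \<theta> \<eta> by (auto simp: Ann_def lin_bracket[OF \<theta>L \<eta>L] mcomm_def matrix_mult_bilinear_simps)
    qed
    have "cps_ord_ge (vo (Suc k)) (vf_bracket \<theta> \<eta> (cps_var i))" for i
    proof -
      have coeff0: "cps_coeff (vf_bracket \<theta> \<eta> (cps_var i)) 0 = 0"
        by (rule maps0[OF L0_D[OF br0]])
      consider "Suc k < N" | "Suc k = N" | "N \<le> k" by linarith
      thus ?thesis
      proof cases
        case 1
        thus ?thesis using coeff0 by (simp add: vo_def cps_ord_ge_Suc_0)
      next
        case 2
        \<comment> \<open>At this step the empty word is long enough, so the linear part itself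
          vanishes.\<close>
        have "linear_part (vf_bracket \<theta> \<eta>) ** mprod [] = 0"
          using ann 2 by (simp add: Ann_def del: mprod_simps)
        hence "cps_coeff (vf_bracket \<theta> \<eta> (cps_var i)) (mexp j) = 0" for j
          by (simp add: linear_part_def vec_eq_iff)
        hence "cps_ord_ge 2 (vf_bracket \<theta> \<eta> (cps_var i))"
          unfolding cps_ord_ge_def using coeff0 by (metis mdeg_eq_1_cases)
        thus ?thesis using 2 by (simp add: vo_def numeral_2_eq_2)
      next
        case 3
        define d where "d = k - N"
        have k: "k \<noteq> 0" "vo k = Suc (Suc d)" "vo (Suc k) = Suc (Suc (Suc d))"
          using 3 by (auto simp: vo_def d_def N_def)
        have ho: "cps_ord_ge (Suc (Suc d)) (\<theta> (cps_var j))" "cps_ord_ge (Suc (Suc d)) (\<eta> (cps_var j))" for j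
          using \<theta> \<eta> k by (auto simp: P_def)
        \<comment> \<open>Two fields of order \<open>d + 2\<close> have a bracket of order
          \<open>2 * d + 3\<close>, at least the required \<open>d + 3\<close>.\<close>
        have "cps_ord_ge (Suc (Suc d) + Suc d) (vf_bracket \<theta> \<eta> (cps_var i))"
          unfolding vf_bracket_def
          by (intro cps_ord_ge_diff cps_Der_ord_ge Der \<theta>L \<eta>L ho)
        thus ?thesis unfolding k by (rule cps_ord_ge_mono) simp
      qed
    qed
    thus ?thesis using br0 ann by (simp add: P_def)
  qed
  \<comment> \<open>A derivation is determined by its values on the coordinates, so division takes
    place in the module of component vectors.\<close>
  obtain K where K: "\<And>u. u \<in> (\<lambda>\<theta> i. \<theta> (cps_var i)) ` log_Der f \<Longrightarrow> (\<And>j. cps_ord_ge K (u j)) \<Longrightarrow>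
      \<exists>F q ub. finite F \<and> (\<forall>b\<in>F. q b \<in> cps_max_ideal \<and> ub b \<in> (\<lambda>\<theta> i. \<theta> (cps_var i)) ` log_Der f) \<and>
        u = (\<lambda>j. \<Sum>b\<in>(F :: 'n vexp set). q b * ub b j)"
  proof (rule high_order_in_max_ideal_multiple[of "(\<lambda>\<theta> i. \<theta> (cps_var i)) ` log_Der f"])
    fix u v assume "u \<in> (\<lambda>\<theta> i. \<theta> (cps_var i)) ` log_Der f" "v \<in> (\<lambda>\<theta> i. \<theta> (cps_var i)) ` log_Der f"
    then obtain \<theta> \<eta> where "\<theta> \<in> log_Der f" "\<eta> \<in> log_Der f" "u = (\<lambda>i. \<theta> (cps_var i))" "v = (\<lambda>i. \<eta> (cps_var i))"
      by blast
    thus "(\<lambda>j. u j + v j) \<in> (\<lambda>\<theta> i. \<theta> (cps_var i)) ` log_Der f"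
      by (intro image_eqI[of _ _ "\<theta> + \<eta>"]) (auto simp: log_Der_closed)
  next
    fix g u assume "u \<in> (\<lambda>\<theta> i. \<theta> (cps_var i)) ` log_Der f"
    then obtain \<theta> where "\<theta> \<in> log_Der f" "u = (\<lambda>i. \<theta> (cps_var i))" by blast
    thus "(\<lambda>j. g * u j) \<in> (\<lambda>\<theta> i. \<theta> (cps_var i)) ` log_Der f"
      by (intro image_eqI[of _ _ "vf_scale g \<theta>"] log_Der_closed(3)) (auto simp: vf_scale_def)
  qed blast
  have "P (N + K) \<subseteq> J"
  proof
    fix \<theta> assume \<theta>: "\<theta> \<in> P (N + K)"
    have "cps_ord_ge (K + 2) (\<theta> (cps_var i))" for i
      using \<theta> by (simp add: P_def vo_def N_def)
    hence "cps_ord_ge K (\<theta> (cps_var i))" for i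
      by (rule cps_ord_ge_mono) simp
    then obtain F q ub where F: "finite F" "\<And>b. b \<in> F \<Longrightarrow> q b \<in> cps_max_ideal"
      "\<And>b. b \<in> F \<Longrightarrow> ub b \<in> (\<lambda>\<theta> i. \<theta> (cps_var i)) ` log_Der f"
      "(\<lambda>i. \<theta> (cps_var i)) = (\<lambda>j. \<Sum>b\<in>(F :: 'n vexp set). q b * ub b j)"
      using K[OF imageI[OF P_D[OF \<theta>]]] by blast
    have "\<forall>b\<in>F. \<exists>\<eta>. \<eta> \<in> log_Der f \<and> ub b = (\<lambda>i. \<eta> (cps_var i))" using F(3) by blast
    from bchoice[OF this] obtain \<eta> where \<eta>: "\<And>b. b \<in> F \<Longrightarrow> \<eta> b \<in> log_Der f"
      "\<And>b. b \<in> F \<Longrightarrow> ub b = (\<lambda>i. \<eta> b (cps_var i))" by blast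
    have "\<theta> h = (\<Sum>b\<in>F. vf_scale (q b) (\<eta> b)) h" for h
    proof -
      have "\<theta> h = (\<Sum>i\<in>UNIV. (\<Sum>b\<in>F. q b * \<eta> b (cps_var i)) * cps_pderiv i h)"
        using cps_Der_expand[OF Der[OF P_D[OF \<theta>]], of h] fun_cong[OF F(4)] \<eta>(2) by simp
      also have "\<dots> = (\<Sum>b\<in>F. q b * (\<Sum>i\<in>UNIV. \<eta> b (cps_var i) * cps_pderiv i h))"
        unfolding sum_distrib_left sum_distrib_right by (subst sum.swap) (simp add: mult.assoc)
      also have "\<dots> = (\<Sum>b\<in>F. vf_scale (q b) (\<eta> b) h)"
        by (intro sum.cong) (simp_all add: vf_scale_def flip: cps_Der_expand[OF Der[OF \<eta>(1)]])
      also have "\<dots> = (\<Sum>b\<in>F. vf_scale (q b) (\<eta> b)) h"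
        by (induction F rule: infinite_finite_induct) auto
      finally show ?thesis .
    qed
    hence "\<theta> = (\<Sum>b\<in>F. vf_scale (q b) (\<eta> b))" by blast
    also have "\<dots> \<in> J"
      using F(1,2) \<eta>(1) unfolding J_def
    proof (induction F rule: finite_induct)
      case (insert b F)
      have "vf_scale (q b) (\<eta> b) + (\<Sum>b\<in>F. vf_scale (q b) (\<eta> b)) \<in>
          ideal_smult vf_scale cps_max_ideal (log_Der f)"
        using insert by (intro ideal_smult_closed(1,3)[OF module_vf_scale]) auto
      thus ?case unfolding sum.insert[OF insert.hyps] .
    qed (simp add: ideal_smult_closed[OF module_vf_scale])
    finally show "\<theta> \<in> J" .
  qed
  hence "lie_derived_series complex_ring (lie_quotient (vf_lie (log_Der f)) J) (N + K) =
      {\<zero>\<^bsub>lie_quotient (vf_lie (log_Der f)) J\<^esub>}"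
  proof (intro J.lie_quotient_derived_series_eq_zero[of P] P_sub)
    show "P 0 = carrier (vf_lie (log_Der f))" by (simp add: P_def vf_lie_def)
  qed (auto simp: vf_lie_def P_bracket)
  thus ?thesis
    unfolding initial_log_lie_algebra_def J_def[symmetric]
    by (intro solvable_lie_algebra.intro solvable_lie_algebra_axioms.intro J.lie_algebra_lie_quotient) blast
qed

end
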